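(* Let $\zeta$ be a formal parameter, let $U(\mathfrak{sl}_3)[[\zeta]]$ carry the standard (undeformed) coproduct $\Delta$, and put $\sigma=\ln(1-\zeta E_{12})$. Then the element $$ F_{\mathfrak p}=\bigl(1\otimes 1-\zeta\,1\otimes E_{23}+\zeta^{2}D_{2}\otimes E_{13}e^{-\sigma}\bigr)^{(D_{2}\otimes 1)}\cdot\exp\bigl(\zeta\,E_{32}\otimes E_{13}e^{-\sigma}\bigr)\cdot\exp\bigl(D_{1}\otimes\sigma\bigr) $$ of $(U(\mathfrak{sl}_3)\otimes U(\mathfrak{sl}_3))[[\zeta]]$ is a twist of $U(\mathfrak{sl}_3)[[\zeta]]$, and the corresponding universal $R$-matrix $R_{\mathfrak p}=(F_{\mathfrak p})_{21}F_{\mathfrak p}^{-1}$ quantizes the boundary $r$-matrix $r_{\mathfrak p}=D_1\wedge E_{12}+D_2\wedge E_{23}+E_{13}\wedge E_{32}$, i.e. $$R_{\mathfrak p}=1\otimes 1+\zeta\, r_{\mathfrak p}+O(\zeta^2).$$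
   Context: $E_{ij}$ ($1\le i,j\le 3$) are the matrix units; $E_{ij}$ with $i\neq j$, and the traceless diagonal combinations of the $E_{ii}$, are viewed as elements of $\mathfrak{sl}_3\subset U(\mathfrak{sl}_3)$ over a field of characteristic $0$. For $p=1,2$, $$D_p=\frac{3-p}{3}(E_{11}+\cdots+E_{pp})-\frac p3(E_{p+1,p+1}+\cdots+E_{33}).$$ Thus $e^{-\sigma}=(1-\zeta E_{12})^{-1}$. All tensor products are $\zeta$-adically completed. For $D$ in the Cartan subalgebra and $x\in\zeta\,(U\otimes U)[[\zeta]]$ commuting with $D\otimes 1$, $(1\otimes 1+x)^{(D\otimes 1)}:=\exp\bigl((D\otimes 1)\ln(1\otimes 1+x)\bigr)$. A twist of a (topological) Hopf algebra $H$ with coproduct $\Delta$ and counit $\varepsilon$ is an invertible element $F\in H\otimes H$ satisfying the Drinfeld equation $F_{12}(\Delta\otimes\mathrm{id})(F)=F_{23}(\mathrm{id}\otimes\Delta)(F)$ and $(\varepsilon\otimes\mathrm{id})(F)=(\mathrm{id}\otimes\varepsilon)(F)=1$. $F_{21}$ is $F$ with its tensor factors interchanged, and $a\wedge b=a\otimes b-b\otimes a$. *)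

theory Defs
  imports
    "HOL-Analysis.Determinants"
    "HOL-Library.Poly_Mapping"
    "HOL-Computational_Algebra.Formal_Power_Series"
begin

section \<open>Quotients of monoid algebras\<close>

text \<open>
  For a monoid \<open>'m\<close>, written additively as \<^theory>\<open>HOL-Library.Poly_Mapping\<close> requires,
  the type \<open>'m \<Rightarrow>\<^sub>0 'k\<close> is the monoid algebra of \<open>'m\<close> over \<open>'k\<close>.
\<close>

inductive_set ideal_gen :: "'a::ring_1 set \<Rightarrow> 'a set" for S :: "'a set" where
  zero: "0 \<in> ideal_gen S"
| gen: "s \<in> S \<Longrightarrow> a * s * b \<in> ideal_gen S"
| add: "x \<in> ideal_gen S \<Longrightarrow> y \<in> ideal_gen S \<Longrightarrow> x + y \<in> ideal_gen S"

lemma ideal_gen_mult_left: "x \<in> ideal_gen S \<Longrightarrow> c * x \<in> ideal_gen S"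
proof (induction rule: ideal_gen.induct)
  case (gen s a b)
  then show ?case using ideal_gen.gen[of s S "c * a" b] by (simp add: mult.assoc)
qed (auto intro: ideal_gen.intros simp: distrib_left)

lemma ideal_gen_mult_right: "x \<in> ideal_gen S \<Longrightarrow> x * c \<in> ideal_gen S"
proof (induction rule: ideal_gen.induct)
  case (gen s a b)
  then show ?case using ideal_gen.gen[of s S a "b * c"] by (simp add: mult.assoc)
qed (auto intro: ideal_gen.intros simp: distrib_right)

lemma ideal_gen_uminus: "x \<in> ideal_gen S \<Longrightarrow> - x \<in> ideal_gen S"
  using ideal_gen_mult_left[of x S "- 1"] by simp

lemma ideal_gen_base: "s \<in> S \<Longrightarrow> s \<in> ideal_gen S"
  using ideal_gen.gen[of s S 1 1] by simp

lemma ideal_gen_hom_zero: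
  fixes h :: "'a::ring_1 \<Rightarrow> 'b::ring_1"
  assumes "x \<in> ideal_gen S" "\<And>a b. h (a + b) = h a + h b" "\<And>a b. h (a * b) = h a * h b"
    "\<And>s. s \<in> S \<Longrightarrow> h s = 0"
  shows "h x = 0"
  using assms(1)
proof (induction rule: ideal_gen.induct)
  case zero
  then show ?case using assms(2)[of 0 0] by simp
qed (simp_all add: assms(2-4))

definition ideal_rel :: "'a::ring_1 set \<Rightarrow> 'a \<Rightarrow> 'a \<Rightarrow> bool" where
  "ideal_rel S p q \<longleftrightarrow> p - q \<in> ideal_gen S"

lemma ideal_rel_equivp: "equivp (ideal_rel S)"
proof (rule equivpI)
  show "reflp (ideal_rel S)" by (auto simp: reflp_def ideal_rel_def ideal_gen.zero)
  show "symp (ideal_rel S)" using ideal_gen_uminus by (fastforce simp: symp_def ideal_rel_def)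
  show "transp (ideal_rel S)"
    using ideal_gen.add by (fastforce simp: transp_def ideal_rel_def)
qed

lemma ideal_rel_refl: "ideal_rel S p p"
  by (simp add: ideal_rel_def ideal_gen.zero)

lemma ideal_rel_eqI: "p = q \<Longrightarrow> ideal_rel S p q"
  by (simp add: ideal_rel_refl)

lemma ideal_rel_add: "ideal_rel S p q \<Longrightarrow> ideal_rel S p' q' \<Longrightarrow> ideal_rel S (p + p') (q + q')"
  using ideal_gen.add[of "p - q" S "p' - q'"] by (simp add: ideal_rel_def algebra_simps)

lemma ideal_rel_uminus: "ideal_rel S p q \<Longrightarrow> ideal_rel S (- p) (- q)"
  using ideal_gen_uminus[of "p - q" S] by (simp add: ideal_rel_def algebra_simps)

lemma ideal_rel_diff: "ideal_rel S p q \<Longrightarrow> ideal_rel S p' q' \<Longrightarrow> ideal_rel S (p - p') (q - q')"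
  using ideal_rel_add[OF _ ideal_rel_uminus, of S p q p' q'] by simp

lemma ideal_rel_mult: "ideal_rel S p q \<Longrightarrow> ideal_rel S p' q' \<Longrightarrow> ideal_rel S (p * p') (q * q')"
  using ideal_gen.add[OF ideal_gen_mult_right[of "p - q" S p'] ideal_gen_mult_left[of "p' - q'" S q]]
  by (simp add: ideal_rel_def algebra_simps)

lemma ideal_rel_hom:
  fixes h :: "'a::ring_1 \<Rightarrow> 'b::ring_1"
  assumes "ideal_rel S p q" "\<And>a b. h (a + b) = h a + h b" "\<And>a b. h (a * b) = h a * h b"
    "\<And>s. s \<in> S \<Longrightarrow> h s = 0"
  shows "h p = h q"
proof -
  have "h (p - q) = 0"
    using assms(1) unfolding ideal_rel_def by (rule ideal_gen_hom_zero) (fact assms(2-4))+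
  then show ?thesis using assms(2)[of "p - q" q] by simp
qed

lemma single_add_induct [case_names single plus]:
  fixes p :: "'m \<Rightarrow>\<^sub>0 'k::comm_monoid_add"
  assumes single: "\<And>m c. P (Poly_Mapping.single m c)"
    and plus: "\<And>p q. P p \<Longrightarrow> P q \<Longrightarrow> P (p + q)"
  shows "P p"
proof (induction p rule: Poly_Mapping.update_induct)
  case const
  then show ?case using single[of undefined 0] by simp
next
  case (update f a b)
  have "Poly_Mapping.update a b f = f + Poly_Mapping.single a b"
    using update(1)
    by (intro poly_mapping_eqI)
      (auto simp: lookup_update lookup_add lookup_single when_def in_keys_iff)
  then show ?case using plus[OF update(3) single] by simp
qed

text \<open>
  The \<open>'k\<close>-linear extension of a map \<open>\<phi>\<close> on the monoid, for a target ring in which the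
  scalars of \<open>'k\<close> are embedded by \<open>\<eta>\<close>.
\<close>

definition malg_lift :: "('k::zero \<Rightarrow> 'b::ring_1) \<Rightarrow> ('m \<Rightarrow> 'b) \<Rightarrow> ('m \<Rightarrow>\<^sub>0 'k) \<Rightarrow> 'b" where
  "malg_lift \<eta> \<phi> p = (\<Sum>m\<in>Poly_Mapping.keys p. \<eta> (Poly_Mapping.lookup p m) * \<phi> m)"

locale scalars =
  fixes \<eta> :: "'k::field \<Rightarrow> 'b::ring_1"
  assumes scal_add: "\<eta> (a + b) = \<eta> a + \<eta> b"
    and scal_mult: "\<eta> (a * b) = \<eta> a * \<eta> b"
    and scal_one: "\<eta> 1 = 1"
    and scal_comm: "\<eta> a * x = x * \<eta> a"
begin

lemma scal_zero: "\<eta> 0 = 0"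
  using scal_add[of 0 0] by simp

lemma malg_lift_single: "malg_lift \<eta> \<phi> (Poly_Mapping.single m c) = \<eta> c * \<phi> m"
  by (cases "c = 0") (simp_all add: malg_lift_def scal_zero)

lemma malg_lift_zero: "malg_lift \<eta> \<phi> 0 = 0"
  by (simp add: malg_lift_def)

lemma malg_lift_one: "malg_lift \<eta> \<phi> 1 = \<phi> 0"
  using malg_lift_single[of \<phi> 0 1] by (simp add: scal_one)

lemma malg_lift_superset:
  "finite A \<Longrightarrow> Poly_Mapping.keys p \<subseteq> A \<Longrightarrow>
    malg_lift \<eta> \<phi> p = (\<Sum>m\<in>A. \<eta> (Poly_Mapping.lookup p m) * \<phi> m)"
  unfolding malg_lift_def by (rule sum.mono_neutral_left) (auto simp: in_keys_iff scal_zero)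

lemma malg_lift_add: "malg_lift \<eta> \<phi> (p + q) = malg_lift \<eta> \<phi> p + malg_lift \<eta> \<phi> q"
proof -
  let ?A = "Poly_Mapping.keys p \<union> Poly_Mapping.keys q"
  have "malg_lift \<eta> \<phi> r = (\<Sum>m\<in>?A. \<eta> (Poly_Mapping.lookup r m) * \<phi> m)"
    if "r \<in> {p, q, p + q}" for r
    using that keys_add[of p q] by (intro malg_lift_superset) auto
  then show ?thesis by (simp add: lookup_add scal_add distrib_right sum.distrib)
qed

lemma malg_lift_diff: "malg_lift \<eta> \<phi> (p - q) = malg_lift \<eta> \<phi> p - malg_lift \<eta> \<phi> q"
  using malg_lift_add[of \<phi> "p - q" q] by simp

lemma malg_lift_mult:
  fixes p q :: "'m::monoid_add \<Rightarrow>\<^sub>0 'k"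
  assumes "\<And>s t. \<phi> (s + t) = \<phi> s * \<phi> t"
  shows "malg_lift \<eta> \<phi> (p * q) = malg_lift \<eta> \<phi> p * malg_lift \<eta> \<phi> q"
proof (induction p rule: single_add_induct)
  case (single m c)
  show ?case
  proof (induction q rule: single_add_induct)
    case (single n d)
    have "\<eta> c * \<eta> d * (\<phi> m * \<phi> n) = \<eta> c * (\<eta> d * \<phi> m) * \<phi> n"
      by (simp add: mult.assoc)
    also have "\<dots> = \<eta> c * \<phi> m * (\<eta> d * \<phi> n)"
      by (simp add: scal_comm[of d "\<phi> m"] mult.assoc)
    finally show ?case
      by (simp add: mult_single malg_lift_single scal_mult assms)
  qed (simp_all add: distrib_left malg_lift_add)
qed (simp_all add: distrib_right malg_lift_add)

end

lemma scalars_id: "scalars (\<lambda>c::'k::field. c)"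
  by standard simp_all


section \<open>The Lie algebra\<close>

typedef (overloaded) ('k::field) sl3 = "{A :: 'k^3^3. trace A = 0}"
  morphisms sl3_matrix Abs_sl3
  by (rule exI[of _ 0]) (simp add: trace_def)

setup_lifting type_definition_sl3

definition mscale :: "'k::field \<Rightarrow> 'k^3^3 \<Rightarrow> 'k^3^3" where
  "mscale c A = (\<chi> i j. c * A $ i $ j)"

lemma trace_mscale: "trace (mscale c A) = c * trace A"
  by (simp add: trace_def mscale_def sum_distrib_left)

lift_definition sl3_add :: "'k::field sl3 \<Rightarrow> 'k sl3 \<Rightarrow> 'k sl3" is "(+)"
  by (simp add: trace_add)

lift_definition sl3_scale :: "'k::field \<Rightarrow> 'k sl3 \<Rightarrow> 'k sl3" is mscale
  by (simp add: trace_mscale)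

lift_definition sl3_bracket :: "'k::field sl3 \<Rightarrow> 'k sl3 \<Rightarrow> 'k sl3" is "\<lambda>A B. A ** B - B ** A"
  unfolding trace_sub by (subst trace_mul_sym) simp

definition mat_unit :: "3 \<Rightarrow> 3 \<Rightarrow> 'k::field^3^3" where
  "mat_unit i j = (\<chi> a b. if a = i \<and> b = j then 1 else 0)"

definition cartan_mat :: "nat \<Rightarrow> 'k::field^3^3" where
  "cartan_mat p =
     mscale ((3 - of_nat p) / 3) (\<Sum>i=1..p. mat_unit (of_nat i) (of_nat i))
     - mscale (of_nat p / 3) (\<Sum>i=p+1..3. mat_unit (of_nat i) (of_nat i))"


lifting_forget sl3.lifting

section \<open>The enveloping algebra\<close>

datatype 'a free_monoid = Word (letters: "'a list")

instantiation free_monoid :: (type) monoid_add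
begin
definition "0 = Word []"
definition "v + w = Word (letters v @ letters w)"
instance by standard (simp_all add: zero_free_monoid_def plus_free_monoid_def)
end

abbreviation letter :: "'a \<Rightarrow> 'a free_monoid \<Rightarrow>\<^sub>0 'k::field" where
  "letter x \<equiv> Poly_Mapping.single (Word [x]) 1"

inductive_set U_relators :: "('k::field sl3 free_monoid \<Rightarrow>\<^sub>0 'k) set" where
  "letter (sl3_add x y) - (letter x + letter y) \<in> U_relators"
| "letter (sl3_scale c x) - Poly_Mapping.single 0 c * letter x \<in> U_relators"
| "letter (sl3_bracket x y) - (letter x * letter y - letter y * letter x) \<in> U_relators"

quotient_type (overloaded) 'k U =
  "('k::field) sl3 free_monoid \<Rightarrow>\<^sub>0 'k" / "ideal_rel U_relators"
  by (rule ideal_rel_equivp)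

abbreviation word_lift ::
    "('k::field \<Rightarrow> 'b::ring_1) \<Rightarrow> ('x \<Rightarrow> 'b) \<Rightarrow> ('x free_monoid \<Rightarrow>\<^sub>0 'k) \<Rightarrow> 'b" where
  "word_lift \<eta> f \<equiv> malg_lift \<eta> (\<lambda>w. prod_list (map f (letters w)))"

lemma (in scalars) word_lift_mult: "word_lift \<eta> f (p * q) = word_lift \<eta> f p * word_lift \<eta> f q"
  by (rule malg_lift_mult) (simp add: plus_free_monoid_def)

lemma (in scalars) word_lift_cong:
  assumes "ideal_rel U_relators p q"
    and "\<And>x y. f (sl3_add x y) = f x + f y"
    and "\<And>c x. f (sl3_scale c x) = \<eta> c * f x"
    and "\<And>x y. f (sl3_bracket x y) = f x * f y - f y * f x"
  shows "word_lift \<eta> f p = word_lift \<eta> f q"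
  using assms(1)
  by (rule ideal_rel_hom)
    (auto elim!: U_relators.cases simp: malg_lift_add malg_lift_diff word_lift_mult malg_lift_single assms
      scal_one zero_free_monoid_def)

instantiation U :: (field) ring_1
begin
lift_definition zero_U :: "'a U" is 0 .
lift_definition one_U :: "'a U" is 1 .
lift_definition plus_U :: "'a U \<Rightarrow> 'a U \<Rightarrow> 'a U" is "(+)" by (rule ideal_rel_add)
lift_definition minus_U :: "'a U \<Rightarrow> 'a U \<Rightarrow> 'a U" is "(-)" by (rule ideal_rel_diff)
lift_definition uminus_U :: "'a U \<Rightarrow> 'a U" is uminus by (rule ideal_rel_uminus)
lift_definition times_U :: "'a U \<Rightarrow> 'a U \<Rightarrow> 'a U" is "(*)" by (rule ideal_rel_mult)
instance
proof
  interpret scalars "\<lambda>c::'a. c" by (rule scalars_id)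
  have "\<not> ideal_rel (U_relators :: ('a sl3 free_monoid \<Rightarrow>\<^sub>0 'a) set) 0 1"
  proof
    assume "ideal_rel (U_relators :: ('a sl3 free_monoid \<Rightarrow>\<^sub>0 'a) set) 0 1"
    then have "word_lift (\<lambda>c. c) (\<lambda>_ :: 'a sl3. 0 :: 'a) (0 :: 'a sl3 free_monoid \<Rightarrow>\<^sub>0 'a)
        = word_lift (\<lambda>c. c) (\<lambda>_ :: 'a sl3. 0) 1"
      by (rule word_lift_cong[where f = "\<lambda>_. 0"]) simp_all
    then show False
      by (simp add: malg_lift_zero malg_lift_one zero_free_monoid_def)
  qed
  then show "(0 :: 'a U) \<noteq> 1" by transfer
qed (transfer; rule ideal_rel_eqI; simp add: algebra_simps)+
end

lift_definition scalU :: "'k::field \<Rightarrow> 'k U" is "Poly_Mapping.single 0" .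

definition \<iota> :: "'k::field sl3 \<Rightarrow> 'k U" where "\<iota> x = abs_U (letter x)"

lemma single_0_commute:
  fixes c :: "'k::field" and p :: "'m::monoid_add \<Rightarrow>\<^sub>0 'k"
  shows "Poly_Mapping.single 0 c * p = p * Poly_Mapping.single 0 c"
  by (induction p rule: single_add_induct) (simp_all add: mult_single algebra_simps)

global_interpretation scalU: scalars scalU
  by standard
    (transfer; rule ideal_rel_eqI; simp add: single_add mult_single single_0_commute)+

lemma \<iota>_add: "\<iota> (sl3_add x y) = \<iota> x + \<iota> y"
  by (auto simp: \<iota>_def plus_U.abs_eq U.abs_eq_iff ideal_rel_def
      intro!: ideal_gen_base U_relators.intros)

lemma \<iota>_scale: "\<iota> (sl3_scale c x) = scalU c * \<iota> x"
  by (auto simp: \<iota>_def scalU.abs_eq times_U.abs_eq U.abs_eq_iff ideal_rel_def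
      intro!: ideal_gen_base U_relators.intros)

lemma \<iota>_bracket: "\<iota> (sl3_bracket x y) = \<iota> x * \<iota> y - \<iota> y * \<iota> x"
  by (auto simp: \<iota>_def times_U.abs_eq minus_U.abs_eq U.abs_eq_iff ideal_rel_def
      intro!: ideal_gen_base U_relators.intros)

lift_definition counit :: "'k::field U \<Rightarrow> 'k" is "word_lift (\<lambda>c. c) (\<lambda>_. 0)"
  by (rule scalars.word_lift_cong[OF scalars_id]) simp_all

lemma counit_add: "counit (a + b) = counit a + counit b"
  by transfer (rule scalars.malg_lift_add[OF scalars_id])

lemma counit_mult: "counit (a * b) = counit a * counit b"
  by transfer (rule scalars.word_lift_mult[OF scalars_id])

lemma counit_scal: "counit (scalU c) = c"
  by transfer (simp add: scalars.malg_lift_single[OF scalars_id] zero_free_monoid_def)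

lemma counit_one: "counit 1 = 1"
  using counit_scal[of 1] by (simp add: scalU.scal_one)

lemma counit_\<iota>: "counit (\<iota> x) = 0"
  by (simp add: \<iota>_def counit.abs_eq scalars.malg_lift_single[OF scalars_id])


lemma U_rep_abs: "ideal_rel U_relators (rep_U (abs_U p)) p"
  by (rule Quotient_rep_abs[OF Quotient_U ideal_rel_refl])

lifting_forget U.lifting


section \<open>Tensor products\<close>

text \<open>
  \<open>U \<otimes> U\<close> is the quotient of the free vector space on \<open>U \<times> U\<close> by bilinearity.
  The free vector space is the monoid algebra of the multiplicative monoid \<open>U \<times> U\<close>, and the
  product of a bilinearity relator with a pair is again a bilinearity relator; so
  the span of these relators is already an ideal, and the induced product is the
  componentwise one. Likewise for three factors.
\<close>

datatype 'a tup2 = Tup2 'a 'a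
datatype 'a tup3 = Tup3 'a 'a 'a

instantiation tup2 :: (monoid_mult) monoid_add
begin
definition "0 = Tup2 1 1"
fun plus_tup2 where "plus_tup2 (Tup2 a b) (Tup2 c d) = Tup2 (a * c) (b * d)"
instance
proof
  fix x y z :: "'a tup2"
  show "x + y + z = x + (y + z)" by (cases x; cases y; cases z) (simp add: mult.assoc)
  show "0 + x = x" "x + 0 = x" by (cases x; simp add: zero_tup2_def)+
qed
end

instantiation tup3 :: (monoid_mult) monoid_add
begin
definition "0 = Tup3 1 1 1"
fun plus_tup3 where
  "plus_tup3 (Tup3 a b c) (Tup3 a' b' c') = Tup3 (a * a') (b * b') (c * c')"
instance
proof
  fix x y z :: "'a tup3"
  show "x + y + z = x + (y + z)" by (cases x; cases y; cases z) (simp add: mult.assoc)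
  show "0 + x = x" "x + 0 = x" by (cases x; simp add: zero_tup3_def)+
qed
end

abbreviation pure2 :: "'k::field U \<Rightarrow> 'k U \<Rightarrow> 'k U tup2 \<Rightarrow>\<^sub>0 'k" where
  "pure2 a b \<equiv> Poly_Mapping.single (Tup2 a b) 1"

abbreviation pure3 :: "'k::field U \<Rightarrow> 'k U \<Rightarrow> 'k U \<Rightarrow> 'k U tup3 \<Rightarrow>\<^sub>0 'k" where
  "pure3 a b c \<equiv> Poly_Mapping.single (Tup3 a b c) 1"

inductive_set UU_relators :: "('k::field U tup2 \<Rightarrow>\<^sub>0 'k) set" where
  "pure2 (a + a') b - (pure2 a b + pure2 a' b) \<in> UU_relators"
| "pure2 a (b + b') - (pure2 a b + pure2 a b') \<in> UU_relators"
| "pure2 (scalU r * a) b - Poly_Mapping.single 0 r * pure2 a b \<in> UU_relators"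
| "pure2 a (scalU r * b) - Poly_Mapping.single 0 r * pure2 a b \<in> UU_relators"

inductive_set UUU_relators :: "('k::field U tup3 \<Rightarrow>\<^sub>0 'k) set" where
  "pure3 (a + a') b c - (pure3 a b c + pure3 a' b c) \<in> UUU_relators"
| "pure3 a (b + b') c - (pure3 a b c + pure3 a b' c) \<in> UUU_relators"
| "pure3 a b (c + c') - (pure3 a b c + pure3 a b c') \<in> UUU_relators"
| "pure3 (scalU r * a) b c - Poly_Mapping.single 0 r * pure3 a b c \<in> UUU_relators"
| "pure3 a (scalU r * b) c - Poly_Mapping.single 0 r * pure3 a b c \<in> UUU_relators"
| "pure3 a b (scalU r * c) - Poly_Mapping.single 0 r * pure3 a b c \<in> UUU_relators"

quotient_type (overloaded) 'k UU = "('k::field) U tup2 \<Rightarrow>\<^sub>0 'k" / "ideal_rel UU_relators"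
  by (rule ideal_rel_equivp)

quotient_type (overloaded) 'k UUU = "('k::field) U tup3 \<Rightarrow>\<^sub>0 'k" / "ideal_rel UUU_relators"
  by (rule ideal_rel_equivp)

abbreviation tup2_lift ::
    "('k::field \<Rightarrow> 'b::ring_1) \<Rightarrow> ('a \<Rightarrow> 'a \<Rightarrow> 'b) \<Rightarrow> ('a tup2 \<Rightarrow>\<^sub>0 'k) \<Rightarrow> 'b" where
  "tup2_lift \<eta> f \<equiv> malg_lift \<eta> (\<lambda>t. case t of Tup2 a b \<Rightarrow> f a b)"

abbreviation tup3_lift ::
    "('k::field \<Rightarrow> 'b::ring_1) \<Rightarrow> ('a \<Rightarrow> 'a \<Rightarrow> 'a \<Rightarrow> 'b) \<Rightarrow> ('a tup3 \<Rightarrow>\<^sub>0 'k) \<Rightarrow> 'b" where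
  "tup3_lift \<eta> f \<equiv> malg_lift \<eta> (\<lambda>t. case t of Tup3 a b c \<Rightarrow> f a b c)"

lemma (in scalars) tup2_lift_mult:
  assumes "\<And>a b a' b'. f (a * a') (b * b') = f a b * f a' b'"
  shows "tup2_lift \<eta> f (p * q) = tup2_lift \<eta> f p * tup2_lift \<eta> f q"
  by (rule malg_lift_mult) (auto simp: assms split: tup2.split)

lemma (in scalars) tup2_lift_cong:
  assumes "ideal_rel UU_relators p q"
    and "\<And>a b a' b'. f (a * a') (b * b') = f a b * f a' b'"
    and "f 1 1 = 1"
    and "\<And>a a' b. f (a + a') b = f a b + f a' b"
    and "\<And>a b b'. f a (b + b') = f a b + f a b'"
    and "\<And>r a b. f (scalU r * a) b = \<eta> r * f a b"
    and "\<And>r a b. f a (scalU r * b) = \<eta> r * f a b"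
  shows "tup2_lift \<eta> f p = tup2_lift \<eta> f q"
  using assms(1) malg_lift_add tup2_lift_mult[where f = f, OF assms(2)]
proof (rule ideal_rel_hom)
  fix s :: "'k U tup2 \<Rightarrow>\<^sub>0 'k"
  assume "s \<in> UU_relators"
  then show "tup2_lift \<eta> f s = 0"
    by (auto elim!: UU_relators.cases simp: malg_lift_add malg_lift_diff malg_lift_single
        tup2_lift_mult[where f = f, OF assms(2)] assms(3-) scal_one zero_tup2_def)
qed

lemma (in scalars) tup3_lift_cong:
  assumes "ideal_rel UUU_relators p q"
    and mult: "\<And>a b c a' b' c'. f (a * a') (b * b') (c * c') = f a b c * f a' b' c'"
    and "f 1 1 1 = 1"
    and "\<And>a a' b c. f (a + a') b c = f a b c + f a' b c"
    and "\<And>a b b' c. f a (b + b') c = f a b c + f a b' c"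
    and "\<And>a b c c'. f a b (c + c') = f a b c + f a b c'"
    and "\<And>r a b c. f (scalU r * a) b c = \<eta> r * f a b c"
    and "\<And>r a b c. f a (scalU r * b) c = \<eta> r * f a b c"
    and "\<And>r a b c. f a b (scalU r * c) = \<eta> r * f a b c"
  shows "tup3_lift \<eta> f p = tup3_lift \<eta> f q"
proof -
  have m: "tup3_lift \<eta> f (x * y) = tup3_lift \<eta> f x * tup3_lift \<eta> f y" for x y
    by (rule malg_lift_mult) (auto simp: mult split: tup3.split)
  show ?thesis
    using assms(1) malg_lift_add m
  proof (rule ideal_rel_hom)
    fix s :: "'k U tup3 \<Rightarrow>\<^sub>0 'k"
    assume "s \<in> UUU_relators"
    then show "tup3_lift \<eta> f s = 0"
      by (auto elim!: UUU_relators.cases simp: malg_lift_add malg_lift_diff malg_lift_single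
          m assms(3-) scal_one zero_tup3_def)
  qed
qed

instantiation UU :: (field) ring_1
begin
lift_definition zero_UU :: "'a UU" is 0 .
lift_definition one_UU :: "'a UU" is 1 .
lift_definition plus_UU :: "'a UU \<Rightarrow> 'a UU \<Rightarrow> 'a UU" is "(+)" by (rule ideal_rel_add)
lift_definition minus_UU :: "'a UU \<Rightarrow> 'a UU \<Rightarrow> 'a UU" is "(-)" by (rule ideal_rel_diff)
lift_definition uminus_UU :: "'a UU \<Rightarrow> 'a UU" is uminus by (rule ideal_rel_uminus)
lift_definition times_UU :: "'a UU \<Rightarrow> 'a UU \<Rightarrow> 'a UU" is "(*)" by (rule ideal_rel_mult)
instance
proof
  interpret scalars "\<lambda>c::'a. c" by (rule scalars_id)
  have "\<not> ideal_rel (UU_relators :: ('a U tup2 \<Rightarrow>\<^sub>0 'a) set) 0 1"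
  proof
    let ?f = "\<lambda>a b. counit a * counit (b :: 'a U)"
    assume "ideal_rel (UU_relators :: ('a U tup2 \<Rightarrow>\<^sub>0 'a) set) 0 1"
    then have "tup2_lift (\<lambda>c. c) ?f 0 = tup2_lift (\<lambda>c. c) ?f 1"
      by (rule tup2_lift_cong)
        (simp_all add: counit_add counit_mult counit_scal counit_one algebra_simps)
    then show False
      by (simp add: malg_lift_zero malg_lift_one zero_tup2_def counit_one)
  qed
  then show "(0 :: 'a UU) \<noteq> 1" by transfer
qed (transfer; rule ideal_rel_eqI; simp add: algebra_simps)+
end

instantiation UUU :: (field) ring_1
begin
lift_definition zero_UUU :: "'a UUU" is 0 .
lift_definition one_UUU :: "'a UUU" is 1 .
lift_definition plus_UUU :: "'a UUU \<Rightarrow> 'a UUU \<Rightarrow> 'a UUU" is "(+)" by (rule ideal_rel_add)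
lift_definition minus_UUU :: "'a UUU \<Rightarrow> 'a UUU \<Rightarrow> 'a UUU" is "(-)" by (rule ideal_rel_diff)
lift_definition uminus_UUU :: "'a UUU \<Rightarrow> 'a UUU" is uminus by (rule ideal_rel_uminus)
lift_definition times_UUU :: "'a UUU \<Rightarrow> 'a UUU \<Rightarrow> 'a UUU" is "(*)" by (rule ideal_rel_mult)
instance
proof
  interpret scalars "\<lambda>c::'a. c" by (rule scalars_id)
  have "\<not> ideal_rel (UUU_relators :: ('a U tup3 \<Rightarrow>\<^sub>0 'a) set) 0 1"
  proof
    let ?f = "\<lambda>a b c. counit a * counit b * counit (c :: 'a U)"
    assume "ideal_rel (UUU_relators :: ('a U tup3 \<Rightarrow>\<^sub>0 'a) set) 0 1"
    then have "tup3_lift (\<lambda>c. c) ?f 0 = tup3_lift (\<lambda>c. c) ?f 1"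
      by (rule tup3_lift_cong)
        (simp_all add: counit_add counit_mult counit_scal counit_one algebra_simps)
    then show False
      by (simp add: malg_lift_zero malg_lift_one zero_tup3_def counit_one)
  qed
  then show "(0 :: 'a UUU) \<noteq> 1" by transfer
qed (transfer; rule ideal_rel_eqI; simp add: algebra_simps)+
end

lift_definition scalUU :: "'k::field \<Rightarrow> 'k UU" is "Poly_Mapping.single 0" .
lift_definition scalUUU :: "'k::field \<Rightarrow> 'k UUU" is "Poly_Mapping.single 0" .

global_interpretation scalUU: scalars scalUU
  by standard
    (transfer; rule ideal_rel_eqI; simp add: single_add mult_single single_0_commute)+

global_interpretation scalUUU: scalars scalUUU
  by standard
    (transfer; rule ideal_rel_eqI; simp add: single_add mult_single single_0_commute)+

definition tensor2 :: "'k::field U \<Rightarrow> 'k U \<Rightarrow> 'k UU" (infixl \<open>\<otimes>\<^sub>U\<close> 75) where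
  "a \<otimes>\<^sub>U b = abs_UU (pure2 a b)"
definition tensor3 :: "'k::field U \<Rightarrow> 'k U \<Rightarrow> 'k U \<Rightarrow> 'k UUU" where
  "tensor3 a b c = abs_UUU (pure3 a b c)"

lemmas tensor2_abs = tensor2_def plus_UU.abs_eq times_UU.abs_eq scalUU.abs_eq UU.abs_eq_iff

lemma tensor2_add_left: "(a + a') \<otimes>\<^sub>U b = a \<otimes>\<^sub>U b + a' \<otimes>\<^sub>U b"
  unfolding tensor2_abs ideal_rel_def by (intro ideal_gen_base UU_relators.intros)

lemma tensor2_add_right: "a \<otimes>\<^sub>U (b + b') = a \<otimes>\<^sub>U b + a \<otimes>\<^sub>U b'"
  unfolding tensor2_abs ideal_rel_def by (intro ideal_gen_base UU_relators.intros)

lemma tensor2_scal_left: "(scalU r * a) \<otimes>\<^sub>U b = scalUU r * (a \<otimes>\<^sub>U b)"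
  unfolding tensor2_abs ideal_rel_def by (intro ideal_gen_base UU_relators.intros)

lemma tensor2_scal_right: "a \<otimes>\<^sub>U (scalU r * b) = scalUU r * (a \<otimes>\<^sub>U b)"
  unfolding tensor2_abs ideal_rel_def by (intro ideal_gen_base UU_relators.intros)

lemma tensor2_mult: "(a \<otimes>\<^sub>U b) * (c \<otimes>\<^sub>U d) = (a * c) \<otimes>\<^sub>U (b * d)"
  by (simp add: tensor2_def times_UU.abs_eq mult_single)

lemma tensor2_one: "1 \<otimes>\<^sub>U 1 = 1"
  by (simp add: tensor2_def one_UU_def flip: single_one zero_tup2_def)

lemma tensor2_diff_left: "(a - a') \<otimes>\<^sub>U b = a \<otimes>\<^sub>U b - a' \<otimes>\<^sub>U b"
  using tensor2_add_left[of "a - a'" a' b] by simp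

lemma tensor2_diff_right: "a \<otimes>\<^sub>U (b - b') = a \<otimes>\<^sub>U b - a \<otimes>\<^sub>U b'"
  using tensor2_add_right[of a "b - b'" b'] by simp

lemmas tensor3_abs = tensor3_def plus_UUU.abs_eq times_UUU.abs_eq scalUUU.abs_eq UUU.abs_eq_iff

lemma tensor3_add:
  "tensor3 (a + a') b c = tensor3 a b c + tensor3 a' b c"
  "tensor3 a (b + b') c = tensor3 a b c + tensor3 a b' c"
  "tensor3 a b (c + c') = tensor3 a b c + tensor3 a b c'"
  unfolding tensor3_abs ideal_rel_def by (intro ideal_gen_base UUU_relators.intros)+

lemma tensor3_scal:
  "tensor3 (scalU r * a) b c = scalUUU r * tensor3 a b c"
  "tensor3 a (scalU r * b) c = scalUUU r * tensor3 a b c"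
  "tensor3 a b (scalU r * c) = scalUUU r * tensor3 a b c"
  unfolding tensor3_abs ideal_rel_def by (intro ideal_gen_base UUU_relators.intros)+

lemma tensor3_mult: "tensor3 a b c * tensor3 a' b' c' = tensor3 (a * a') (b * b') (c * c')"
  by (simp add: tensor3_def times_UUU.abs_eq mult_single)

lemma tensor3_one: "tensor3 1 1 1 = 1"
  by (simp add: tensor3_def one_UUU_def flip: single_one zero_tup3_def)

lemma UU_induct [case_names tensor add]:
  fixes x :: "'k::field UU"
  assumes tensor: "\<And>a b. P (a \<otimes>\<^sub>U b)" and add: "\<And>x y. P x \<Longrightarrow> P y \<Longrightarrow> P (x + y)"
  shows "P x"
proof (induct x rule: UU.abs_induct)
  case (1 p)
  show ?case
  proof (induction p rule: single_add_induct)
    case (single m c)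
    obtain a b where m: "m = Tup2 a b" by (cases m)
    have "abs_UU (Poly_Mapping.single m c) = scalUU c * (a \<otimes>\<^sub>U b)"
      by (simp add: scalUU.abs_eq tensor2_def times_UU.abs_eq mult_single m)
    also have "\<dots> = (scalU c * a) \<otimes>\<^sub>U b" by (simp add: tensor2_scal_left)
    finally show ?case using tensor by simp
  next
    case (plus p q)
    then show ?case using add[of "abs_UU p" "abs_UU q"] by (simp add: plus_UU.abs_eq)
  qed
qed



lemma UU_rep_abs: "ideal_rel UU_relators (rep_UU (abs_UU p)) p"
  by (rule Quotient_rep_abs[OF Quotient_UU ideal_rel_refl])


section \<open>Structure maps\<close>

text \<open>
  Each map is the linear extension of its values on words in \<^term>\<open>\<iota> x\<close>, respectively on pure
  tensors, evaluated at a representative; the lemmas show independence of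
  the representative.
\<close>

definition comul :: "'k::field U \<Rightarrow> 'k UU" where
  "comul u = word_lift scalUU (\<lambda>x. \<iota> x \<otimes>\<^sub>U 1 + 1 \<otimes>\<^sub>U \<iota> x) (rep_U u)"

lemma comul_abs: "comul (abs_U p) = word_lift scalUU (\<lambda>x. \<iota> x \<otimes>\<^sub>U 1 + 1 \<otimes>\<^sub>U \<iota> x) p"
  unfolding comul_def using U_rep_abs
  by (rule scalUU.word_lift_cong)
    (simp_all add: \<iota>_add \<iota>_scale \<iota>_bracket tensor2_add_left tensor2_add_right tensor2_diff_left
      tensor2_diff_right tensor2_scal_left tensor2_scal_right algebra_simps tensor2_mult)

lemma comul_\<iota>: "comul (\<iota> x) = \<iota> x \<otimes>\<^sub>U 1 + 1 \<otimes>\<^sub>U \<iota> x"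
  by (simp add: \<iota>_def[of x] comul_abs scalUU.malg_lift_single scalUU.scal_one)

lemma comul_add: "comul (u + v) = comul u + comul v"
  by (induct u rule: U.abs_induct, induct v rule: U.abs_induct)
    (simp add: comul_abs plus_U.abs_eq scalUU.malg_lift_add)

lemma comul_mult: "comul (u * v) = comul u * comul v"
  by (induct u rule: U.abs_induct, induct v rule: U.abs_induct)
    (simp add: comul_abs times_U.abs_eq scalUU.word_lift_mult)

lemma comul_scal: "comul (scalU c) = scalUU c"
  by (simp add: comul_abs scalU.abs_eq scalUU.malg_lift_single zero_free_monoid_def)

lemma comul_one: "comul 1 = 1"
  using comul_scal[of 1] by (simp add: scalU.scal_one scalUU.scal_one)

definition flip2 :: "'k::field UU \<Rightarrow> 'k UU" where
  "flip2 x = tup2_lift scalUU (\<lambda>a b. b \<otimes>\<^sub>U a) (rep_UU x)"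

lemma flip2_abs: "flip2 (abs_UU p) = tup2_lift scalUU (\<lambda>a b. b \<otimes>\<^sub>U a) p"
  unfolding flip2_def using UU_rep_abs
  by (rule scalUU.tup2_lift_cong)
    (simp_all add: tensor2_add_left tensor2_add_right tensor2_scal_left tensor2_scal_right
      tensor2_mult tensor2_one)

definition leg12 :: "'k::field UU \<Rightarrow> 'k UUU" where
  "leg12 x = tup2_lift scalUUU (\<lambda>a b. tensor3 a b 1) (rep_UU x)"

lemma leg12_abs: "leg12 (abs_UU p) = tup2_lift scalUUU (\<lambda>a b. tensor3 a b 1) p"
  unfolding leg12_def using UU_rep_abs
  by (rule scalUUU.tup2_lift_cong)
    (simp_all add: tensor3_add tensor3_scal tensor3_mult tensor3_one)

definition leg23 :: "'k::field UU \<Rightarrow> 'k UUU" where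
  "leg23 x = tup2_lift scalUUU (\<lambda>a b. tensor3 1 a b) (rep_UU x)"

lemma leg23_abs: "leg23 (abs_UU p) = tup2_lift scalUUU (\<lambda>a b. tensor3 1 a b) p"
  unfolding leg23_def using UU_rep_abs
  by (rule scalUUU.tup2_lift_cong)
    (simp_all add: tensor3_add tensor3_scal tensor3_mult tensor3_one)

lemma legs_add:
  "leg12 (x + y) = leg12 x + leg12 y"
  "leg23 (x + y) = leg23 x + leg23 y"
  by (induct x rule: UU.abs_induct, induct y rule: UU.abs_induct,
      simp add: leg12_abs leg23_abs plus_UU.abs_eq scalUUU.malg_lift_add)+

lemma legs_mult:
  "leg12 (x * y) = leg12 x * leg12 y"
  "leg23 (x * y) = leg23 x * leg23 y"
  by (induct x rule: UU.abs_induct, induct y rule: UU.abs_induct,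
      simp add: leg12_abs leg23_abs times_UU.abs_eq scalUUU.tup2_lift_mult tensor3_mult)+

lemma legs_scal:
  "leg12 (scalUU c) = scalUUU c"
  "leg23 (scalUU c) = scalUUU c"
  by (simp_all add: leg12_abs leg23_abs scalUU.abs_eq scalUUU.malg_lift_single zero_tup2_def
      tensor3_one)

lemma legs_one: "leg12 1 = 1" "leg23 1 = 1"
  using legs_scal[of 1] by (simp_all add: scalUU.scal_one scalUUU.scal_one)

lemma legs_tensor:
  "leg12 (a \<otimes>\<^sub>U b) = tensor3 a b 1"
  "leg23 (a \<otimes>\<^sub>U b) = tensor3 1 a b"
  by (simp_all add: leg12_abs leg23_abs tensor2_def scalUUU.malg_lift_single scalUUU.scal_one)

lemma leg12_commute: "leg12 x * tensor3 1 1 b = tensor3 1 1 b * leg12 x"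
  by (induction x rule: UU_induct) (simp_all add: legs_tensor tensor3_mult legs_add algebra_simps)

lemma leg23_commute: "leg23 x * tensor3 a 1 1 = tensor3 a 1 1 * leg23 x"
  by (induction x rule: UU_induct) (simp_all add: legs_tensor tensor3_mult legs_add algebra_simps)

text \<open>\<open>comul_id\<close> is \<open>\<Delta> \<otimes> id\<close>, and \<open>id_comul\<close> is \<open>id \<otimes> \<Delta>\<close>.\<close>

definition comul_id :: "'k::field UU \<Rightarrow> 'k UUU" where
  "comul_id x = tup2_lift scalUUU (\<lambda>a b. leg12 (comul a) * tensor3 1 1 b) (rep_UU x)"

lemma comul_id_abs:
  "comul_id (abs_UU p) = tup2_lift scalUUU (\<lambda>a b. leg12 (comul a) * tensor3 1 1 b) p"
  unfolding comul_id_def using UU_rep_abs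
proof (rule scalUUU.tup2_lift_cong)
  fix a b a' b' :: "'a U" and r :: 'a
  show "leg12 (comul (a * a')) * tensor3 1 1 (b * b')
      = leg12 (comul a) * tensor3 1 1 b * (leg12 (comul a') * tensor3 1 1 b')" (is "?l = ?r")
  proof -
    have "?l = leg12 (comul a) * (leg12 (comul a') * tensor3 1 1 b) * tensor3 1 1 b'"
      by (simp add: comul_mult legs_mult tensor3_mult mult.assoc)
    also have "\<dots> = ?r" by (simp only: leg12_commute[of "comul a'" b] mult.assoc)
    finally show ?thesis .
  qed
  show "leg12 (comul a) * tensor3 1 1 (scalU r * b) = scalUUU r * (leg12 (comul a) * tensor3 1 1 b)"
    using scalUUU.scal_comm[of r "leg12 (comul a)"] by (simp add: tensor3_scal flip: mult.assoc)
qed (simp_all add: comul_add comul_mult comul_one comul_scal legs_add legs_mult legs_one legs_scal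
      tensor3_one tensor3_add tensor3_scal algebra_simps)

definition id_comul :: "'k::field UU \<Rightarrow> 'k UUU" where
  "id_comul x = tup2_lift scalUUU (\<lambda>a b. tensor3 a 1 1 * leg23 (comul b)) (rep_UU x)"

lemma id_comul_abs:
  "id_comul (abs_UU p) = tup2_lift scalUUU (\<lambda>a b. tensor3 a 1 1 * leg23 (comul b)) p"
  unfolding id_comul_def using UU_rep_abs
proof (rule scalUUU.tup2_lift_cong)
  fix a b a' b' :: "'a U" and r :: 'a
  show "tensor3 (a * a') 1 1 * leg23 (comul (b * b'))
      = tensor3 a 1 1 * leg23 (comul b) * (tensor3 a' 1 1 * leg23 (comul b'))" (is "?l = ?r")
  proof -
    have "?l = tensor3 a 1 1 * (tensor3 a' 1 1 * leg23 (comul b)) * leg23 (comul b')"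
      by (simp add: comul_mult legs_mult tensor3_mult flip: mult.assoc)
    also have "\<dots> = ?r" by (simp only: leg23_commute[of "comul b" a', symmetric] mult.assoc)
    finally show ?thesis .
  qed
  show "tensor3 a 1 1 * leg23 (comul (scalU r * b)) = scalUUU r * (tensor3 a 1 1 * leg23 (comul b))"
    using scalUUU.scal_comm[of r "tensor3 a 1 1"]
    by (simp add: comul_mult comul_scal legs_mult legs_scal flip: mult.assoc)
qed (simp_all add: comul_add comul_mult comul_one comul_scal legs_add legs_mult legs_one legs_scal
      tensor3_one tensor3_add tensor3_scal algebra_simps)

text \<open>\<open>\<epsilon> \<otimes> id\<close> and \<open>id \<otimes> \<epsilon>\<close>, with \<open>k \<otimes> U\<close> and \<open>U \<otimes> k\<close> identified with \<open>U\<close>.\<close>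

definition counit_id :: "'k::field UU \<Rightarrow> 'k U" where
  "counit_id x = tup2_lift scalU (\<lambda>a b. scalU (counit a) * b) (rep_UU x)"

definition id_counit :: "'k::field UU \<Rightarrow> 'k U" where
  "id_counit x = tup2_lift scalU (\<lambda>a b. scalU (counit b) * a) (rep_UU x)"

lemma scalU_left_commute: "a * (scalU r * b) = scalU r * (a * b)"
  using scalU.scal_comm[of r a] by (simp flip: mult.assoc)

lemma scalU_mult_bilinear: "scalU (r * s) * (a * b) = scalU r * a * (scalU s * b)"
  by (simp add: scalU.scal_mult mult.assoc scalU_left_commute[of a])

lemma counit_id_abs: "counit_id (abs_UU p) = tup2_lift scalU (\<lambda>a b. scalU (counit a) * b) p"
  unfolding counit_id_def using UU_rep_abs
proof (rule scalU.tup2_lift_cong)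
  fix a b a' b' :: "'a U" and r :: 'a
  show "scalU (counit (a * a')) * (b * b') = scalU (counit a) * b * (scalU (counit a') * b')"
    by (simp only: counit_mult scalU_mult_bilinear)
  show "scalU (counit a) * (scalU r * b) = scalU r * (scalU (counit a) * b)"
    by (rule scalU_left_commute)
qed (simp_all add: counit_add counit_mult counit_one counit_scal scalU.scal_add scalU.scal_mult
      scalU.scal_one distrib_left distrib_right mult.assoc)

lemma id_counit_abs: "id_counit (abs_UU p) = tup2_lift scalU (\<lambda>a b. scalU (counit b) * a) p"
  unfolding id_counit_def using UU_rep_abs
proof (rule scalU.tup2_lift_cong)
  fix a b a' b' :: "'a U" and r :: 'a
  show "scalU (counit (b * b')) * (a * a') = scalU (counit b) * a * (scalU (counit b') * a')"
    by (simp only: counit_mult scalU_mult_bilinear)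
  show "scalU (counit b) * (scalU r * a) = scalU r * (scalU (counit b) * a)"
    by (rule scalU_left_commute)
qed (simp_all add: counit_add counit_mult counit_one counit_scal scalU.scal_add scalU.scal_mult
      scalU.scal_one distrib_left distrib_right mult.assoc)

lemma structure_maps_tensor:
  "flip2 (a \<otimes>\<^sub>U b) = b \<otimes>\<^sub>U a"
  "comul_id (a \<otimes>\<^sub>U b) = leg12 (comul a) * tensor3 1 1 b"
  "id_comul (a \<otimes>\<^sub>U b) = tensor3 a 1 1 * leg23 (comul b)"
  "counit_id (a \<otimes>\<^sub>U b) = scalU (counit a) * b"
  "id_counit (a \<otimes>\<^sub>U b) = scalU (counit b) * a"
  by (simp_all add: flip2_abs comul_id_abs id_comul_abs counit_id_abs id_counit_abs tensor2_def
      scalU.malg_lift_single scalU.scal_one scalUU.malg_lift_single scalUU.scal_one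
      scalUUU.malg_lift_single scalUUU.scal_one)


section \<open>Formal power series\<close>

text \<open>
  The completed tensor powers of \<open>U[[\<zeta>]]\<close> are \<open>U[[\<zeta>]]\<close>, \<open>(U \<otimes> U)[[\<zeta>]]\<close>,
  \<open>(U \<otimes> U \<otimes> U)[[\<zeta>]]\<close>, with \<open>\<zeta>\<close> being \<^const>\<open>fps_X\<close>; the structure maps
  act on them coefficientwise.
\<close>

definition fps_coeffwise :: "('a \<Rightarrow> 'b) \<Rightarrow> 'a fps \<Rightarrow> 'b fps" where
  "fps_coeffwise h f = Abs_fps (\<lambda>n. h (fps_nth f n))"

definition fps_tensor :: "'k::field U fps \<Rightarrow> 'k U fps \<Rightarrow> 'k UU fps" (infixl \<open>\<otimes>\<^sub>\<zeta>\<close> 75) where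
  "f \<otimes>\<^sub>\<zeta> g = Abs_fps (\<lambda>n. \<Sum>i=0..n. fps_nth f i \<otimes>\<^sub>U fps_nth g (n - i))"

lemma tensor2_zero: "0 \<otimes>\<^sub>U b = 0" "a \<otimes>\<^sub>U 0 = 0"
  using tensor2_add_left[of 0 0 b] tensor2_add_right[of a 0 0] by simp_all

lemma fps_tensor_const: "fps_const a \<otimes>\<^sub>\<zeta> fps_const b = fps_const (a \<otimes>\<^sub>U b)"
  by (rule fps_ext) (auto simp: fps_tensor_def tensor2_zero intro!: sum.neutral)

lemma fps_tensor_one: "1 \<otimes>\<^sub>\<zeta> 1 = 1"
  using fps_tensor_const[of 1 1] by (simp add: tensor2_one)

text \<open>
  As with \<^const>\<open>fps_compose\<close>, the next two are meaningful only for \<open>f\<close> with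
  constant term \<open>0\<close>, respectively \<open>1\<close>.
\<close>

definition fexp :: "('k::field_char_0 \<Rightarrow> 'b::ring_1) \<Rightarrow> 'b fps \<Rightarrow> 'b fps" where
  "fexp \<eta> f = fps_compose (fps_coeffwise \<eta> (fps_exp 1)) f"

definition fln :: "('k::field_char_0 \<Rightarrow> 'b::ring_1) \<Rightarrow> 'b fps \<Rightarrow> 'b fps" where
  "fln \<eta> f = fps_compose (fps_coeffwise \<eta> (fps_ln 1)) (f - 1)"

definition fpow :: "'k::field_char_0 UU fps \<Rightarrow> 'k UU fps \<Rightarrow> 'k UU fps" where
  "fpow f d = fexp scalUU (d * fln scalUU f)"


section \<open>Twists\<close>

definition is_inverse :: "'a::monoid_mult \<Rightarrow> 'a \<Rightarrow> bool" where
  "is_inverse x y \<longleftrightarrow> x * y = 1 \<and> y * x = 1"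

definition is_twist :: "'k::field UU fps \<Rightarrow> bool" where
  "is_twist F \<longleftrightarrow>
     (\<exists>G. is_inverse F G) \<and>
     fps_coeffwise leg12 F * fps_coeffwise comul_id F
       = fps_coeffwise leg23 F * fps_coeffwise id_comul F \<and>
     fps_coeffwise counit_id F = 1 \<and>
     fps_coeffwise id_counit F = 1"

definition universal_R :: "'k::field UU fps \<Rightarrow> 'k UU fps" where
  "universal_R F = fps_coeffwise flip2 F * (THE G. is_inverse F G)"

definition wedge :: "'k::field U \<Rightarrow> 'k U \<Rightarrow> 'k UU" (infixl \<open>\<and>\<^sub>U\<close> 70) where
  "a \<and>\<^sub>U b = a \<otimes>\<^sub>U b - b \<otimes>\<^sub>U a"


section \<open>Elements\<close>

text \<open>Only meaningful for traceless matrices, as \<^const>\<open>Abs_sl3\<close> is unspecified elsewhere.\<close>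

definition U_of_matrix :: "'k::field^3^3 \<Rightarrow> 'k U" where
  "U_of_matrix A = \<iota> (Abs_sl3 A)"

definition E\<^sub>U :: "3 \<Rightarrow> 3 \<Rightarrow> 'k::field U" where
  "E\<^sub>U i j = U_of_matrix (mat_unit i j)"

definition D\<^sub>U :: "nat \<Rightarrow> 'k::field U" where
  "D\<^sub>U p = U_of_matrix (cartan_mat p)"

lemma trace_mat_unit: "i \<noteq> j \<Longrightarrow> trace (mat_unit i j) = 0"
  unfolding trace_def mat_unit_def by (intro sum.neutral) auto

lemma trace_mat_unit_diag: "trace (mat_unit i i :: 'k::field^3^3) = 1"
  by (simp add: trace_def mat_unit_def)

lemma trace_sum: "trace (sum f A) = (\<Sum>i\<in>A. trace (f i :: 'k::field^3^3))"
  by (induction A rule: infinite_finite_induct) (simp_all add: trace_add, simp_all add: trace_def)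

lemma trace_cartan_mat: "p \<le> 3 \<Longrightarrow> trace (cartan_mat p :: 'k::field^3^3) = 0"
  by (simp add: cartan_mat_def trace_sub trace_mscale trace_sum trace_mat_unit_diag of_nat_diff)

end

theory Submission
  imports Defs
begin

text \<open>
  The element is a product \<open>F = \<Phi> J\<close>. Put \<open>A = E13 exp(-\<sigma>)\<close>; then
  \<open>J = exp(\<zeta> E32 \<otimes> A) exp(D1 \<otimes> \<sigma>)\<close> is an extended Jordanian twist, and
  \<open>\<Phi> = (1 - \<zeta> 1 \<otimes> E23 + \<zeta>\<^sup>2 D2 \<otimes> A)\<close> to the power \<open>D2 \<otimes> 1\<close>. The cocycle equation for
  \<open>F\<close> splits into that of \<open>J\<close> for \<open>\<Delta>\<close> and that of \<open>\<Phi>\<close> for the twisted coproduct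
  \<open>\<Delta>\<^sub>J = J \<Delta> J\<^sup>-\<^sup>1\<close>.

  Under \<open>\<Delta>\<^sub>J\<close> the elements \<open>\<sigma>\<close>, \<open>A\<close> and \<open>D2\<close> are primitive, and
  \<open>\<Delta>\<^sub>J E23 = E23 \<otimes> 1 + 1 \<otimes> E23 - 2 \<zeta> D2 \<otimes> A\<close> (\<open>ext_jordanian_sigma\<close> to \<open>ext_jordanian_e23\<close>). That \<open>\<sigma>\<close>
  and \<open>A\<close> are primitive turns both sides of the equation for \<open>J\<close> into products of the same six
  exponentials, which agree after two transpositions (\<open>ext_jordanian_cocycle\<close>).

  For \<open>\<Phi>\<close>, let \<open>T(x) = 1 - \<zeta> E + \<zeta>\<^sup>2 x A\<close> with \<open>E = E23\<close> and \<open>x\<close> central, so that \<open>\<Phi>\<close> is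
  \<open>T(x)\<^sup>x\<close> at \<open>x = D2\<close>. From \<open>A E - E A = \<zeta> A\<^sup>2\<close> one gets
  \<open>T(x) T(y + 1) = T(y) T(x + 1)\<close>, and hence the recursion \<open>T(n + 1)\<^sup>n\<^sup>+\<^sup>1 = T(n)\<^sup>n T(2 n + 1)\<close>. The
  first tensor factor enters the cocycle equation of \<open>\<Phi>\<close> only through \<open>x = D2\<close>, and the coefficient
  of each power of \<open>\<zeta>\<close> is polynomial in \<open>x\<close>. As a polynomial is determined by its values at natural
  numbers, it suffices to treat \<open>x = n\<close>, and there induction on \<open>n\<close> applies, by the recursion
  (\<open>twist_base_cocycle_of_nat\<close>). The interpolation argument (\<open>fps_polyrel_unique\<close>) also
  extends the recursion from \<open>n\<close> to \<open>n + D2\<close>, and the conjugation by the integer powers of \<open>exp(\<sigma>)\<close> to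
  that by \<open>exp(D1 \<otimes> \<sigma>)\<close>.

  Finally the coefficient \<open>F\<^sub>1\<close> of \<open>\<zeta>\<close> in \<open>F\<close> is \<open>E32 \<otimes> E13 - D2 \<otimes> E23 - D1 \<otimes> E12\<close>, and that of the
  R-matrix is the flip of \<open>F\<^sub>1\<close> minus \<open>F\<^sub>1\<close>.
\<close>

unbundle no vec_syntax and fps_syntax


section \<open>Substitution into scalar power series\<close>

lemma power_nth_eq_0:
  fixes f :: "'a::ring_1 fps"
  assumes "f $ 0 = 0" "n < i"
  shows "(f ^ i) $ n = 0"
  using assms(2)
proof (induction i arbitrary: n)
  case (Suc i)
  have "f $ j * (f ^ i) $ (n - j) = 0" if "j \<in> {0..n}" for j
  proof (cases "j = 0")
    case False
    then have "n - j < i" using Suc.prems that by auto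
    then show ?thesis using Suc.IH by simp
  qed (simp add: assms)
  then show ?case by (simp add: fps_mult_nth)
qed simp

lemma mult_powers_nth_eq_0:
  fixes f g :: "'a::ring_1 fps"
  assumes "f $ 0 = 0" "g $ 0 = 0" "n < i + j"
  shows "(f ^ i * g ^ j) $ n = 0"
  unfolding fps_mult_nth
proof (intro sum.neutral ballI)
  fix p assume "p \<in> {0..n}"
  then have "p < i \<or> n - p < j" using assms(3) by auto
  then show "(f ^ i) $ p * (g ^ j) $ (n - p) = 0"
    using power_nth_eq_0[OF assms(1)] power_nth_eq_0[OF assms(2)] by auto
qed

lemma commute_power:
  fixes f g :: "'a::ring_1"
  assumes "f * g = h * f"
  shows "f * g ^ n = h ^ n * f"
  by (induction n) (simp_all add: assms power_commutes mult.assoc, metis assms mult.assoc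
      power_Suc power_commutes)

lemma mult_of_nat_left_commute: "y * (of_nat m * x) = of_nat m * (y * x)" for x y :: "'a::semiring_1"
  by (metis mult_of_nat_commute mult.assoc)

lemma binomial_commuting:
  fixes f g :: "'a::ring_1"
  assumes "f * g = g * f"
  shows "(f + g) ^ n = (\<Sum>k\<le>n. of_nat (n choose k) * (f ^ k * g ^ (n - k)))"
proof (induction n)
  case (Suc n)
  have gf: "g * f ^ k = f ^ k * g" for k
    by (rule commute_power) (simp add: assms)
  have "(f + g) ^ Suc n = (\<Sum>k\<le>n. of_nat (n choose k) * (f ^ Suc k * g ^ (n - k)))
      + (\<Sum>k\<le>n. of_nat (n choose k) * (f ^ k * g ^ (Suc n - k)))"
    unfolding power_Suc[of "f + g"] Suc distrib_right sum_distrib_left sum.distrib[symmetric]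
    by (intro arg_cong2[of _ _ _ _ "(+)"] sum.cong refl)
      (simp_all add: mult_of_nat_left_commute Suc_diff_le gf mult.assoc flip: mult.assoc[of g "f ^ _"])
  also have "(\<Sum>k\<le>n. of_nat (n choose k) * (f ^ k * g ^ (Suc n - k)))
      = (\<Sum>k\<le>Suc n. of_nat (n choose k) * (f ^ k * g ^ (Suc n - k)))"
    by (simp add: binomial_eq_0)
  also have "\<dots> = g ^ Suc n + (\<Sum>k\<le>n. of_nat (n choose Suc k) * (f ^ Suc k * g ^ (n - k)))"
    by (subst sum.atMost_Suc_shift) simp
  also have "(\<Sum>k\<le>n. of_nat (n choose k) * (f ^ Suc k * g ^ (n - k))) + \<dots>
      = g ^ Suc n + (\<Sum>k\<le>n. of_nat (Suc n choose Suc k) * (f ^ Suc k * g ^ (Suc n - Suc k)))"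
    by (simp add: sum.distrib distrib_right)
  also have "\<dots> = (\<Sum>k\<le>Suc n. of_nat (Suc n choose k) * (f ^ k * g ^ (Suc n - k)))"
    by (subst sum.atMost_Suc_shift) simp
  finally show ?case .
qed simp

context scalars begin

text \<open>
  For \<open>f\<close> without constant term this is the homomorphism \<open>k[[t]] \<rightarrow> B[[\<zeta>]]\<close> with \<open>t \<mapsto> f\<close>. Its source is
  commutative, so identities between scalar series such as \<open>exp (ln (1 + t)) = 1 + t\<close> carry over to
  the noncommutative target.
\<close>

abbreviation ev :: "'k fps \<Rightarrow> 'b fps \<Rightarrow> 'b fps" where
  "ev c f \<equiv> fps_coeffwise \<eta> c oo f"

lemma ev_nth:
  assumes "f $ 0 = 0" "n \<le> N"
  shows "ev c f $ n = (\<Sum>i\<le>N. \<eta> (c $ i) * (f ^ i) $ n)"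
  unfolding fps_compose_nth
  by (rule sum.mono_neutral_cong_left)
    (use assms in \<open>auto simp: fps_coeffwise_def power_nth_eq_0\<close>)

lemma scal_sum: "\<eta> (sum c A) = (\<Sum>i\<in>A. \<eta> (c i))"
  by (induction A rule: infinite_finite_induct) (simp_all add: scal_add scal_zero)

lemma scal_of_nat: "\<eta> (of_nat n) = of_nat n"
  by (induction n) (simp_all add: scal_zero scal_add scal_one)

lemma scal_mult_mult: "\<eta> a * x * (\<eta> b * y) = \<eta> a * \<eta> b * (x * y)"
  by (metis scal_comm mult.assoc)

text \<open>
  Only the terms of total degree at most the order of the coefficient survive, so a product of two
  substitutions is a sum over a triangle; multiplicativity of substitution and the addition theorem
  of the exponential are both read off from this form.
\<close>

lemma ev_mult_ev_nth:
  assumes "f $ 0 = 0" "g $ 0 = 0"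
  shows "(ev c f * ev d g) $ n
    = (\<Sum>m\<le>n. \<Sum>i\<le>m. \<eta> (c $ i * d $ (m - i)) * (f ^ i * g ^ (m - i)) $ n)"
proof -
  let ?t = "\<lambda>i j. \<eta> (c $ i) * \<eta> (d $ j) * (f ^ i * g ^ j) $ n"
  have "(ev c f * ev d g) $ n = (\<Sum>p=0..n. (\<Sum>i\<le>n. \<eta> (c $ i) * (f ^ i) $ p) *
      (\<Sum>j\<le>n. \<eta> (d $ j) * (g ^ j) $ (n - p)))"
    unfolding fps_mult_nth
    by (intro sum.cong refl arg_cong2[of _ _ _ _ "(*)"] ev_nth assms) auto
  also have "\<dots> = (\<Sum>p=0..n. \<Sum>i\<le>n. \<Sum>j\<le>n. \<eta> (c $ i) * \<eta> (d $ j) * ((f ^ i) $ p * (g ^ j) $ (n - p)))"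
    by (simp only: sum_product scal_mult_mult)
  also have "\<dots> = (\<Sum>i\<le>n. \<Sum>j\<le>n. ?t i j)"
    unfolding fps_mult_nth sum_distrib_left
    by (subst sum.swap) (intro sum.cong refl sum.swap)
  also have "\<dots> = (\<Sum>(i, j)\<in>{..n} \<times> {..n}. ?t i j)"
    by (simp add: sum.cartesian_product)
  also have "\<dots> = (\<Sum>(i, j)\<in>{(i, j). i + j \<le> n}. ?t i j)"
  proof (rule sum.mono_neutral_right)
    show "\<forall>p\<in>{..n} \<times> {..n} - {(i, j). i + j \<le> n}. (case p of (i, j) \<Rightarrow> ?t i j) = 0"
      using mult_powers_nth_eq_0[OF assms] by (simp add: not_le split_beta)
  qed auto
  also have "\<dots> = (\<Sum>m\<le>n. \<Sum>i\<le>m. ?t i (m - i))"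
    by (rule sum.triangle_reindex_eq)
  finally show ?thesis by (simp add: scal_mult)
qed

lemma ev_mult:
  assumes "f $ 0 = 0"
  shows "ev (c * d) f = ev c f * ev d f"
proof (rule fps_ext)
  fix n
  show "ev (c * d) f $ n = (ev c f * ev d f) $ n"
    by (simp add: ev_mult_ev_nth[OF assms assms] ev_nth[OF assms order.refl] fps_mult_nth[of c]
        scal_sum sum_distrib_right atLeast0AtMost flip: power_add)
qed

lemma ev_add: "ev (c + d) f = ev c f + ev d f"
  by (rule fps_ext)
    (simp add: fps_compose_nth fps_coeffwise_def scal_add distrib_right sum.distrib)

lemma ev_one: "ev 1 f = 1"
proof (rule fps_ext)
  fix n
  have "\<eta> (1 $ i) * y = (if i = 0 then y else 0)" for i y
    by (auto simp: scal_one scal_zero)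
  then show "ev 1 f $ n = 1 $ n"
    by (simp add: fps_compose_nth fps_coeffwise_def sum.delta)
qed

lemma ev_X:
  assumes "f $ 0 = 0"
  shows "ev fps_X f = f"
proof (rule fps_ext)
  fix n
  have "\<eta> (fps_X $ i) * y = (if i = 1 then y else 0)" for i y
    by (auto simp: scal_one scal_zero)
  then have "ev fps_X f $ n = (\<Sum>i=0..n. if i = 1 then (f ^ i) $ n else 0)"
    by (simp only: fps_compose_nth fps_coeffwise_def fps_nth_Abs_fps)
  then show "ev fps_X f $ n = f $ n"
    using assms by (cases n) (auto simp: sum.delta)
qed

lemma ev_power:
  assumes "f $ 0 = 0"
  shows "ev (c ^ n) f = ev c f ^ n"
  by (induction n) (simp_all add: ev_one ev_mult assms)

lemma ev_compose:
  assumes "f $ 0 = 0" "b $ 0 = 0"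
  shows "ev (a oo b) f = ev a (ev b f)"
proof (rule fps_ext)
  fix n
  have evb: "ev b f $ 0 = 0" using assms by (simp add: fps_coeffwise_def scal_zero)
  have "ev (a oo b) f $ n
      = (\<Sum>i\<le>n. (\<Sum>j\<le>n. \<eta> (a $ j) * \<eta> ((b ^ j) $ i)) * (f ^ i) $ n)"
    unfolding ev_nth[OF assms(1) order.refl]
  proof (intro sum.cong refl arg_cong2[of _ _ _ _ "(*)"])
    fix i assume "i \<in> {..n}"
    then have "(a oo b) $ i = (\<Sum>j\<le>n. a $ j * (b ^ j) $ i)"
      unfolding fps_compose_nth
      by (intro sum.mono_neutral_left) (auto simp: power_nth_eq_0 assms)
    then show "\<eta> ((a oo b) $ i) = (\<Sum>j\<le>n. \<eta> (a $ j) * \<eta> ((b ^ j) $ i))"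
      by (simp add: scal_sum scal_mult)
  qed
  also have "\<dots> = (\<Sum>j\<le>n. \<eta> (a $ j) * (\<Sum>i\<le>n. \<eta> ((b ^ j) $ i) * (f ^ i) $ n))"
    unfolding sum_distrib_left sum_distrib_right by (subst sum.swap) (simp only: mult.assoc)
  also have "\<dots> = (\<Sum>j\<le>n. \<eta> (a $ j) * (ev b f ^ j) $ n)"
    by (simp add: ev_nth[OF assms(1) order.refl] flip: ev_power[OF assms(1)])
  also have "\<dots> = ev a (ev b f) $ n"
    by (simp add: ev_nth[OF evb order.refl])
  finally show "ev (a oo b) f $ n = ev a (ev b f) $ n" .
qed

text \<open>
  Coefficientwise, a factor \<open>ev c f\<close> may be replaced by a partial sum, so that identities
  between such factors reduce to identities between powers.
\<close>

definition ev_upto :: "nat \<Rightarrow> 'k fps \<Rightarrow> 'b fps \<Rightarrow> 'b fps" where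
  "ev_upto N c f = (\<Sum>i\<le>N. fps_const (\<eta> (c $ i)) * f ^ i)"

lemma mult_ev_nth:
  assumes "f $ 0 = 0" "n \<le> N"
  shows "(Y * ev c f) $ n = (Y * ev_upto N c f) $ n" "(ev c f * Y) $ n = (ev_upto N c f * Y) $ n"
proof -
  have "ev c f $ m = ev_upto N c f $ m" if "m \<le> n" for m
    using assms that by (simp add: ev_nth[of f m N] ev_upto_def fps_sum_nth)
  then show "(Y * ev c f) $ n = (Y * ev_upto N c f) $ n"
    "(ev c f * Y) $ n = (ev_upto N c f * Y) $ n"
    by (simp_all add: fps_mult_nth)
qed

lemma const_scal_commute: "fps_const (\<eta> a) * f = f * fps_const (\<eta> a)"
  by (rule fps_ext) (simp add: scal_comm)

lemma const_scal_left_commute: "Y * (fps_const (\<eta> a) * f) = fps_const (\<eta> a) * (Y * f)"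
  by (metis const_scal_commute mult.assoc)

lemma ev_intertwine:
  assumes "f $ 0 = 0" "g $ 0 = 0" "Y * f = g * Y"
  shows "Y * ev c f = ev c g * Y"
proof (rule fps_ext)
  fix n
  have "Y * ev_upto n c f = ev_upto n c g * Y"
    unfolding ev_upto_def sum_distrib_left sum_distrib_right
    by (simp add: const_scal_left_commute commute_power[OF assms(3)] mult.assoc)
  then show "(Y * ev c f) $ n = (ev c g * Y) $ n"
    by (simp add: mult_ev_nth[OF _ order.refl] assms)
qed

end

section \<open>Exponential and logarithm\<close>

lemma fps_exp_oo_ln: "fps_exp 1 oo fps_ln 1 = (1 + fps_X :: 'k::field_char_0 fps)"
proof -
  have "(fps_exp 1 - 1) oo fps_ln 1 = (fps_X :: 'k fps)"
    by (simp add: fps_ln_fps_exp_inv fps_inv_right)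
  then show ?thesis
    by (simp add: fps_compose_sub_distrib diff_eq_eq add.commute)
qed

lemma fps_ln_oo_exp: "fps_ln 1 oo (fps_exp 1 - 1) = (fps_X :: 'k::field_char_0 fps)"
  by (simp add: fps_ln_fps_exp_inv fps_inv)

locale scalars_char_0 = scalars \<eta> for \<eta> :: "'k::field_char_0 \<Rightarrow> 'b::ring_1"
begin

lemma fexp_nth_0 [simp]: "fexp \<eta> f $ 0 = 1"
  by (simp add: fexp_def fps_coeffwise_def scal_one)

lemma fln_nth_0 [simp]: "fln \<eta> f $ 0 = 0"
  by (simp add: fln_def fps_coeffwise_def scal_zero)

lemma fexp_nth_1: "f $ 0 = 0 \<Longrightarrow> fexp \<eta> f $ 1 = f $ 1"
  by (simp add: fexp_def fps_compose_nth fps_coeffwise_def scal_one)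

lemma fln_nth_1: "f $ 0 = 1 \<Longrightarrow> fln \<eta> f $ 1 = f $ 1"
  by (simp add: fln_def fps_compose_nth fps_coeffwise_def scal_one fps_ln_nth)

lemma fexp_zero [simp]: "fexp \<eta> 0 = 1"
  by (simp add: fexp_def fps_compose_0_right fps_coeffwise_def scal_one)

lemma fln_one [simp]: "fln \<eta> 1 = 0"
  by (simp add: fln_def fps_compose_0_right fps_coeffwise_def scal_zero)

lemma fexp_intertwine:
  "f $ 0 = 0 \<Longrightarrow> g $ 0 = 0 \<Longrightarrow> Y * f = g * Y \<Longrightarrow> Y * fexp \<eta> f = fexp \<eta> g * Y"
  unfolding fexp_def by (rule ev_intertwine)

lemma fln_intertwine:
  "f $ 0 = 1 \<Longrightarrow> g $ 0 = 1 \<Longrightarrow> Y * f = g * Y \<Longrightarrow> Y * fln \<eta> f = fln \<eta> g * Y"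
  unfolding fln_def by (rule ev_intertwine) (simp_all add: algebra_simps)

lemma fexp_fln:
  assumes "a $ 0 = 1"
  shows "fexp \<eta> (fln \<eta> a) = a"
proof -
  have "fexp \<eta> (fln \<eta> a) = ev (1 + fps_X) (a - 1)"
    unfolding fexp_def fln_def by (simp add: assms flip: ev_compose fps_exp_oo_ln)
  then show ?thesis by (simp add: ev_add ev_one ev_X assms)
qed

lemma fln_fexp:
  assumes "f $ 0 = 0"
  shows "fln \<eta> (fexp \<eta> f) = f"
proof -
  have "fexp \<eta> f = ev ((fps_exp 1 - 1) + 1) f"
    by (simp add: fexp_def)
  then have "fexp \<eta> f - 1 = ev (fps_exp 1 - 1) f"
    by (simp only: ev_add ev_one add_diff_cancel_right')
  then have "fln \<eta> (fexp \<eta> f) = ev fps_X f"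
    unfolding fln_def by (simp add: assms flip: ev_compose fps_ln_oo_exp)
  then show ?thesis by (simp add: ev_X assms)
qed

lemma fexp_add:
  assumes "f $ 0 = 0" "g $ 0 = 0" "f * g = g * f"
  shows "fexp \<eta> (f + g) = fexp \<eta> f * fexp \<eta> g"
proof (rule fps_ext)
  fix n
  have "\<eta> (fps_exp 1 $ m) * ((f + g) ^ m) $ n
      = (\<Sum>i\<le>m. \<eta> (fps_exp 1 $ i * fps_exp 1 $ (m - i)) * (f ^ i * g ^ (m - i)) $ n)" for m
  proof -
    have "\<eta> (1 / fact m) * (of_nat (m choose i) * x)
        = \<eta> (1 / fact i * (1 / fact (m - i))) * x" if "i \<le> m" for i x
    proof -
      have "\<eta> (1 / fact m) * (of_nat (m choose i) * x)
          = \<eta> (1 / fact m * of_nat (m choose i)) * x"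
        by (simp only: scal_mult scal_of_nat mult.assoc)
      also have "1 / fact m * of_nat (m choose i) = (1 / fact i * (1 / fact (m - i)) :: 'k)"
        using that by (simp add: binomial_fact)
      finally show ?thesis .
    qed
    then show ?thesis
      by (simp add: binomial_commuting[OF assms(3)] fps_sum_nth sum_distrib_left fps_mult_of_nat_nth)
  qed
  then show "fexp \<eta> (f + g) $ n = (fexp \<eta> f * fexp \<eta> g) $ n"
    unfolding fexp_def ev_mult_ev_nth[OF assms(1,2)]
    by (subst ev_nth[OF _ order.refl]) (simp_all add: assms)
qed

lemma fexp_minus:
  assumes "f $ 0 = 0"
  shows "fexp \<eta> f * fexp \<eta> (- f) = 1" "fexp \<eta> (- f) * fexp \<eta> f = 1"
  using fexp_add[of f "- f"] fexp_add[of "- f" f] assms by simp_all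

lemma fexp_of_nat_mult:
  assumes "f $ 0 = 0"
  shows "fexp \<eta> (of_nat n * f) = fexp \<eta> f ^ n"
proof (induction n)
  case (Suc n)
  have "fexp \<eta> (of_nat (Suc n) * f) = fexp \<eta> (f + of_nat n * f)"
    by (simp add: distrib_right)
  also have "\<dots> = fexp \<eta> f * fexp \<eta> (of_nat n * f)"
    by (intro fexp_add) (simp_all add: assms, metis mult_of_nat_commute mult.assoc)
  finally show ?case using Suc by simp
qed simp

lemma fln_mult:
  assumes "a $ 0 = 1" "b $ 0 = 1" "a * b = b * a"
  shows "fln \<eta> (a * b) = fln \<eta> a + fln \<eta> b"
proof -
  have "a * fln \<eta> b = fln \<eta> b * a"
    by (rule fln_intertwine) (simp_all add: assms)
  then have "fln \<eta> b * fln \<eta> a = fln \<eta> a * fln \<eta> b"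
    by (intro fln_intertwine) (simp_all add: assms)
  then have "fexp \<eta> (fln \<eta> a + fln \<eta> b) = a * b"
    by (simp add: fexp_add fexp_fln assms)
  then have "fln \<eta> (a * b) = fln \<eta> (fexp \<eta> (fln \<eta> a + fln \<eta> b))"
    by simp
  then show ?thesis by (simp add: fln_fexp)
qed

text \<open>
  The series \<open>exp (ad f) Y = Y + [f, Y] + [f, [f, Y]] / 2 + \<dots>\<close> when the next commutator
  vanishes; \<open>W\<close> is half of \<open>[f, [f, Y]]\<close>, which keeps the statement free of division.
\<close>

lemma fexp_ad:
  assumes f: "f $ 0 = 0"
    and Y: "f * Y = Y * f + Z" and Z: "f * Z = Z * f + 2 * W" and W: "f * W = W * f"
  shows "fexp \<eta> f * Y = (Y + Z + W) * fexp \<eta> f"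
proof (rule fps_ext)
  fix n
  let ?e = "\<lambda>i. fps_const (\<eta> (1 / fact i)) * f ^ i"
  have const: "fps_const (\<eta> a) * fps_const (\<eta> b) = fps_const (\<eta> (a * b))" for a b
    by (simp add: scal_mult)
  have of_nat_const: "of_nat m = fps_const (\<eta> (of_nat m))" for m
    by (simp add: scal_of_nat fps_of_nat)
  have fW: "f ^ i * W = W * f ^ i" for i
    using commute_power[of W f f] W by simp
  have fZ: "f ^ i * Z = Z * f ^ i + of_nat (2 * i) * (W * f ^ (i - 1))" for i
  proof (induction i)
    case (Suc i)
    have "f ^ Suc i * Z = f * (f ^ i * Z)" by (simp add: mult.assoc)
    also have "\<dots> = f * Z * f ^ i + of_nat (2 * i) * (f * W * f ^ (i - 1))"
      by (simp only: Suc distrib_left mult_of_nat_left_commute[of f] mult.assoc)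
    also have "\<dots> = Z * f ^ Suc i + (2 * W * f ^ i + of_nat (2 * i) * (W * (f * f ^ (i - 1))))"
      by (simp add: Z W distrib_right mult.assoc)
    also have "of_nat (2 * i) * (W * (f * f ^ (i - 1))) = of_nat (2 * i) * (W * f ^ i)"
      by (cases i) simp_all
    finally show ?case by (simp add: distrib_right mult.assoc mult_2)
  qed simp
  have fY: "f ^ i * Y = Y * f ^ i + of_nat i * (Z * f ^ (i - 1))
      + of_nat (i * (i - 1)) * (W * f ^ (i - 2))" for i
  proof (induction i)
    case (Suc i)
    have "f ^ Suc i * Y = f ^ i * (Y * f + Z)"
      by (simp only: power_Suc2 mult.assoc Y)
    also have "\<dots> = (f ^ i * Y) * f + f ^ i * Z" by (simp add: distrib_left mult.assoc)
    also have "\<dots> = Y * f ^ Suc i + of_nat i * (Z * (f ^ (i - 1) * f))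
        + of_nat (i * (i - 1)) * (W * (f ^ (i - 2) * f))
        + Z * f ^ i + of_nat (2 * i) * (W * f ^ (i - 1))"
      unfolding Suc fZ by (simp add: distrib_right mult.assoc power_commutes)
    also have "of_nat i * (Z * (f ^ (i - 1) * f)) = of_nat i * (Z * f ^ i)"
      by (cases i) (simp_all add: power_commutes)
    also have "of_nat (i * (i - 1)) * (W * (f ^ (i - 2) * f))
        = of_nat (i * (i - 1)) * (W * f ^ (i - 1))"
      by (cases i; cases "i - 1") (simp_all add: power_commutes)
    also have "Y * f ^ Suc i + of_nat i * (Z * f ^ i) + of_nat (i * (i - 1)) * (W * f ^ (i - 1))
        + Z * f ^ i + of_nat (2 * i) * (W * f ^ (i - 1))
      = Y * f ^ Suc i + of_nat (i + 1) * (Z * f ^ i)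
        + of_nat (i * (i - 1) + 2 * i) * (W * f ^ (i - 1))"
      by (simp add: distrib_right)
    also have "i * (i - 1) + 2 * i = Suc i * i" by (cases i) simp_all
    finally show ?case by simp
  qed simp
  have e: "?e i * Y = Y * ?e i + (if i < 1 then 0 else Z * ?e (i - 1))
      + (if i < 2 then 0 else W * ?e (i - 2))" for i
  proof -
    have 1: "\<eta> (1 / fact i * of_nat i) = \<eta> (1 / fact (i - 1))" if "\<not> i < 1"
      using that by (cases i) (simp_all add: field_simps del: of_nat_Suc)
    have 2: "\<eta> (1 / fact i * of_nat (i * (i - 1))) = \<eta> (1 / fact (i - 2))" if i: "\<not> i < 2"
    proof -
      obtain j where "i = Suc (Suc j)" using i by (metis Suc_1 add_2_eq_Suc le_Suc_ex not_less)
      then have "fact i = of_nat (i * (i - 1)) * (fact (i - 2) :: 'k)"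
        by (simp only: fact_Suc of_nat_mult mult.assoc diff_Suc_1 diff_Suc_Suc numeral_2_eq_2
            minus_nat.diff_0)
      moreover have "of_nat (i * (i - 1)) \<noteq> (0 :: 'k)"
        using i by (simp del: of_nat_mult)
      ultimately show ?thesis by (simp del: of_nat_mult)
    qed
    have merge: "fps_const (\<eta> a) * (of_nat m * x) = fps_const (\<eta> (a * of_nat m)) * x" for a m x
      by (simp only: of_nat_const const flip: mult.assoc)
    have "?e i * Y = fps_const (\<eta> (1 / fact i)) * (f ^ i * Y)"
      by (rule mult.assoc)
    also have "\<dots> = Y * ?e i + fps_const (\<eta> (1 / fact i * of_nat i)) * (Z * f ^ (i - 1))
      + fps_const (\<eta> (1 / fact i * of_nat (i * (i - 1)))) * (W * f ^ (i - 2))"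
      unfolding fY distrib_left merge const_scal_left_commute[of Y] ..
    also have "fps_const (\<eta> (1 / fact i * of_nat i)) * (Z * f ^ (i - 1))
        = (if i < 1 then 0 else Z * ?e (i - 1))"
      using 1 by (simp only: const_scal_left_commute[of Z]) (simp add: scal_zero)
    also have "fps_const (\<eta> (1 / fact i * of_nat (i * (i - 1)))) * (W * f ^ (i - 2))
        = (if i < 2 then 0 else W * ?e (i - 2))"
      using 2 by (simp only: const_scal_left_commute[of W])
        (auto simp: scal_zero less_2_cases_iff)
    finally show ?thesis .
  qed
  let ?S = "\<lambda>N. ev_upto N (fps_exp 1) f"
  have "(\<Sum>i\<le>n + 2. if i < 1 then 0 else Z * ?e (i - 1)) = (\<Sum>i\<le>n + 1. Z * ?e i)"
    unfolding numeral_2_eq_2 add_Suc_right by (subst sum.atMost_Suc_shift) simp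
  moreover have "(\<Sum>i\<le>n + 2. if i < 2 then 0 else W * ?e (i - 2)) = (\<Sum>i\<le>n. W * ?e i)"
    unfolding numeral_2_eq_2 add_Suc_right by (subst sum.atMost_Suc_shift, subst
        sum.atMost_Suc_shift) simp
  ultimately have "?S (n + 2) * Y = Y * ?S (n + 2) + Z * ?S (n + 1) + W * ?S n"
    unfolding ev_upto_def sum_distrib_left sum_distrib_right fps_exp_nth power_one of_nat_fact
    by (simp only: e sum.distrib)
  then have "(?S (n + 2) * Y) $ n = (Y * ?S (n + 2)) $ n + (Z * ?S (n + 1)) $ n + (W * ?S n) $ n"
    by simp
  then show "(fexp \<eta> f * Y) $ n = ((Y + Z + W) * fexp \<eta> f) $ n"
    unfolding fexp_def distrib_right
    by (simp only: mult_ev_nth(2)[OF f, where n = n and N = "n + 2" and Y = Y]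
        mult_ev_nth(1)[OF f, where n = n and N = "n + 2" and Y = Y]
        mult_ev_nth(1)[OF f, where n = n and N = "n + 1" and Y = Z]
        mult_ev_nth(1)[OF f, where n = n and N = n and Y = W] fps_add_nth le_add1 order.refl)
qed

end

text \<open>
  This is \<^const>\<open>fpow\<close> over an arbitrary ring of coefficients; the cocycle equation involves such
  powers over \<open>U \<otimes> U \<otimes> U\<close>.
\<close>

definition fpower :: "('k::field_char_0 \<Rightarrow> 'b::ring_1) \<Rightarrow> 'b fps \<Rightarrow> 'b fps \<Rightarrow> 'b fps" where
  "fpower \<eta> f d = fexp \<eta> (d * fln \<eta> f)"

context scalars_char_0 begin

lemma fpower_of_nat: "f $ 0 = 1 \<Longrightarrow> fpower \<eta> f (of_nat n) = f ^ n"
  by (simp add: fpower_def fexp_of_nat_mult fexp_fln)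

lemma fpower_intertwine:
  assumes "f $ 0 = 1" "g $ 0 = 1" "Y * f = g * Y" "Y * d = e * Y"
  shows "Y * fpower \<eta> f d = fpower \<eta> g e * Y"
  unfolding fpower_def
proof (rule fexp_intertwine)
  have "Y * fln \<eta> f = fln \<eta> g * Y"
    by (rule fln_intertwine) (use assms in simp_all)
  then show "Y * (d * fln \<eta> f) = e * fln \<eta> g * Y"
    by (metis assms(4) mult.assoc)
qed simp_all

end

section \<open>Homomorphisms acting on coefficients\<close>

locale alg_hom = S: scalars_char_0 \<eta> + S': scalars_char_0 \<eta>'
  for \<eta> :: "'k::field_char_0 \<Rightarrow> 'a::ring_1" and \<eta>' :: "'k \<Rightarrow> 'b::ring_1" +
  fixes h :: "'a \<Rightarrow> 'b"
  assumes hom_add: "h (x + y) = h x + h y"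
    and hom_mult: "h (x * y) = h x * h y"
    and hom_scal: "h (\<eta> c) = \<eta>' c"
begin

lemma hom_zero: "h 0 = 0"
  using hom_add[of 0 0] by simp

lemma hom_one: "h 1 = 1"
  using hom_scal[of 1] by (simp add: S.scal_one S'.scal_one)

lemma hom_sum: "h (sum g A) = (\<Sum>i\<in>A. h (g i))"
  by (induction A rule: infinite_finite_induct) (simp_all add: hom_add hom_zero)

abbreviation hom_fps :: "'a fps \<Rightarrow> 'b fps" where
  "hom_fps \<equiv> fps_coeffwise h"

lemma hom_fps_nth: "hom_fps f $ n = h (f $ n)"
  by (simp add: fps_coeffwise_def)

lemma hom_fps_add: "hom_fps (f + g) = hom_fps f + hom_fps g"
  by (rule fps_ext) (simp add: hom_fps_nth hom_add)

lemma hom_fps_diff: "hom_fps (f - g) = hom_fps f - hom_fps g"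
  using hom_fps_add[of "f - g" g] by simp

lemma hom_fps_mult: "hom_fps (f * g) = hom_fps f * hom_fps g"
  by (rule fps_ext) (simp add: hom_fps_nth fps_mult_nth hom_sum hom_mult)

lemma hom_fps_const: "hom_fps (fps_const a) = fps_const (h a)"
  by (rule fps_ext) (simp add: hom_fps_nth hom_zero)

lemma hom_fps_one: "hom_fps 1 = 1"
  using hom_fps_const[of 1] by (simp add: hom_one)

lemma hom_fps_zero: "hom_fps 0 = 0"
  using hom_fps_const[of 0] by (simp add: hom_zero)

lemma hom_fps_uminus: "hom_fps (- f) = - hom_fps f"
  using hom_fps_diff[of 0 f] by (simp add: hom_fps_zero)

lemma hom_fps_X: "hom_fps fps_X = fps_X"
  by (rule fps_ext) (simp add: hom_fps_nth hom_zero hom_one)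

lemma hom_fps_of_nat: "hom_fps (of_nat n) = of_nat n"
  by (induction n) (simp_all add: hom_fps_zero hom_fps_one hom_fps_add)

lemma hom_fps_power: "hom_fps (f ^ n) = hom_fps f ^ n"
  by (induction n) (simp_all add: hom_fps_one hom_fps_mult)

lemma hom_fps_ev: "hom_fps (S.ev c f) = S'.ev c (hom_fps f)"
  by (rule fps_ext)
    (simp add: fps_compose_nth hom_fps_nth hom_sum hom_mult flip: hom_fps_power,
      simp add: fps_coeffwise_def hom_scal)

lemma hom_fps_fexp: "hom_fps (fexp \<eta> f) = fexp \<eta>' (hom_fps f)"
  by (simp add: fexp_def hom_fps_ev)

lemma hom_fps_fln: "hom_fps (fln \<eta> f) = fln \<eta>' (hom_fps f)"
  by (simp add: fln_def hom_fps_ev hom_fps_diff hom_fps_one)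

lemma hom_fps_fpower: "hom_fps (fpower \<eta> f d) = fpower \<eta>' (hom_fps f) (hom_fps d)"
  by (simp add: fpower_def hom_fps_fexp hom_fps_fln hom_fps_mult)

lemmas hom_fps_simps = hom_fps_add hom_fps_diff hom_fps_mult hom_fps_const hom_fps_one
  hom_fps_zero hom_fps_uminus hom_fps_X hom_fps_power hom_fps_fexp hom_fps_fln hom_fps_fpower

end

section \<open>Polynomial interpolation\<close>

text \<open>
  Pairs \<open>(q, y)\<close> such that \<open>q n\<close> is the value at \<open>n\<close>, and \<open>y\<close> the value at \<open>d\<close>, of one and the same
  polynomial, whose coefficients commute with \<open>d\<close>. Carrying the two values instead of the
  polynomial itself avoids a type of polynomials over a noncommutative ring.
\<close>

inductive_set polyrel :: "'b::ring_1 \<Rightarrow> ((nat \<Rightarrow> 'b) \<times> 'b) set" for d :: 'b where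
  const: "c * d = d * c \<Longrightarrow> (\<lambda>n. c, c) \<in> polyrel d"
| add: "(q, y) \<in> polyrel d \<Longrightarrow> (q', y') \<in> polyrel d \<Longrightarrow> (\<lambda>n. q n + q' n, y + y') \<in> polyrel d"
| var_mult: "(q, y) \<in> polyrel d \<Longrightarrow> (\<lambda>n. of_nat n * q n, d * y) \<in> polyrel d"

lemma polyrel_var: "(\<lambda>n. of_nat n, d) \<in> polyrel d"
  using polyrel.var_mult[OF polyrel.const[of 1 d]] by simp

lemma polyrel_mult:
  assumes "(q, y) \<in> polyrel d" "(q', y') \<in> polyrel d"
  shows "(\<lambda>n. q n * q' n, y * y') \<in> polyrel d"
  using assms(1)
proof induction
  case (const c)
  from assms(2) show ?case
  proof induction
    case (const c')
    then show ?case
      using \<open>c * d = d * c\<close> polyrel.const[of "c * c'" d] by (metis mult.assoc)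
  next
    case (add q y q' y')
    then show ?case by (simp add: distrib_left polyrel.add)
  next
    case (var_mult q y)
    have "c * (d * y) = d * (c * y)" using const by (metis mult.assoc)
    then show ?case
      using polyrel.var_mult[OF var_mult.IH] by (simp add: mult_of_nat_left_commute)
  qed
next
  case (add q y q' y')
  then show ?case by (simp add: distrib_right polyrel.add)
next
  case (var_mult q y)
  then show ?case using polyrel.var_mult by (fastforce simp: mult.assoc)
qed

lemma polyrel_sum:
  "(\<And>i. i \<in> A \<Longrightarrow> (q i, y i) \<in> polyrel d) \<Longrightarrow> (\<lambda>n. \<Sum>i\<in>A. q i n, \<Sum>i\<in>A. y i) \<in> polyrel d"
  by (induction A rule: infinite_finite_induct) (simp_all add: polyrel.add polyrel.const)

primrec falling :: "'b::ring_1 \<Rightarrow> nat \<Rightarrow> 'b" where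
  "falling x 0 = 1"
| "falling x (Suc i) = falling x i * (x - of_nat i)"

lemma falling_commute: "x * falling x i = falling x i * x"
proof (induction i)
  case (Suc i)
  have "x * (x - of_nat i) = (x - of_nat i) * x"
    by (simp add: algebra_simps mult_of_nat_commute)
  then show ?case by (simp add: Suc mult.assoc flip: mult.assoc[of x])
qed simp

lemma mult_falling: "x * falling x i = falling x (Suc i) + of_nat i * falling x i"
  by (simp add: falling_commute algebra_simps mult_of_nat_commute)

lemma falling_of_nat:
  "n < i \<Longrightarrow> falling (of_nat n) i = 0"
  "falling (of_nat n) n = of_nat (fact n)"
proof -
  have *: "falling (of_nat n) i = of_nat (\<Prod>j<i. n - j)" if "i \<le> n" for i
    using that by (induction i) (simp_all add: of_nat_diff)
  have "(\<Prod>j<n. n - j) = fact n"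
    by (simp add: fact_prod_rev atLeast0LessThan)
  then show "falling (of_nat n) n = of_nat (fact n)"
    using *[of n] by simp
  show "falling (of_nat n) i = 0" if "n < i"
    using that by (induction i) (auto simp: less_Suc_eq)
qed

text \<open>
  In the basis of falling factorials the values at \<open>0, 1, 2, \<dots>\<close> are a triangular system for the
  coefficients, with the invertible diagonal entries \<open>n!\<close>. So vanishing values force vanishing
  coefficients, in any ring over a field of characteristic \<open>0\<close>.
\<close>

lemma polyrel_falling:
  assumes "(q, y) \<in> polyrel d"
  shows "\<exists>N c. (\<forall>i. c i * d = d * c i) \<and> (\<forall>i\<ge>N. c i = 0) \<and>
    (\<forall>n. q n = (\<Sum>i<N. c i * falling (of_nat n) i)) \<and> y = (\<Sum>i<N. c i * falling d i)"
  using assms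
proof induction
  case (const c)
  show ?case
    by (rule exI[of _ 1], rule exI[of _ "\<lambda>i. if i = 0 then c else 0"]) (simp add: const)
next
  case (add q y q' y')
  obtain N c where c: "\<forall>i. c i * d = d * c i" "\<forall>i\<ge>N. c i = 0"
    "\<forall>n. q n = (\<Sum>i<N. c i * falling (of_nat n) i)" "y = (\<Sum>i<N. c i * falling d i)"
    using add.IH(1) by blast
  obtain N' c' where c': "\<forall>i. c' i * d = d * c' i" "\<forall>i\<ge>N'. c' i = 0"
    "\<forall>n. q' n = (\<Sum>i<N'. c' i * falling (of_nat n) i)" "y' = (\<Sum>i<N'. c' i * falling d i)"
    using add.IH(2) by blast
  have pad: "(\<Sum>i<N. c i * g i) = (\<Sum>i<max N N'. c i * g i)" for g
    by (rule sum.mono_neutral_left) (use c(2) in auto)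
  have pad': "(\<Sum>i<N'. c' i * g i) = (\<Sum>i<max N N'. c' i * g i)" for g
    by (rule sum.mono_neutral_left) (use c'(2) in auto)
  show ?case
    by (rule exI[of _ "max N N'"], rule exI[of _ "\<lambda>i. c i + c' i"])
      (use c c' in \<open>auto simp: pad pad' distrib_left distrib_right sum.distrib\<close>)
next
  case (var_mult q y)
  obtain N c where c: "\<forall>i. c i * d = d * c i" "\<forall>i\<ge>N. c i = 0"
    "\<forall>n. q n = (\<Sum>i<N. c i * falling (of_nat n) i)" "y = (\<Sum>i<N. c i * falling d i)"
    using var_mult.IH by blast
  define c' where "c' i = (if i = 0 then 0 else c (i - 1)) + of_nat i * c i" for i
  have key: "x * (\<Sum>i<N. c i * falling x i) = (\<Sum>i<Suc N. c' i * falling x i)"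
    if "\<forall>i. c i * x = x * c i" for x
  proof -
    have "x * (c i * falling x i) = c i * falling x (Suc i) + of_nat i * c i * falling x i" for i
    proof -
      have "x * (c i * falling x i) = c i * (x * falling x i)"
        using that by (metis mult.assoc)
      also have "\<dots> = c i * falling x (Suc i) + of_nat i * c i * falling x i"
        unfolding mult_falling distrib_left by (metis mult_of_nat_commute mult.assoc)
      finally show ?thesis .
    qed
    then have "x * (\<Sum>i<N. c i * falling x i)
        = (\<Sum>i<N. c i * falling x (Suc i)) + (\<Sum>i<N. of_nat i * c i * falling x i)"
      by (simp add: sum_distrib_left sum.distrib)
    also have "(\<Sum>i<N. c i * falling x (Suc i))
        = (\<Sum>i<Suc N. (if i = 0 then 0 else c (i - 1)) * falling x i)"
      by (subst sum.lessThan_Suc_shift) simp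
    also have "(\<Sum>i<N. of_nat i * c i * falling x i) = (\<Sum>i<Suc N. of_nat i * c i * falling x i)"
      using c(2) by simp
    finally show ?thesis
      by (simp only: c'_def distrib_right sum.distrib)
  qed
  have "c' i * d = d * c' i" for i
    using c(1) by (simp add: c'_def distrib_left distrib_right mult.assoc mult_of_nat_left_commute)
  moreover have "\<forall>i\<ge>Suc N. c' i = 0" using c(2) by (auto simp: c'_def)
  moreover have "of_nat n * q n = (\<Sum>i<Suc N. c' i * falling (of_nat n) i)" for n
    using key[of "of_nat n"] c(3) by (simp add: mult_of_nat_commute)
  moreover have "d * y = (\<Sum>i<Suc N. c' i * falling d i)"
    using key[of d] c(1,4) by simp
  ultimately show ?case by blast
qed

context scalars_char_0 begin

lemma of_nat_mult_eq_0:
  assumes "x * of_nat n = (0::'b)" "n \<noteq> 0"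
  shows "x = 0"
proof -
  have "x = x * \<eta> (of_nat n * (1 / of_nat n))"
    using assms(2) by (simp add: scal_one)
  also have "\<dots> = x * of_nat n * \<eta> (1 / of_nat n)"
    by (simp only: scal_mult scal_of_nat mult.assoc)
  finally show ?thesis by (simp add: assms)
qed

lemma polyrel_eq_0:
  assumes "(q, y) \<in> polyrel (d::'b)" "\<And>n. q n = 0"
  shows "y = 0"
proof -
  obtain N c where c: "\<forall>i\<ge>N. c i = 0"
    "\<forall>n. q n = (\<Sum>i<N. c i * falling (of_nat n) i)" "y = (\<Sum>i<N. c i * falling d i)"
    using polyrel_falling[OF assms(1)] by blast
  have "c m = 0" for m
  proof (induction m rule: less_induct)
    case (less m)
    show ?case
    proof (cases "m < N")
      case True
      have "c i * falling (of_nat m) i = (if i = m then c m * of_nat (fact m) else 0)" for i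
        using less by (cases i m rule: linorder_cases) (auto simp: falling_of_nat)
      then have "q m = c m * of_nat (fact m)"
        using True c(2) by (simp add: sum.delta)
      then show ?thesis
        using assms(2) of_nat_mult_eq_0[of "c m" "fact m"] by simp
    qed (use c(1) in simp)
  qed
  then show ?thesis by (simp add: c(3))
qed

end

text \<open>
  The same for power series whose coefficients are polynomial in \<open>d\<close>; this is the form in which a
  power \<open>f\<^sup>d\<close> is determined by the powers \<open>f\<^sup>n\<close>.
\<close>

definition fps_polyrel :: "'b::ring_1 \<Rightarrow> (nat \<Rightarrow> 'b fps) \<Rightarrow> 'b fps \<Rightarrow> bool" where
  "fps_polyrel d q y \<longleftrightarrow> (\<forall>m. (\<lambda>n. q n $ m, y $ m) \<in> polyrel d)"

lemma fps_polyrel_const: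
  assumes "c * fps_const d = fps_const d * c"
  shows "fps_polyrel d (\<lambda>n. c) c"
  unfolding fps_polyrel_def
proof
  fix m
  have "(c * fps_const d) $ m = (fps_const d * c) $ m" by (simp only: assms)
  then show "(\<lambda>n. c $ m, c $ m) \<in> polyrel d" by (intro polyrel.const) simp
qed

lemma fps_polyrel_var: "fps_polyrel d (\<lambda>n. of_nat n) (fps_const d)"
  by (auto simp: fps_polyrel_def polyrel_var polyrel.const simp flip: fps_of_nat)

lemma fps_polyrel_add:
  "fps_polyrel d q y \<Longrightarrow> fps_polyrel d q' y' \<Longrightarrow> fps_polyrel d (\<lambda>n. q n + q' n) (y + y')"
  by (simp add: fps_polyrel_def polyrel.add)

lemma fps_polyrel_mult:
  "fps_polyrel d q y \<Longrightarrow> fps_polyrel d q' y' \<Longrightarrow> fps_polyrel d (\<lambda>n. q n * q' n) (y * y')"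
  by (auto simp: fps_polyrel_def fps_mult_nth intro!: polyrel_sum polyrel_mult)

lemma fps_polyrel_diff:
  assumes "fps_polyrel d q y" "fps_polyrel d q' y'"
  shows "fps_polyrel d (\<lambda>n. q n - q' n) (y - y')"
  using fps_polyrel_add[OF assms(1) fps_polyrel_mult[OF fps_polyrel_const[of "- 1"] assms(2)]]
  by simp

lemma fps_polyrel_power:
  "fps_polyrel d q y \<Longrightarrow> fps_polyrel d (\<lambda>n. q n ^ i) (y ^ i)"
  by (induction i) (simp_all add: fps_polyrel_const fps_polyrel_mult)

context scalars_char_0 begin

lemma fps_polyrel_ev:
  assumes "fps_polyrel d q y"
  shows "fps_polyrel d (\<lambda>n. ev c (q n)) (ev c y)"
  unfolding fps_polyrel_def fps_compose_nth
  using fps_polyrel_power[OF assms]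
  by (intro allI polyrel_sum polyrel_mult polyrel.const) (auto simp: fps_polyrel_def
      fps_coeffwise_def scal_comm)

lemma fps_polyrel_fexp:
  "fps_polyrel d q y \<Longrightarrow> fps_polyrel d (\<lambda>n. fexp \<eta> (q n)) (fexp \<eta> y)"
  unfolding fexp_def by (rule fps_polyrel_ev)

lemma fps_polyrel_fln:
  "fps_polyrel d q y \<Longrightarrow> fps_polyrel d (\<lambda>n. fln \<eta> (q n)) (fln \<eta> y)"
  unfolding fln_def by (intro fps_polyrel_ev fps_polyrel_diff fps_polyrel_const) simp_all

lemma fps_polyrel_fpower:
  assumes "fps_polyrel d q y" "fps_polyrel d e x"
  shows "fps_polyrel d (\<lambda>n. fpower \<eta> (q n) (e n)) (fpower \<eta> y x)"
  unfolding fpower_def by (intro fps_polyrel_fexp fps_polyrel_mult fps_polyrel_fln assms)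

lemma fps_polyrel_unique:
  assumes "fps_polyrel (d::'b) q y" "fps_polyrel d q' y'" "\<And>n. q n = q' n"
  shows "y = y'"
proof (rule fps_ext)
  fix m
  have "(\<lambda>n. (q n - q' n) $ m, (y - y') $ m) \<in> polyrel d"
    using fps_polyrel_diff[OF assms(1,2)] by (simp add: fps_polyrel_def)
  then have "(y - y') $ m = 0"
    by (rule polyrel_eq_0) (simp add: assms(3))
  then show "y $ m = y' $ m" by simp
qed

lemmas fps_polyrel_intros = fps_polyrel_add fps_polyrel_diff fps_polyrel_mult fps_polyrel_fpower
  fps_polyrel_fexp fps_polyrel_fln fps_polyrel_power fps_polyrel_const fps_polyrel_var

end

section \<open>Powers of \<open>1 - \<zeta>E + \<zeta>\<^sup>2xA\<close>\<close>

text \<open>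
  The base \<open>T(x)\<close> of the power \<open>\<Phi>\<close>, where \<open>x\<close> stands for \<open>D2\<close> in the tensor factor preceding
  that of \<open>E\<close> and \<open>A\<close>.
\<close>

definition twist_base :: "'b::ring_1 fps \<Rightarrow> 'b fps \<Rightarrow> 'b fps \<Rightarrow> 'b fps" where
  "twist_base E A x = 1 - fps_X * E + fps_X\<^sup>2 * (x * A)"

lemma twist_base_nth_0 [simp]: "twist_base E A x $ 0 = 1"
  by (simp add: twist_base_def power2_eq_square mult.assoc)

lemma fps_X_left_commute: "(a::'b::ring_1 fps) * (fps_X * b) = fps_X * (a * b)"
  by (metis fps_mult_fps_X_commute mult.assoc)

lemmas fps_X_to_front = fps_mult_fps_X_commute[symmetric] fps_X_left_commute

text \<open>
  The relation between \<open>A\<close> and \<open>E\<close> says that \<open>A T(x + 1) = T(x) A\<close>: passing \<open>A\<close> shifts \<open>x\<close>. As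
  \<open>T(y) - T(x)\<close> is a multiple of \<open>A\<close>, this makes \<open>T(x) T(y + 1)\<close> symmetric in \<open>x\<close> and \<open>y\<close>.
\<close>

lemma twist_base_exchange:
  fixes E A x y :: "'b::ring_1 fps"
  assumes AE: "A * E = E * A + fps_X * (A * A)"
    and comm: "A * x = x * A" "A * y = y * A" "E * x = x * E" "E * y = y * E" "y * x = x * y"
  shows "twist_base E A x * twist_base E A (y + 1) = twist_base E A y * twist_base E A (x + 1)"
proof -
  have comm': "A * (E * b) = E * (A * b) + fps_X * (A * (A * b))"
    "A * (x * b) = x * (A * b)" "A * (y * b) = y * (A * b)" "E * (x * b) = x * (E * b)"
    "E * (y * b) = y * (E * b)" "y * (x * b) = x * (y * b)" for b
    by (simp_all only: AE comm distrib_right mult.assoc flip: mult.assoc)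
  note front = fps_X_to_front[of A] fps_X_to_front[of E] fps_X_to_front[of x] fps_X_to_front[of y]
  show ?thesis
    by (simp add: twist_base_def power2_eq_square algebra_simps front comm comm' AE)
qed

lemma twist_base_intertwine:
  fixes Y :: "'b::ring_1 fps"
  assumes "Y * E = E' * Y" "Y * A = A' * Y" "Y * x = x' * Y"
  shows "Y * twist_base E A x = twist_base E' A' x' * Y"
proof -
  have "Y * (x * A) = x' * A' * Y"
    by (metis assms(2,3) mult.assoc)
  then show ?thesis
    by (simp only: twist_base_def power2_eq_square distrib_left distrib_right left_diff_distrib
        right_diff_distrib mult.assoc fps_X_left_commute[of Y] assms(1) mult_1_left mult_1_right)
qed

lemma (in alg_hom) hom_fps_twist_base:
  "hom_fps (twist_base E A x) = twist_base (hom_fps E) (hom_fps A) (hom_fps x)"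
  by (simp add: twist_base_def hom_fps_simps)

lemma twist_base_power_exchange:
  fixes E A x y :: "'b::ring_1 fps"
  assumes AE: "A * E = E * A + fps_X * (A * A)"
    and comm: "A * x = x * A" "A * y = y * A" "E * x = x * E" "E * y = y * E" "y * x = x * y"
  shows "twist_base E A x ^ n * twist_base E A y
      = twist_base E A (y - of_nat n) * twist_base E A (x + 1) ^ n"
proof (induction n)
  case (Suc n)
  let ?y = "y - of_nat (Suc n)"
  have "twist_base E A x * twist_base E A (?y + 1) = twist_base E A ?y * twist_base E A (x + 1)"
    by (rule twist_base_exchange)
      (simp_all only: assms distrib_left distrib_right left_diff_distrib right_diff_distrib
        mult_1_left mult_1_right mult_of_nat_commute[of _ x] mult_of_nat_commute[of _ A]
        mult_of_nat_commute[of _ E])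
  then have "twist_base E A x * twist_base E A (y - of_nat n)
      = twist_base E A ?y * twist_base E A (x + 1)"
    by (simp add: algebra_simps)
  then show ?case
    by (simp only: power_Suc mult.assoc Suc) (simp only: flip: mult.assoc)
qed simp

text \<open>
  The preceding exchange with \<open>x = n\<close> and \<open>y = 2 n + 1\<close>, chosen so that \<open>y - n = x + 1\<close>.
\<close>

lemma twist_base_power_Suc:
  fixes E A :: "'b::ring_1 fps"
  assumes "A * E = E * A + fps_X * (A * A)"
  shows "twist_base E A (of_nat n) ^ n * twist_base E A (of_nat (2 * n + 1))
      = twist_base E A (of_nat (Suc n)) ^ Suc n"
proof -
  have "2 * n + 1 = n + Suc n" by simp
  then have "of_nat (2 * n + 1) - of_nat n = (of_nat (Suc n) :: 'b fps)"
    by (simp only: of_nat_add add_diff_cancel_left')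
  moreover have "twist_base E A (of_nat n) ^ n * twist_base E A (of_nat (2 * n + 1))
      = twist_base E A (of_nat (2 * n + 1) - of_nat n) * twist_base E A (of_nat n + 1) ^ n"
    by (rule twist_base_power_exchange[OF assms]) (rule mult_of_nat_commute[symmetric])+
  ultimately show ?thesis
    by (simp only: power_Suc of_nat_Suc add.commute[of "of_nat n" 1])
qed

context scalars_char_0 begin

text \<open>
  The same recursion at the argument \<open>n + d\<close>: at \<open>n + m\<close> it is \<open>twist_base_power_Suc\<close>, and
  interpolation in \<open>m\<close> reaches \<open>d\<close>.
\<close>

lemma twist_base_fpower_plus_one:
  fixes E A :: "'b fps" and d :: 'b
  assumes AE: "A * E = E * A + fps_X * (A * A)"
    and comm: "A * fps_const d = fps_const d * A" "E * fps_const d = fps_const d * E"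
  defines "G \<equiv> \<lambda>x. fpower \<eta> (twist_base E A x) x"
  shows "G (of_nat n + fps_const d) * twist_base E A (2 * (of_nat n + fps_const d) + 1)
    = G (of_nat (Suc n) + fps_const d)"
proof (rule fps_polyrel_unique)
  have two: "2 * fps_const d = fps_const d * 2"
    by (simp only: mult_2 mult_2_right)
  note const = comm two mult_of_nat_commute[of _ "fps_const d"] fps_mult_fps_X_commute[of "fps_const d"]
    fps_mult_fps_X_power_commute[of _ "fps_const d"] mult_1_left mult_1_right
  let ?L = "\<lambda>x. G (of_nat n + x) * twist_base E A (2 * (of_nat n + x) + 1)"
  let ?R = "\<lambda>x. G (of_nat (Suc n) + x)"
  show "fps_polyrel d (\<lambda>m. ?L (of_nat m)) (?L (fps_const d))"
    unfolding G_def twist_base_def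
    by (intro fps_polyrel_intros) (simp_all only: const)
  show "fps_polyrel d (\<lambda>m. ?R (of_nat m)) (?R (fps_const d))"
    unfolding G_def twist_base_def
    by (intro fps_polyrel_intros) (simp_all only: const)
  fix m
  have G_of_nat: "G (of_nat k) = twist_base E A (of_nat k) ^ k" for k
    by (simp add: G_def fpower_of_nat)
  have arg: "of_nat n + of_nat m = (of_nat (n + m) :: 'b fps)"
    "of_nat (Suc n) + of_nat m = (of_nat (Suc (n + m)) :: 'b fps)"
    "2 * of_nat (n + m) + 1 = (of_nat (2 * (n + m) + 1) :: 'b fps)"
    by simp_all
  show "?L (of_nat m) = ?R (of_nat m)"
    unfolding arg G_of_nat by (rule twist_base_power_Suc[OF AE])
qed

text \<open>
  Passing from \<open>n\<close> to \<open>n + 1\<close> on the left inserts \<open>T(2 n + 1)\<close> before \<open>G(n + 1 + d)\<close>. Since \<open>E\<close> and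
  \<open>A\<close> raise the weight under \<open>d\<close> by \<open>1\<close>, they turn this into \<open>G(n + d)\<close> when they pass it, whereas
  the summand \<open>1\<close> of \<open>T(2 n + 1)\<close> leaves \<open>G(n + d) T'(2 (n + d) + 1)\<close>. Together these terms are
  \<open>G(n + d) V(2 n + 1)\<close>, where \<open>V\<close> is the base of the power on the right; and \<open>V\<close> satisfies the same
  recursion, because its two constituents satisfy the relation between \<open>E\<close> and \<open>A\<close>.
\<close>

lemma twist_base_cocycle_of_nat:
  fixes E A E' A' :: "'b fps" and d :: 'b
  assumes AE: "A * E = E * A + fps_X * (A * A)" and AE': "A' * E' = E' * A' + fps_X * (A' * A')"
    and dE: "fps_const d * E = E * (fps_const d + 1)" and dA: "fps_const d * A = A * (fps_const d + 1)"
    and comm: "E' * E = E * E'" "E' * A = A * E'" "A' * E = E * A'" "A' * A = A * A'"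
    and dE': "E' * fps_const d = fps_const d * E'" and dA': "A' * fps_const d = fps_const d * A'"
  defines "G \<equiv> \<lambda>x. fpower \<eta> (twist_base E' A' x) x"
  shows "twist_base E A (of_nat n) ^ n * G (of_nat n + fps_const d)
    = G (fps_const d) * twist_base (E + E' - 2 * (fps_X * (fps_const d * A'))) (A + A') (of_nat n) ^ n"
proof -
  let ?d = "fps_const d"
  let ?V = "twist_base (E + E' - 2 * (fps_X * (?d * A'))) (A + A')"
  have GS: "G (of_nat (Suc n) + ?d)
      = G (of_nat n + ?d) * twist_base E' A' (2 * (of_nat n + ?d) + 1)" for n
    unfolding G_def by (rule twist_base_fpower_plus_one[symmetric]) (fact AE' dE' dA')+
  have shift: "B * G (of_nat (Suc n) + ?d) = G (of_nat n + ?d) * B"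
    if B: "?d * B = B * (?d + 1)" "E' * B = B * E'" "A' * B = B * A'" for B n
  proof -
    have x: "B * (of_nat (Suc n) + ?d) = (of_nat n + ?d) * B"
      by (simp add: B(1) algebra_simps mult_of_nat_commute[of n B])
    have "B * ((of_nat (Suc n) + ?d) * A') = (of_nat n + ?d) * A' * B"
      by (simp only: x B(3) mult.assoc flip: mult.assoc[of B])
    then have "B * (fps_X * E') = fps_X * E' * B"
      "B * (fps_X\<^sup>2 * ((of_nat (Suc n) + ?d) * A')) = fps_X\<^sup>2 * ((of_nat n + ?d) * A') * B"
      by (simp_all only: B(2) power2_eq_square mult.assoc fps_X_left_commute[of B])
    then have "B * twist_base E' A' (of_nat (Suc n) + ?d) = twist_base E' A' (of_nat n + ?d) * B"
      by (simp only: twist_base_def distrib_left distrib_right right_diff_distrib left_diff_distrib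
          mult_1_left mult_1_right)
    then show ?thesis
      unfolding G_def using x by (intro fpower_intertwine) simp_all
  qed
  have VE: "(A + A') * (E + E' - 2 * (fps_X * (?d * A')))
      = (E + E' - 2 * (fps_X * (?d * A'))) * (A + A') + fps_X * ((A + A') * (A + A'))"
  proof -
    have Ad: "A * ?d = ?d * A - A" using dA by (simp add: algebra_simps)
    have Ad': "A * (?d * b) = ?d * (A * b) - A * b" for b
      using Ad by (metis left_diff_distrib mult.assoc)
    have A'd: "A' * (?d * b) = ?d * (A' * b)" for b
      using dA' by (metis mult.assoc)
    show ?thesis
      by (simp add: Ad Ad' A'd dA' comm AE AE' distrib_left distrib_right left_diff_distrib
          right_diff_distrib mult_2 mult.assoc fps_X_to_front[of A] fps_X_to_front[of A']
          fps_X_to_front[of ?d])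
  qed
  show ?thesis
  proof (induction n)
    case 0
    then show ?case by simp
  next
    case (Suc n)
    let ?c = "of_nat (2 * n + 1) :: 'b fps"
    have "twist_base E A ?c * G (of_nat (Suc n) + ?d)
        = G (of_nat (Suc n) + ?d) - fps_X * (E * G (of_nat (Suc n) + ?d))
          + fps_X\<^sup>2 * (?c * (A * G (of_nat (Suc n) + ?d)))"
      by (simp only: twist_base_def distrib_right left_diff_distrib mult.assoc mult_1_left)
    also have "\<dots> = G (of_nat n + ?d) * twist_base E' A' (2 * (of_nat n + ?d) + 1)
          - fps_X * (G (of_nat n + ?d) * E) + fps_X\<^sup>2 * (?c * (G (of_nat n + ?d) * A))"
      unfolding shift[OF dE comm(1,3)] shift[OF dA comm(2,4)] unfolding GS ..
    also have "\<dots> = G (of_nat n + ?d) *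
        (twist_base E' A' (2 * (of_nat n + ?d) + 1) - fps_X * E + fps_X\<^sup>2 * (?c * A))"
      by (simp only: distrib_left right_diff_distrib fps_X_left_commute[of "G _"] power2_eq_square
          mult.assoc mult_of_nat_left_commute[of "G _"])
    also have "twist_base E' A' (2 * (of_nat n + ?d) + 1) - fps_X * E + fps_X\<^sup>2 * (?c * A) = ?V ?c"
      by (simp add: twist_base_def power2_eq_square algebra_simps mult_2 mult_2_right
        del: fps_const_add)
    finally have step: "twist_base E A ?c * G (of_nat (Suc n) + ?d) = G (of_nat n + ?d) * ?V ?c" .
    have "twist_base E A (of_nat (Suc n)) ^ Suc n * G (of_nat (Suc n) + ?d)
        = twist_base E A (of_nat n) ^ n * (twist_base E A ?c * G (of_nat (Suc n) + ?d))"
      by (simp only: mult.assoc flip: twist_base_power_Suc[OF AE])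
    also have "\<dots> = G ?d * (?V (of_nat n) ^ n * ?V ?c)"
      unfolding step by (simp only: Suc flip: mult.assoc)
    also have "?V (of_nat n) ^ n * ?V ?c = ?V (of_nat (Suc n)) ^ Suc n"
      by (rule twist_base_power_Suc[OF VE])
    finally show ?case .
  qed
qed

lemma twist_base_cocycle:
  fixes E A E' A' :: "'b fps" and d x :: 'b
  assumes AE: "A * E = E * A + fps_X * (A * A)" and AE': "A' * E' = E' * A' + fps_X * (A' * A')"
    and dE: "fps_const d * E = E * (fps_const d + 1)" and dA: "fps_const d * A = A * (fps_const d + 1)"
    and comm: "E' * E = E * E'" "E' * A = A * E'" "A' * E = E * A'" "A' * A = A * A'"
    and dE': "E' * fps_const d = fps_const d * E'" and dA': "A' * fps_const d = fps_const d * A'"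
    and x: "E * fps_const x = fps_const x * E" "A * fps_const x = fps_const x * A"
      "E' * fps_const x = fps_const x * E'" "A' * fps_const x = fps_const x * A'"
      "fps_const d * fps_const x = fps_const x * fps_const d"
  defines "G \<equiv> \<lambda>x. fpower \<eta> (twist_base E' A' x) x"
  shows "fpower \<eta> (twist_base E A (fps_const x)) (fps_const x) * G (fps_const x + fps_const d)
    = G (fps_const d) * fpower \<eta> (twist_base (E + E' - 2 * (fps_X * (fps_const d * A'))) (A +
        A') (fps_const x)) (fps_const x)"
proof (rule fps_polyrel_unique)
  let ?L = "\<lambda>x. fpower \<eta> (twist_base E A x) x * G (x + fps_const d)"
  let ?R = "\<lambda>x. G (fps_const d) *
    fpower \<eta> (twist_base (E + E' - 2 * (fps_X * (fps_const d * A'))) (A + A') x) x"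
  show "fps_polyrel x (\<lambda>m. ?L (of_nat m)) (?L (fps_const x))"
    unfolding G_def twist_base_def
    by (intro fps_polyrel_intros) (simp_all only: x fps_mult_fps_X_commute mult_1_left
        mult_1_right fps_mult_fps_X_power_commute)
  have 2: "2 * fps_const x = fps_const x * 2"
    by (simp add: mult_2 mult_2_right)
  show "fps_polyrel x (\<lambda>m. ?R (of_nat m)) (?R (fps_const x))"
    unfolding G_def twist_base_def
    by (intro fps_polyrel_intros) (simp_all only: x 2 fps_mult_fps_X_commute mult_1_left
        mult_1_right fps_mult_fps_X_power_commute)
  fix m
  show "?L (of_nat m) = ?R (of_nat m)"
    using twist_base_cocycle_of_nat[OF AE AE' dE dA comm dE' dA', of m]
    by (simp add: fpower_of_nat G_def)
qed

end

section \<open>Relations in the enveloping algebra\<close>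

lemma U_of_matrix_add:
  assumes "trace A = 0" "trace B = 0"
  shows "U_of_matrix (A + B) = U_of_matrix A + U_of_matrix B"
proof -
  have "sl3_add (Abs_sl3 A) (Abs_sl3 B) = Abs_sl3 (A + B)"
    using assms by (simp add: sl3_add.rep_eq Abs_sl3_inverse trace_add flip: sl3_matrix_inject)
  then show ?thesis by (simp add: U_of_matrix_def flip: \<iota>_add)
qed

lemma U_of_matrix_bracket:
  assumes "trace A = 0" "trace B = 0" "A ** B - B ** A = C"
  shows "U_of_matrix A * U_of_matrix B = U_of_matrix B * U_of_matrix A + U_of_matrix C"
proof -
  have "trace C = 0"
    unfolding assms(3)[symmetric] trace_sub by (subst trace_mul_sym) simp
  then have "sl3_bracket (Abs_sl3 A) (Abs_sl3 B) = Abs_sl3 C"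
    using assms by (simp add: sl3_bracket.rep_eq Abs_sl3_inverse flip: sl3_matrix_inject)
  then show ?thesis
    using \<iota>_bracket[of "Abs_sl3 A" "Abs_sl3 B"] by (simp add: U_of_matrix_def)
qed

lemma U_of_matrix_zero: "U_of_matrix 0 = 0"
  using U_of_matrix_add[of 0 0] by (simp add: trace_def)

lemma U_of_matrix_uminus:
  assumes "trace A = 0"
  shows "U_of_matrix (- A) = - U_of_matrix A"
proof -
  have "trace (- A) = 0" using assms by (simp add: trace_def sum_negf)
  then show ?thesis
    using U_of_matrix_add[OF assms, of "- A"] by (simp add: U_of_matrix_zero eq_neg_iff_add_eq_0
        add.commute)
qed

lemmas mat3_simps = vec_eq_iff forall_3 matrix_matrix_mult_def sum_3 mat_unit_def mscale_def

lemma cartan_mat_eq: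
  "cartan_mat 1 = (mscale (2/3) (mat_unit 1 1) - mscale (1/3) (mat_unit 2 2 + mat_unit 3 3)
    :: 'k::field_char_0^3^3)"
  "cartan_mat 2 = (mscale (1/3) (mat_unit 1 1 + mat_unit 2 2) - mscale (2/3) (mat_unit 3 3)
    :: 'k::field_char_0^3^3)"
  by (simp_all add: cartan_mat_def numeral_2_eq_2 numeral_3_eq_3)

lemma trace_generators:
  "trace (cartan_mat 1 :: 'k::field^3^3) = 0" "trace (cartan_mat 2 :: 'k::field^3^3) = 0"
  "trace (mat_unit 1 2 :: 'k::field^3^3) = 0" "trace (mat_unit 1 3 :: 'k::field^3^3) = 0"
  "trace (mat_unit 2 3 :: 'k::field^3^3) = 0" "trace (mat_unit 3 2 :: 'k::field^3^3) = 0"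
  by (simp_all add: trace_cartan_mat trace_mat_unit)

lemma U_of_matrix_commute:
  assumes "trace A = 0" "trace B = 0" "A ** B - B ** A = 0"
  shows "U_of_matrix A * U_of_matrix B = U_of_matrix B * U_of_matrix A"
  using U_of_matrix_bracket[OF assms] by (simp add: U_of_matrix_zero)

lemma U_relations:
  fixes D1 D2 :: "'k::field_char_0 U"
  defines "D1 \<equiv> D\<^sub>U 1" and "D2 \<equiv> D\<^sub>U 2"
  shows "D1 * D2 = D2 * D1"
    and "D1 * E\<^sub>U 1 2 = E\<^sub>U 1 2 * D1 + E\<^sub>U 1 2"
    and "D1 * E\<^sub>U 1 3 = E\<^sub>U 1 3 * D1 + E\<^sub>U 1 3"
    and "D1 * E\<^sub>U 2 3 = E\<^sub>U 2 3 * D1"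
    and "D1 * E\<^sub>U 3 2 = E\<^sub>U 3 2 * D1"
    and "D2 * E\<^sub>U 1 2 = E\<^sub>U 1 2 * D2"
    and "D2 * E\<^sub>U 1 3 = E\<^sub>U 1 3 * D2 + E\<^sub>U 1 3"
    and "D2 * E\<^sub>U 2 3 = E\<^sub>U 2 3 * D2 + E\<^sub>U 2 3"
    and "E\<^sub>U 3 2 * D2 = D2 * E\<^sub>U 3 2 + E\<^sub>U 3 2"
    and "E\<^sub>U 1 3 * E\<^sub>U 1 2 = E\<^sub>U 1 2 * (E\<^sub>U 1 3 :: 'k U)"
    and "E\<^sub>U 3 2 * E\<^sub>U 1 2 = E\<^sub>U 1 2 * (E\<^sub>U 3 2 :: 'k U)"
    and "E\<^sub>U 1 3 * E\<^sub>U 2 3 = E\<^sub>U 2 3 * (E\<^sub>U 1 3 :: 'k U)"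
    and "E\<^sub>U 1 2 * E\<^sub>U 2 3 = E\<^sub>U 2 3 * E\<^sub>U 1 2 + (E\<^sub>U 1 3 :: 'k U)"
    and "E\<^sub>U 1 3 * E\<^sub>U 3 2 = E\<^sub>U 3 2 * E\<^sub>U 1 3 + (E\<^sub>U 1 2 :: 'k U)"
    and "E\<^sub>U 2 3 * E\<^sub>U 3 2 = E\<^sub>U 3 2 * E\<^sub>U 2 3 + (D2 + D2 - D1)"
proof -
  note tr = trace_generators[where 'k = 'k]
  have "trace (cartan_mat 2 + cartan_mat 2 :: 'k^3^3) = 0"
    by (simp only: trace_add tr add_0)
  moreover have "trace (- cartan_mat 1 :: 'k^3^3) = 0"
    using tr(1) by (simp only: trace_def vector_uminus_component sum_negf minus_zero)
  ultimately have H: "U_of_matrix (cartan_mat 2 + cartan_mat 2 + - cartan_mat 1) = D2 + D2 - D1"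
    unfolding D1_def D2_def D\<^sub>U_def diff_conv_add_uminus
    by (simp only: U_of_matrix_add U_of_matrix_uminus tr)
  show "E\<^sub>U 2 3 * E\<^sub>U 3 2 = E\<^sub>U 3 2 * E\<^sub>U 2 3 + (D2 + D2 - D1)"
    unfolding H[symmetric] E\<^sub>U_def
    by (rule U_of_matrix_bracket, fact trace_generators, fact trace_generators, unfold cartan_mat_eq)
      (simp add: mat3_simps)
qed (unfold D1_def D2_def E\<^sub>U_def D\<^sub>U_def,
    (rule U_of_matrix_commute U_of_matrix_bracket, fact trace_generators, fact trace_generators,
      (unfold cartan_mat_eq)?, simp add: mat3_simps; fail)+)

section \<open>The structure maps as homomorphisms\<close>

global_interpretation expU: scalars_char_0 scalU ..
global_interpretation expUU: scalars_char_0 scalUU ..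
global_interpretation expUUU: scalars_char_0 scalUUU ..

lemma scalUU_eq: "scalUU c = scalU c \<otimes>\<^sub>U 1" "scalUU c = 1 \<otimes>\<^sub>U scalU c"
  using tensor2_scal_left[of c 1 1] tensor2_scal_right[of 1 c 1] by (simp_all add: tensor2_one)

lemma scalUUU_eq:
  "scalUUU c = tensor3 (scalU c) 1 1" "scalUUU c = tensor3 1 (scalU c) 1"
  "scalUUU c = tensor3 1 1 (scalU c)"
  using tensor3_scal(1)[of c 1 1 1] tensor3_scal(2)[of 1 c 1 1] tensor3_scal(3)[of 1 1 c 1]
  by (simp_all add: tensor3_one)

global_interpretation fst2: alg_hom scalU scalUU "\<lambda>a. a \<otimes>\<^sub>U 1"
  by standard (simp_all add: tensor2_add_left tensor2_mult scalUU_eq(1))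

global_interpretation snd2: alg_hom scalU scalUU "\<lambda>a. 1 \<otimes>\<^sub>U a"
  by standard (simp_all add: tensor2_add_right tensor2_mult scalUU_eq(2))

global_interpretation fst3: alg_hom scalU scalUUU "\<lambda>a. tensor3 a 1 1"
  by standard (simp_all add: tensor3_add tensor3_mult scalUUU_eq(1))

global_interpretation snd3: alg_hom scalU scalUUU "\<lambda>a. tensor3 1 a 1"
  by standard (simp_all add: tensor3_add tensor3_mult scalUUU_eq(2))

global_interpretation trd3: alg_hom scalU scalUUU "\<lambda>a. tensor3 1 1 a"
  by standard (simp_all add: tensor3_add tensor3_mult scalUUU_eq(3))

global_interpretation comul: alg_hom scalU scalUU comul
  by standard (simp_all add: comul_add comul_mult comul_scal)

global_interpretation leg12: alg_hom scalUU scalUUU leg12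
  by standard (simp_all add: legs_add legs_mult legs_scal)

global_interpretation leg23: alg_hom scalUU scalUUU leg23
  by standard (simp_all add: legs_add legs_mult legs_scal)

lemma structure_maps_add:
  "comul_id (x + y) = comul_id x + comul_id y" "id_comul (x + y) = id_comul x + id_comul y"
  "counit_id (x + y) = counit_id x + counit_id y" "id_counit (x + y) = id_counit x + id_counit y"
  "flip2 (x + y) = flip2 x + flip2 y"
  by (induct x rule: UU.abs_induct, induct y rule: UU.abs_induct,
      simp add: comul_id_abs id_comul_abs counit_id_abs id_counit_abs flip2_abs plus_UU.abs_eq
        scalUUU.malg_lift_add scalUU.malg_lift_add scalU.malg_lift_add)+

lemma UU_mult_induct:
  assumes "\<And>x y. h (x + y) = h x + (h y :: 'b::ring_1)"
    and "\<And>a b a' b'. h ((a * a') \<otimes>\<^sub>U (b * b')) = h (a \<otimes>\<^sub>U b) * h (a' \<otimes>\<^sub>U b')"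
  shows "h (x * y) = h x * h (y :: 'k::field UU)"
proof (induct x rule: UU_induct)
  case (tensor a b)
  show ?case
    by (induct y rule: UU_induct) (simp_all add: assms tensor2_mult distrib_left)
qed (simp add: assms(1) distrib_right)

lemma comul_id_mult: "comul_id (x * y) = comul_id x * comul_id y"
  by (rule UU_mult_induct)
    (simp_all add: structure_maps_add structure_maps_tensor comul_mult legs_mult tensor3_mult
      mult.assoc flip: mult.assoc[of "tensor3 1 1 _"] leg12_commute)

lemma id_comul_mult: "id_comul (x * y) = id_comul x * id_comul y"
proof (rule UU_mult_induct)
  fix a b a' b' :: "'a U"
  have "tensor3 (a * a') 1 1 * (leg23 (comul b) * leg23 (comul b'))
      = tensor3 a 1 1 * (tensor3 a' 1 1 * leg23 (comul b)) * leg23 (comul b')"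
    by (simp add: tensor3_mult flip: mult.assoc)
  also have "tensor3 a' 1 1 * leg23 (comul b) = leg23 (comul b) * tensor3 a' 1 1"
    by (rule leg23_commute[symmetric])
  finally show "id_comul ((a * a') \<otimes>\<^sub>U (b * b')) = id_comul (a \<otimes>\<^sub>U b) * id_comul (a' \<otimes>\<^sub>U b')"
    by (simp add: structure_maps_tensor comul_mult legs_mult mult.assoc)
qed (rule structure_maps_add)

global_interpretation comul_id: alg_hom scalUU scalUUU comul_id
proof
  show "comul_id (scalUU c) = scalUUU c" for c :: 'a
    by (simp add: scalUU_eq(2) structure_maps_tensor comul_one legs_one scalUUU_eq(3))
qed (fact structure_maps_add comul_id_mult)+

global_interpretation id_comul: alg_hom scalUU scalUUU id_comul
proof
  show "id_comul (scalUU c) = scalUUU c" for c :: 'a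
    by (simp add: scalUU_eq(1) structure_maps_tensor comul_one legs_one scalUUU_eq(1))
qed (fact structure_maps_add id_comul_mult)+

global_interpretation counit_id: alg_hom scalUU scalU counit_id
proof
  show "counit_id (x * y) = counit_id x * counit_id y" for x y :: "'a UU"
    by (rule UU_mult_induct)
      (simp_all add: structure_maps_add structure_maps_tensor counit_mult scalU_mult_bilinear)
  show "counit_id (scalUU c) = scalU c" for c :: 'a
    by (simp add: scalUU_eq(2) structure_maps_tensor counit_one scalU.scal_one)
qed (fact structure_maps_add)

global_interpretation id_counit: alg_hom scalUU scalU id_counit
proof
  show "id_counit (x * y) = id_counit x * id_counit y" for x y :: "'a UU"
    by (rule UU_mult_induct)
      (simp_all add: structure_maps_add structure_maps_tensor counit_mult scalU_mult_bilinear)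
  show "id_counit (scalUU c) = scalU c" for c :: 'a
    by (simp add: scalUU_eq(1) structure_maps_tensor counit_one scalU.scal_one)
qed (fact structure_maps_add)

abbreviation in\<^sub>1 :: "'k::field U fps \<Rightarrow> 'k UU fps" where "in\<^sub>1 \<equiv> fps_coeffwise (\<lambda>a. a \<otimes>\<^sub>U 1)"
abbreviation in\<^sub>2 :: "'k::field U fps \<Rightarrow> 'k UU fps" where "in\<^sub>2 \<equiv> fps_coeffwise (\<lambda>a. 1 \<otimes>\<^sub>U a)"
abbreviation at\<^sub>1 :: "'k::field U fps \<Rightarrow> 'k UUU fps" where "at\<^sub>1 \<equiv> fps_coeffwise (\<lambda>a. tensor3 a 1 1)"
abbreviation at\<^sub>2 :: "'k::field U fps \<Rightarrow> 'k UUU fps" where "at\<^sub>2 \<equiv> fps_coeffwise (\<lambda>a. tensor3 1 a 1)"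
abbreviation at\<^sub>3 :: "'k::field U fps \<Rightarrow> 'k UUU fps" where "at\<^sub>3 \<equiv> fps_coeffwise (\<lambda>a. tensor3 1 1 a)"

lemma fps_coeffwise_commute:
  assumes "\<And>a b. h a * g b = g b * h a"
  shows "fps_coeffwise h f * fps_coeffwise g f'
      = fps_coeffwise g f' * (fps_coeffwise h f :: 'a::ring_1 fps)"
proof (rule fps_ext)
  fix n
  show "(fps_coeffwise h f * fps_coeffwise g f') $ n = (fps_coeffwise g f' * fps_coeffwise h f) $ n"
    unfolding fps_mult_nth fps_coeffwise_def fps_nth_Abs_fps
    by (subst sum.atLeastAtMost_rev) (simp add: assms)
qed

lemma in_commute: "in\<^sub>2 g * in\<^sub>1 f = in\<^sub>1 f * in\<^sub>2 g"
  by (rule fps_coeffwise_commute) (simp add: tensor2_mult)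

lemma at_commute:
  "at\<^sub>2 g * at\<^sub>1 f = at\<^sub>1 f * at\<^sub>2 g" "at\<^sub>3 g * at\<^sub>1 f = at\<^sub>1 f * at\<^sub>3 g" "at\<^sub>3 g * at\<^sub>2 f = at\<^sub>2 f * at\<^sub>3 g"
  by (rule fps_coeffwise_commute; simp add: tensor3_mult)+

lemma fps_tensor_eq: "f \<otimes>\<^sub>\<zeta> g = in\<^sub>1 f * in\<^sub>2 (g :: 'k::field U fps)"
  by (rule fps_ext) (simp add: fps_tensor_def fps_mult_nth fps_coeffwise_def tensor2_mult)

lemma fps_coeffwise_compose: "fps_coeffwise h (fps_coeffwise g f) = fps_coeffwise (\<lambda>a. h (g a)) f"
  by (simp add: fps_coeffwise_def)

lemma hom_in:
  "fps_coeffwise leg12 (in\<^sub>1 f) = at\<^sub>1 f" "fps_coeffwise leg12 (in\<^sub>2 f) = at\<^sub>2 f"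
  "fps_coeffwise leg23 (in\<^sub>1 f) = at\<^sub>2 f" "fps_coeffwise leg23 (in\<^sub>2 f) = at\<^sub>3 f"
  "fps_coeffwise comul_id (in\<^sub>1 f) = fps_coeffwise leg12 (fps_coeffwise comul f)"
  "fps_coeffwise comul_id (in\<^sub>2 f) = at\<^sub>3 f"
  "fps_coeffwise id_comul (in\<^sub>1 f) = at\<^sub>1 f"
  "fps_coeffwise id_comul (in\<^sub>2 f) = fps_coeffwise leg23 (fps_coeffwise comul f)"
  by (simp_all add: fps_coeffwise_compose legs_tensor structure_maps_tensor comul_one legs_one
      tensor3_one)

section \<open>The extended Jordanian twist\<close>

lemma fps_tensor_mult: "(f \<otimes>\<^sub>\<zeta> g) * (f' \<otimes>\<^sub>\<zeta> g') = (f * f') \<otimes>\<^sub>\<zeta> (g * (g' :: 'k::field_char_0 U fps))"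
  unfolding fps_tensor_eq fst2.hom_fps_mult snd2.hom_fps_mult
  by (simp only: mult.assoc) (simp only: in_commute flip: mult.assoc)

lemma fps_tensor_linear:
  fixes f g :: "'k::field_char_0 U fps"
  shows "(f + f') \<otimes>\<^sub>\<zeta> g = f \<otimes>\<^sub>\<zeta> g + f' \<otimes>\<^sub>\<zeta> g" "f \<otimes>\<^sub>\<zeta> (g + g') = f \<otimes>\<^sub>\<zeta> g + f \<otimes>\<^sub>\<zeta> g'"
    "(f - f') \<otimes>\<^sub>\<zeta> g = f \<otimes>\<^sub>\<zeta> g - f' \<otimes>\<^sub>\<zeta> g" "f \<otimes>\<^sub>\<zeta> (g - g') = f \<otimes>\<^sub>\<zeta> g - f \<otimes>\<^sub>\<zeta> g'"
    "(fps_X * f) \<otimes>\<^sub>\<zeta> g = fps_X * (f \<otimes>\<^sub>\<zeta> g)" "f \<otimes>\<^sub>\<zeta> (fps_X * g) = fps_X * (f \<otimes>\<^sub>\<zeta> g)"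
  by (simp_all add: fps_tensor_eq fst2.hom_fps_simps snd2.hom_fps_simps algebra_simps
      fps_X_left_commute[of "in\<^sub>1 f"])

lemma in_eq: "in\<^sub>1 f = f \<otimes>\<^sub>\<zeta> 1" "in\<^sub>2 f = 1 \<otimes>\<^sub>\<zeta> (f :: 'k::field_char_0 U fps)"
  by (simp_all add: fps_tensor_eq fst2.hom_fps_one snd2.hom_fps_one)

text \<open>
  With this rewrite rule active, \<open>D\<^sub>U 1\<close> would not match the relations between the generators.
\<close>

declare One_nat_def [simp del]

abbreviation D1 :: "'k::field_char_0 U fps" where "D1 \<equiv> fps_const (D\<^sub>U 1)"
abbreviation D2 :: "'k::field_char_0 U fps" where "D2 \<equiv> fps_const (D\<^sub>U 2)"
abbreviation e12 :: "'k::field_char_0 U fps" where "e12 \<equiv> fps_const (E\<^sub>U 1 2)"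
abbreviation e13 :: "'k::field_char_0 U fps" where "e13 \<equiv> fps_const (E\<^sub>U 1 3)"
abbreviation e23 :: "'k::field_char_0 U fps" where "e23 \<equiv> fps_const (E\<^sub>U 2 3)"
abbreviation e32 :: "'k::field_char_0 U fps" where "e32 \<equiv> fps_const (E\<^sub>U 3 2)"

lemmas generator_relations = U_relations[THEN arg_cong[where f = fps_const],
    folded fps_const_mult fps_const_add fps_const_sub]

definition omega :: "'k::field_char_0 U fps" where "omega = 1 - fps_X * e12"
definition sigma :: "'k::field_char_0 U fps" where "sigma = fln scalU omega"
text \<open>
  The element \<open>A\<close>. Unlike \<open>E13\<close> it is primitive under \<open>\<Delta>\<^sub>J\<close>, and \<open>A E23 - E23 A = \<zeta> A\<^sup>2\<close>.
\<close>

definition A13 :: "'k::field_char_0 U fps" where "A13 = e13 * fexp scalU (- sigma)"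

lemma omega_nth_0 [simp]: "omega $ 0 = 1"
  by (simp add: omega_def)

lemma sigma_nth_0 [simp]: "sigma $ 0 = 0"
  by (simp add: sigma_def)

lemma fexp_sigma: "fexp scalU sigma = omega"
  by (simp add: sigma_def expU.fexp_fln)

lemma omega_inverse: "omega * fexp scalU (- sigma) = 1" "fexp scalU (- sigma) * omega = 1"
  using expU.fexp_minus[of sigma] by (simp_all add: fexp_sigma)

lemma commute_omega:
  assumes "b * e12 = e12 * b"
  shows "b * omega = omega * b" "b * sigma = sigma * b"
    "b * fexp scalU (- sigma) = fexp scalU (- sigma) * b"
proof -
  show 1: "b * omega = omega * b"
    by (simp add: omega_def right_diff_distrib left_diff_distrib fps_X_left_commute[of b] assms
        mult.assoc)
  show 2: "b * sigma = sigma * b"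
    unfolding sigma_def by (rule expU.fln_intertwine) (simp_all add: 1)
  show "b * fexp scalU (- sigma) = fexp scalU (- sigma) * b"
    by (rule expU.fexp_intertwine) (simp_all add: 2)
qed

lemma omega_sigma: "omega * sigma = sigma * omega"
  by (rule commute_omega(2)) (simp add: omega_def algebra_simps fps_mult_fps_X_commute)

lemma A13_omega: "A13 * omega = e13" "omega * A13 = e13"
  by (simp_all add: A13_def mult.assoc omega_inverse
      flip: mult.assoc[of omega] commute_omega[of e13, OF generator_relations(10)])

lemma A13_commute:
  "A13 * e12 = e12 * A13" "A13 * sigma = sigma * A13" "A13 * e13 = e13 * A13"
proof -
  have w: "fexp scalU (- sigma) * e12 = e12 * fexp scalU (- sigma)"
    by (rule commute_omega(3)[symmetric]) simp
  show 1: "A13 * e12 = e12 * A13"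
    unfolding A13_def
    by (simp only: mult.assoc w) (simp only: generator_relations(10) flip: mult.assoc)
  show "A13 * sigma = sigma * A13" by (rule commute_omega(2)[OF 1])
  show "A13 * e13 = e13 * A13"
    unfolding A13_def by (simp only: mult.assoc flip: commute_omega(3)[OF generator_relations(10)])
qed

lemma D2_A13: "D2 * (A13 :: 'k::field_char_0 U fps) = A13 * D2 + A13"
proof -
  have "D2 * (A13 :: 'k U fps) = (D2 * e13) * fexp scalU (- sigma)" by (simp only: A13_def mult.assoc)
  also have "\<dots> = e13 * (D2 * fexp scalU (- sigma)) + A13"
    unfolding generator_relations(7) by (simp only: A13_def mult.assoc distrib_right)
  finally show ?thesis
    by (simp only: commute_omega(3)[OF generator_relations(6)] A13_def mult.assoc)
qed

lemma omega_e23: "omega * (e23 :: 'k::field_char_0 U fps) = (e23 - fps_X * A13) * omega"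
proof -
  have "omega * e23 = (e23 :: 'k U fps) - fps_X * (e12 * e23)"
    by (simp only: omega_def left_diff_distrib mult_1_left mult.assoc)
  also have "\<dots> = e23 * omega - fps_X * e13"
    unfolding generator_relations(13)
    by (simp only: omega_def right_diff_distrib distrib_left mult_1_right fps_X_left_commute[of
        e23] diff_diff_add)
  finally show ?thesis
    by (simp only: left_diff_distrib mult.assoc A13_omega)
qed

lemma A13_e23: "A13 * (e23 :: 'k::field_char_0 U fps) = e23 * A13 + fps_X * (A13 * A13)"
proof -
  let ?w = "fexp scalU (- sigma) :: 'k U fps"
  have "e23 * ?w = ?w * (omega * e23) * ?w"
    by (simp only: mult.assoc[symmetric] omega_inverse mult_1_left)
  also have "\<dots> = ?w * (e23 - fps_X * A13)"
    unfolding omega_e23 by (simp only: mult.assoc omega_inverse mult_1_right)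
  also have "\<dots> = ?w * e23 - fps_X * (?w * A13)"
    by (simp only: right_diff_distrib fps_X_left_commute[of ?w])
  finally have "?w * e23 = e23 * ?w + fps_X * (?w * A13)"
    by (simp only: eq_diff_eq)
  then have "e13 * (?w * e23) = e13 * (e23 * ?w + fps_X * (?w * A13))"
    by (simp only:)
  also have "\<dots> = e23 * A13 + fps_X * (A13 * A13)"
    by (simp only: distrib_left fps_X_left_commute[of e13])
      (simp only: A13_def generator_relations(12) flip: mult.assoc)
  finally show ?thesis by (simp only: A13_def mult.assoc)
qed

lemma omega_power_e23:
  "omega ^ n * (e23 :: 'k::field_char_0 U fps) = (e23 - fps_X * (of_nat n * A13)) * omega ^ n"
proof (induction n)
  case (Suc n)
  have "omega ^ Suc n * (e23 :: 'k U fps) = omega ^ n * ((e23 - fps_X * A13) * omega)"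
    by (simp only: power_Suc2 mult.assoc omega_e23)
  also have "\<dots> = (omega ^ n * e23) * omega - fps_X * (omega ^ n * A13 * omega)"
    by (simp only: left_diff_distrib right_diff_distrib mult.assoc fps_X_left_commute[of "omega ^ n"])
  also have "omega ^ n * A13 = A13 * (omega ^ n :: 'k U fps)"
    by (rule commute_power[symmetric]) (simp add: A13_omega)
  also have "omega ^ n * e23 * omega = ((e23 :: 'k U fps) - fps_X * (of_nat n * A13)) * omega ^ Suc n"
    by (subst Suc) (simp only: power_Suc2 mult.assoc)
  finally show ?case
    by (simp add: left_diff_distrib distrib_right distrib_left mult.assoc power_Suc2 del: power_Suc)
qed simp

lemma fps_tensor_nth_0 [simp]: "(f \<otimes>\<^sub>\<zeta> g) $ 0 = (f $ 0) \<otimes>\<^sub>U (g $ 0)"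
  by (simp add: fps_tensor_def)

definition jordanian :: "'k::field_char_0 UU fps" where
  "jordanian = fexp scalUU (D1 \<otimes>\<^sub>\<zeta> sigma)"

definition extension :: "'k::field_char_0 UU fps" where
  "extension = fexp scalUU (fps_X * (e32 \<otimes>\<^sub>\<zeta> A13))"

lemma jordanian_commute:
  assumes "b * D1 = D1 * b" "g * sigma = sigma * g"
  shows "jordanian * (b \<otimes>\<^sub>\<zeta> g) = (b \<otimes>\<^sub>\<zeta> g) * jordanian"
  unfolding jordanian_def
  by (rule expUU.fexp_intertwine[symmetric]) (simp_all add: tensor2_zero fps_tensor_mult assms)

text \<open>
  As \<open>D1 b = b (D1 + 1)\<close>, moving \<open>b \<otimes> 1\<close> to the left adds \<open>1 \<otimes> \<sigma>\<close> to the exponent,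
  and \<open>exp(\<sigma>) = \<omega>\<close>.
\<close>

lemma jordanian_shift:
  fixes b :: "'k::field_char_0 U fps"
  assumes "D1 * b = b * D1 + b"
  shows "jordanian * (b \<otimes>\<^sub>\<zeta> 1) = (b \<otimes>\<^sub>\<zeta> omega) * jordanian"
proof -
  let ?f = "D1 \<otimes>\<^sub>\<zeta> (sigma :: 'k U fps)"
  have f0: "?f $ 0 = 0" "(1 \<otimes>\<^sub>\<zeta> (sigma :: 'k U fps)) $ 0 = 0" by (simp_all add: tensor2_zero)
  have "fexp scalUU (1 \<otimes>\<^sub>\<zeta> sigma) = 1 \<otimes>\<^sub>\<zeta> (omega :: 'k U fps)"
    by (simp add: fexp_sigma flip: in_eq snd2.hom_fps_fexp)
  then have exp: "fexp scalUU (1 \<otimes>\<^sub>\<zeta> sigma + ?f) = (1 \<otimes>\<^sub>\<zeta> omega) * jordanian"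
    unfolding jordanian_def by (subst expUU.fexp_add) (simp_all add: tensor2_zero fps_tensor_mult)
  have "(b \<otimes>\<^sub>\<zeta> 1) * fexp scalUU (1 \<otimes>\<^sub>\<zeta> sigma + ?f) = fexp scalUU ?f * (b \<otimes>\<^sub>\<zeta> 1)"
    by (rule expUU.fexp_intertwine)
      (simp_all add: tensor2_zero distrib_left fps_tensor_mult assms fps_tensor_linear)
  then show ?thesis
    unfolding exp by (simp add: fps_tensor_mult jordanian_def flip: mult.assoc)
qed

text \<open>
  For \<open>n\<close> in place of \<open>D1 \<otimes> 1\<close> this is conjugation by \<open>\<omega>\<^sup>n\<close>; interpolation in \<open>n\<close> gives the rest.
\<close>

lemma jordanian_e23:
  "jordanian * (1 \<otimes>\<^sub>\<zeta> (e23 :: 'k::field_char_0 U fps)) = (1 \<otimes>\<^sub>\<zeta> e23 - fps_X * (D1 \<otimes>\<^sub>\<zeta> A13)) * jordanian"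
proof -
  let ?d = "(D\<^sub>U 1 :: 'k U) \<otimes>\<^sub>U 1"
  let ?L = "\<lambda>x. fexp scalUU (x * in\<^sub>2 sigma) * in\<^sub>2 (e23 :: 'k U fps)"
  let ?R = "\<lambda>x. (in\<^sub>2 (e23 :: 'k U fps) - fps_X * (x * in\<^sub>2 A13)) * fexp scalUU (x * in\<^sub>2 sigma)"
  have d: "fps_const ?d = in\<^sub>1 D1"
    by (simp add: fst2.hom_fps_const)
  note comm = in_commute fps_mult_fps_X_commute
  have "fps_polyrel ?d (\<lambda>n. ?L (of_nat n)) (?L (fps_const ?d))"
    by (intro expUU.fps_polyrel_intros) (simp_all only: d comm)
  moreover have "fps_polyrel ?d (\<lambda>n. ?R (of_nat n)) (?R (fps_const ?d))"
    by (intro expUU.fps_polyrel_intros) (simp_all only: d comm)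
  moreover have "?L (of_nat n) = ?R (of_nat n)" for n
  proof -
    have "fexp scalUU (of_nat n * in\<^sub>2 sigma) = in\<^sub>2 (omega ^ n :: 'k U fps)"
      by (subst expUU.fexp_of_nat_mult)
        (simp_all add: snd2.hom_fps_nth tensor2_zero snd2.hom_fps_power fexp_sigma
          flip: snd2.hom_fps_fexp)
    then show ?thesis
      using arg_cong[OF omega_power_e23[of n], of in\<^sub>2]
      by (simp only: snd2.hom_fps_mult snd2.hom_fps_diff snd2.hom_fps_X snd2.hom_fps_of_nat)
  qed
  ultimately have "?L (in\<^sub>1 D1) = ?R (in\<^sub>1 D1)"
    unfolding d by (rule expUU.fps_polyrel_unique)
  then show ?thesis
    by (simp only: jordanian_def in_eq fps_tensor_mult mult_1_left mult_1_right)
qed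

lemma extension_commute:
  assumes "b * e32 = e32 * b" "g * A13 = A13 * g"
  shows "extension * (b \<otimes>\<^sub>\<zeta> g) = (b \<otimes>\<^sub>\<zeta> g) * extension"
  unfolding extension_def
  by (rule expUU.fexp_intertwine[symmetric])
    (simp_all add: fps_X_left_commute[of "b \<otimes>\<^sub>\<zeta> g"] fps_tensor_mult assms mult.assoc)

lemma extension_e13:
  "extension * ((e13 :: 'k::field_char_0 U fps) \<otimes>\<^sub>\<zeta> omega)
      = (e13 \<otimes>\<^sub>\<zeta> omega - fps_X * (e12 \<otimes>\<^sub>\<zeta> e13)) * extension"
proof -
  let ?f = "fps_X * (e32 \<otimes>\<^sub>\<zeta> A13)" and ?Y = "(e13 :: 'k U fps) \<otimes>\<^sub>\<zeta> omega" and ?Z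
      = "- fps_X * ((e12 :: 'k U fps) \<otimes>\<^sub>\<zeta> e13)"
  have "e32 * e13 = e13 * e32 - (e12 :: 'k U fps)"
    by (simp only: generator_relations(14) add_diff_cancel_right')
  then have "?f * ?Y = ?Y * ?f + ?Z"
    by (simp add: mult.assoc fps_X_left_commute[of ?Y] fps_tensor_mult A13_omega fps_tensor_linear
        right_diff_distrib del: fps_const_mult)
  moreover have "?f * ?Z = ?Z * ?f + 2 * 0"
    by (simp add: mult.assoc fps_X_left_commute[of "_ \<otimes>\<^sub>\<zeta> _"] fps_tensor_mult A13_commute
        generator_relations(11) del: fps_const_mult)
  ultimately have "extension * ?Y = (?Y + ?Z + 0) * extension"
    unfolding extension_def by (intro expUU.fexp_ad) simp_all
  then show ?thesis by simp
qed

text \<open>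
  This conjugation stops only at the second commutator: \<open>E32\<close> maps \<open>E23\<close> to \<open>D1 - 2 D2\<close> and this
  to a multiple of \<open>E32\<close>. The resulting term \<open>- \<zeta>\<^sup>2 E32 \<otimes> A\<^sup>2\<close> cancels the one that \<open>1 \<otimes> E23\<close>
  contributes through \<open>[A, E23] = \<zeta> A\<^sup>2\<close>.
\<close>

lemma extension_e23:
  "extension * ((e23 :: 'k::field_char_0 U fps) \<otimes>\<^sub>\<zeta> 1 + 1 \<otimes>\<^sub>\<zeta> e23 - fps_X * (D1 \<otimes>\<^sub>\<zeta> A13))
    = (e23 \<otimes>\<^sub>\<zeta> 1 + 1 \<otimes>\<^sub>\<zeta> e23 - 2 * (fps_X * (D2 \<otimes>\<^sub>\<zeta> A13))) * extension"
proof -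
  let ?f = "fps_X * (e32 \<otimes>\<^sub>\<zeta> A13)" and ?Y = "(e23 :: 'k U fps) \<otimes>\<^sub>\<zeta> 1 + 1 \<otimes>\<^sub>\<zeta> e23 - fps_X * (D1 \<otimes>\<^sub>\<zeta> A13)"
  define V where "V = fps_X * (fps_X * ((e32 :: 'k U fps) \<otimes>\<^sub>\<zeta> (A13 * A13)))"
  define Z where "Z = V + fps_X * ((D1 - D2 - D2) \<otimes>\<^sub>\<zeta> A13)"
  note front = fps_X_left_commute[of "_ \<otimes>\<^sub>\<zeta> _"]
  have e32_e23: "e32 * e23 = e23 * e32 - (D2 + D2 - D1 :: 'k U fps)"
    by (simp only: generator_relations(15) add_diff_cancel_right')
  have "?f * ?Y = ?Y * ?f + Z"
    by (simp add: Z_def V_def distrib_left distrib_right left_diff_distrib right_diff_distrib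
        mult.assoc front
        fps_tensor_mult fps_tensor_linear e32_e23 generator_relations(5) A13_e23
        del: fps_const_mult fps_const_add fps_const_sub)
  moreover have "?f * Z = Z * ?f + 2 * - V"
    by (simp add: Z_def V_def distrib_left distrib_right left_diff_distrib right_diff_distrib
        mult.assoc front mult_2
        fps_tensor_mult fps_tensor_linear generator_relations(5,9)
        del: fps_const_mult fps_const_add fps_const_sub)
  moreover have "?f * - V = - V * ?f"
    by (simp add: V_def mult.assoc front fps_tensor_mult del: fps_const_mult)
  ultimately have "extension * ?Y = (?Y + Z + - V) * extension"
    unfolding extension_def by (intro expUU.fexp_ad) simp_all
  also have "?Y + Z + - V = e23 \<otimes>\<^sub>\<zeta> 1 + 1 \<otimes>\<^sub>\<zeta> e23 - 2 * (fps_X * (D2 \<otimes>\<^sub>\<zeta> A13))"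
    by (simp add: Z_def fps_tensor_linear algebra_simps mult_2 del: fps_const_sub fps_const_add)
  finally show ?thesis .
qed

abbreviation comul_fps :: "'k::field_char_0 U fps \<Rightarrow> 'k UU fps" where
  "comul_fps \<equiv> fps_coeffwise comul"

lemma comul_generators:
  "comul (E\<^sub>U i j) = E\<^sub>U i j \<otimes>\<^sub>U 1 + 1 \<otimes>\<^sub>U E\<^sub>U i j" "comul (D\<^sub>U p) = D\<^sub>U p \<otimes>\<^sub>U 1 + 1 \<otimes>\<^sub>U D\<^sub>U p"
  by (simp_all add: E\<^sub>U_def D\<^sub>U_def U_of_matrix_def comul_\<iota>)

lemma comul_fps_generators:
  "comul_fps (fps_const (E\<^sub>U i j)) = fps_const (E\<^sub>U i j) \<otimes>\<^sub>\<zeta> 1 + 1 \<otimes>\<^sub>\<zeta> fps_const (E\<^sub>U i j)"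
  "comul_fps (fps_const (D\<^sub>U p)) = fps_const (D\<^sub>U p) \<otimes>\<^sub>\<zeta> 1 + 1 \<otimes>\<^sub>\<zeta> fps_const (D\<^sub>U p)"
  by (simp_all add: comul.hom_fps_const comul_generators fst2.hom_fps_const snd2.hom_fps_const
      flip: in_eq)

lemma intertwine_mult:
  fixes x y z :: "'a::semigroup_mult"
  shows "g * x = y * g \<Longrightarrow> f * y = z * f \<Longrightarrow> f * g * x = z * (f * g)"
  by (metis mult.assoc)

definition ext_jordanian :: "'k::field_char_0 UU fps" where
  "ext_jordanian = extension * jordanian"

text \<open>
  This and the following identities of the form \<open>J \<Delta>(u) = \<Delta>\<^sub>J(u) J\<close> compute the twisted coproduct.
  Here \<open>\<omega> = exp(\<sigma>)\<close> is group-like, so \<open>\<sigma>\<close> is primitive; \<open>E13\<close> becomes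
  \<open>E13 \<otimes> \<omega> + \<omega> \<otimes> E13\<close>, so its quotient \<open>A\<close> by \<open>\<omega>\<close> is primitive as well.
\<close>

lemma ext_jordanian_omega:
  "ext_jordanian * comul_fps (omega :: 'k::field_char_0 U fps) = (omega \<otimes>\<^sub>\<zeta> omega) * ext_jordanian"
proof -
  have "1 \<otimes>\<^sub>\<zeta> omega = 1 - fps_X * (1 \<otimes>\<^sub>\<zeta> (e12 :: 'k U fps))"
    by (simp add: omega_def fps_tensor_linear fps_tensor_one)
  then have omega2: "comul_fps omega = 1 \<otimes>\<^sub>\<zeta> omega - fps_X * (e12 \<otimes>\<^sub>\<zeta> (1 :: 'k U fps))"
    by (simp add: omega_def comul.hom_fps_simps comul_fps_generators comul_generators distrib_left
      del: comul.hom_fps_const)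
  have "jordanian * comul_fps (omega :: 'k U fps) = (1 \<otimes>\<^sub>\<zeta> omega - fps_X * (e12 \<otimes>\<^sub>\<zeta> omega)) * jordanian"
    unfolding omega2 right_diff_distrib left_diff_distrib fps_X_left_commute[of jordanian]
    by (simp add: jordanian_shift[OF generator_relations(2)] jordanian_commute omega_sigma mult.assoc)
  also have "1 \<otimes>\<^sub>\<zeta> omega - fps_X * (e12 \<otimes>\<^sub>\<zeta> omega) = omega \<otimes>\<^sub>\<zeta> (omega :: 'k U fps)"
    by (simp only: fps_tensor_linear omega_def[THEN arg_cong[where f = "\<lambda>u. u \<otimes>\<^sub>\<zeta> omega"]])
  finally have "jordanian * comul_fps (omega :: 'k U fps) = (omega \<otimes>\<^sub>\<zeta> omega) * jordanian" .
  moreover have "extension * (omega \<otimes>\<^sub>\<zeta> (omega :: 'k U fps)) = (omega \<otimes>\<^sub>\<zeta> omega) * extension"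
    by (rule extension_commute) (simp_all only: commute_omega[OF generator_relations(11)] A13_omega)
  ultimately show ?thesis
    unfolding ext_jordanian_def by (rule intertwine_mult)
qed

lemma fln_omega_omega: "fln scalUU (omega \<otimes>\<^sub>\<zeta> omega) = in\<^sub>1 sigma + in\<^sub>2 (sigma :: 'k::field_char_0 U fps)"
  unfolding fps_tensor_eq sigma_def fst2.hom_fps_fln snd2.hom_fps_fln
  by (rule expUU.fln_mult) (simp_all add: in_commute fst2.hom_fps_nth snd2.hom_fps_nth tensor2_one)

lemma ext_jordanian_sigma:
  "ext_jordanian * comul_fps sigma = (in\<^sub>1 sigma + in\<^sub>2 (sigma :: 'k::field_char_0 U fps)) * ext_jordanian"
proof -
  have "comul_fps sigma = fln scalUU (comul_fps (omega :: 'k U fps))"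
    by (simp only: sigma_def comul.hom_fps_fln)
  then show ?thesis
    unfolding fln_omega_omega[symmetric]
    by (simp only:, intro expUU.fln_intertwine)
      (simp_all add: ext_jordanian_omega comul.hom_fps_nth comul_one tensor2_one)
qed

lemma fexp_minus_sigma_sigma:
  "fexp scalUU (- (in\<^sub>1 sigma + in\<^sub>2 sigma))
    = fexp scalU (- sigma) \<otimes>\<^sub>\<zeta> fexp scalU (- sigma :: 'k::field_char_0 U fps)"
proof -
  have "fexp scalUU (- in\<^sub>1 sigma + - in\<^sub>2 (sigma :: 'k U fps))
      = fexp scalUU (- in\<^sub>1 sigma) * fexp scalUU (- in\<^sub>2 sigma)"
    by (rule expUU.fexp_add) (simp_all add: in_commute fst2.hom_fps_nth snd2.hom_fps_nth tensor2_zero)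
  then show ?thesis
    by (simp add: fps_tensor_eq fst2.hom_fps_simps snd2.hom_fps_simps)
qed

lemma ext_jordanian_e13:
  "ext_jordanian * comul_fps (e13 :: 'k::field_char_0 U fps)
      = (e13 \<otimes>\<^sub>\<zeta> omega + omega \<otimes>\<^sub>\<zeta> e13) * ext_jordanian"
proof -
  have e13: "e13 * sigma = sigma * (e13 :: 'k U fps)"
    by (rule commute_omega(2)[OF generator_relations(10)])
  have "jordanian * comul_fps e13 = (e13 \<otimes>\<^sub>\<zeta> omega + 1 \<otimes>\<^sub>\<zeta> (e13 :: 'k U fps)) * jordanian"
    unfolding comul_fps_generators distrib_left distrib_right
    by (simp only: jordanian_shift[OF generator_relations(3)] jordanian_commute e13 mult_1_left
        mult_1_right)
  moreover have "extension * (e13 \<otimes>\<^sub>\<zeta> omega + 1 \<otimes>\<^sub>\<zeta> e13)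
      = (e13 \<otimes>\<^sub>\<zeta> omega - fps_X * (e12 \<otimes>\<^sub>\<zeta> e13) + 1 \<otimes>\<^sub>\<zeta> (e13 :: 'k U fps)) * extension"
    unfolding distrib_left distrib_right extension_e13
    by (simp only: extension_commute A13_commute mult_1_left mult_1_right)
  moreover have "e13 \<otimes>\<^sub>\<zeta> omega - fps_X * (e12 \<otimes>\<^sub>\<zeta> e13) + 1 \<otimes>\<^sub>\<zeta> e13
      = e13 \<otimes>\<^sub>\<zeta> omega + omega \<otimes>\<^sub>\<zeta> (e13 :: 'k U fps)"
    by (simp add: fps_tensor_linear omega_def[THEN arg_cong[where f = "\<lambda>u. u \<otimes>\<^sub>\<zeta> e13"]])
  ultimately show ?thesis
    unfolding ext_jordanian_def by (simp only: intertwine_mult)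
qed

lemma ext_jordanian_A13:
  "ext_jordanian * comul_fps (A13 :: 'k::field_char_0 U fps) = (in\<^sub>1 A13 + in\<^sub>2 A13) * ext_jordanian"
proof -
  let ?w = "fexp scalU (- sigma :: 'k U fps)"
  have "ext_jordanian * comul_fps ?w = (?w \<otimes>\<^sub>\<zeta> ?w) * ext_jordanian"
    unfolding fexp_minus_sigma_sigma[symmetric] comul.hom_fps_fexp comul.hom_fps_uminus
    by (rule expUU.fexp_intertwine)
      (simp_all add: ext_jordanian_sigma comul.hom_fps_nth comul.hom_zero fst2.hom_fps_nth
        snd2.hom_fps_nth tensor2_zero del: minus_add_distrib)
  then have "ext_jordanian * comul_fps (A13 :: 'k U fps)
      = ((e13 \<otimes>\<^sub>\<zeta> omega + omega \<otimes>\<^sub>\<zeta> e13) * (?w \<otimes>\<^sub>\<zeta> ?w)) * ext_jordanian"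
    by (simp only: A13_def comul.hom_fps_mult ext_jordanian_e13 mult.assoc flip: mult.assoc[of
        ext_jordanian])
  also have "(e13 \<otimes>\<^sub>\<zeta> omega + omega \<otimes>\<^sub>\<zeta> e13) * (?w \<otimes>\<^sub>\<zeta> ?w) = in\<^sub>1 A13 + in\<^sub>2 A13"
    by (simp only: in_eq distrib_right fps_tensor_mult omega_inverse A13_def)
  finally show ?thesis .
qed

lemma ext_jordanian_D2:
  "ext_jordanian * comul_fps (D2 :: 'k::field_char_0 U fps) = (in\<^sub>1 D2 + in\<^sub>2 D2) * ext_jordanian"
proof -
  have D2: "D2 * sigma = sigma * (D2 :: 'k U fps)"
    by (rule commute_omega(2)[OF generator_relations(6)])
  have "jordanian * (in\<^sub>1 D2 + in\<^sub>2 D2) = (in\<^sub>1 D2 + in\<^sub>2 (D2 :: 'k U fps)) * jordanian"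
    unfolding distrib_left distrib_right in_eq
    by (simp only: jordanian_commute D2 generator_relations(1) mult_1_left mult_1_right)
  moreover have "extension * (in\<^sub>1 D2 + in\<^sub>2 D2) = (in\<^sub>1 D2 + in\<^sub>2 (D2 :: 'k U fps)) * extension"
    unfolding extension_def in_eq
    by (rule expUU.fexp_intertwine[symmetric])
      (simp_all add: distrib_left distrib_right mult.assoc fps_tensor_mult fps_tensor_linear
        fps_X_left_commute[of "_ \<otimes>\<^sub>\<zeta> _"] generator_relations(9) D2_A13 del: fps_const_mult fps_const_add)
  moreover have "comul_fps D2 = in\<^sub>1 D2 + in\<^sub>2 (D2 :: 'k U fps)"
    by (simp only: comul_fps_generators in_eq)
  ultimately show ?thesis
    unfolding ext_jordanian_def by (simp only: intertwine_mult)
qed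

lemma ext_jordanian_e23:
  "ext_jordanian * comul_fps (e23 :: 'k::field_char_0 U fps)
    = (in\<^sub>1 e23 + in\<^sub>2 e23 - 2 * (fps_X * (in\<^sub>1 D2 * in\<^sub>2 A13))) * ext_jordanian"
proof -
  have "jordanian * comul_fps e23
      = (e23 \<otimes>\<^sub>\<zeta> 1 + 1 \<otimes>\<^sub>\<zeta> e23 - fps_X * (D1 \<otimes>\<^sub>\<zeta> (A13 :: 'k U fps))) * jordanian"
    unfolding comul_fps_generators distrib_left distrib_right add_diff_eq[symmetric]
    by (simp only: jordanian_commute generator_relations(4) jordanian_e23 mult_1_left mult_1_right)
  then show ?thesis
    unfolding ext_jordanian_def mult.assoc
    by (simp only: mult.assoc[symmetric] extension_e23)
      (simp only: mult.assoc fps_tensor_eq fst2.hom_fps_one snd2.hom_fps_one mult_1_left mult_1_right)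
qed

section \<open>The cocycle equation\<close>

lemma fexp_commute:
  assumes "f $ 0 = 0" "g $ 0 = 0" "f * g = g * f"
  shows "fexp scalUUU f * fexp scalUUU g = fexp scalUUU g * fexp scalUUU f"
  by (metis assms expUUU.fexp_add add.commute)

lemma intertwine_commuting:
  fixes x y u :: "'a::semigroup_mult"
  shows "g * u = u * g \<Longrightarrow> g * x = y * g \<Longrightarrow> g * (u * x) = (u * y) * g"
  by (metis mult.assoc)

lemma intertwine_product:
  fixes x y x' y' :: "'a::semigroup_mult"
  shows "g * x = x' * g \<Longrightarrow> g * y = y' * g \<Longrightarrow> g * (x * y) = x' * (y' * g)"
  by (metis mult.assoc)

lemma at_left_commute:
  "at\<^sub>2 g * (at\<^sub>1 f * x) = at\<^sub>1 f * (at\<^sub>2 g * x)" "at\<^sub>3 g * (at\<^sub>1 f * x) = at\<^sub>1 f * (at\<^sub>3 g * x)"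
  "at\<^sub>3 g * (at\<^sub>2 f * x) = at\<^sub>2 f * (at\<^sub>3 g * x)"
  by (simp_all only: at_commute flip: mult.assoc)

lemma at_mult:
  "at\<^sub>1 f * at\<^sub>1 g = at\<^sub>1 (f * g)" "at\<^sub>2 f * at\<^sub>2 g = at\<^sub>2 (f * g)" "at\<^sub>3 f * at\<^sub>3 g = at\<^sub>3 (f * g)"
  "at\<^sub>1 f * (at\<^sub>1 g * x) = at\<^sub>1 (f * g) * x" "at\<^sub>2 f * (at\<^sub>2 g * x) = at\<^sub>2 (f * g) * x"
  "at\<^sub>3 f * (at\<^sub>3 g * x) = at\<^sub>3 (f * (g :: 'k::field_char_0 U fps)) * x"
  by (simp_all only: fst3.hom_fps_mult snd3.hom_fps_mult trd3.hom_fps_mult mult.assoc)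

lemmas at_simps = mult.assoc at_commute at_left_commute at_mult
  fps_X_to_front[of "at\<^sub>1 _"] fps_X_to_front[of "at\<^sub>2 _"] fps_X_to_front[of "at\<^sub>3 _"]

lemma at_nth_0:
  "at\<^sub>1 f $ 0 = tensor3 (f $ 0) 1 1" "at\<^sub>2 f $ 0 = tensor3 1 (f $ 0) 1" "at\<^sub>3 f $ 0 = tensor3 1 1 (f $ 0)"
  by (simp_all add: fps_coeffwise_def)

lemma leg_at_commute:
  "fps_coeffwise leg12 x * at\<^sub>3 f = at\<^sub>3 f * fps_coeffwise leg12 x"
  "fps_coeffwise leg23 x * at\<^sub>1 f = at\<^sub>1 f * fps_coeffwise leg23 x"
  by (rule fps_coeffwise_commute; rule leg12_commute leg23_commute)+

lemma leg_comul_generators: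
  "fps_coeffwise leg12 (comul_fps (fps_const (E\<^sub>U i j)))
      = at\<^sub>1 (fps_const (E\<^sub>U i j)) + at\<^sub>2 (fps_const (E\<^sub>U i j))"
  "fps_coeffwise leg12 (comul_fps (fps_const (D\<^sub>U p))) = at\<^sub>1 (fps_const (D\<^sub>U p)) + at\<^sub>2 (fps_const (D\<^sub>U p))"
  unfolding comul_fps_generators in_eq[symmetric] leg12.hom_fps_add hom_in by (rule refl)+

text \<open>
  Write \<open>a\<^sub>i\<^sub>j = exp(\<zeta> E32\<^sub>i A\<^sub>j)\<close> and \<open>b\<^sub>i\<^sub>j = exp(D1\<^sub>i \<sigma>\<^sub>j)\<close>, the subscripts being
  tensor factors. As \<open>A\<close> and \<open>\<sigma>\<close> are primitive under \<open>\<Delta>\<^sub>J\<close>, the right-hand side is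
  \<open>a\<^sub>1\<^sub>2 a\<^sub>1\<^sub>3 b\<^sub>1\<^sub>2 b\<^sub>1\<^sub>3 a\<^sub>2\<^sub>3 b\<^sub>2\<^sub>3\<close>; the left-hand side is \<open>a\<^sub>1\<^sub>2 b\<^sub>1\<^sub>2 a\<^sub>1\<^sub>3 a\<^sub>2\<^sub>3 b\<^sub>1\<^sub>3 b\<^sub>2\<^sub>3\<close>. They agree because
  \<open>b\<^sub>1\<^sub>2\<close> commutes with \<open>a\<^sub>1\<^sub>3\<close> and \<open>b\<^sub>1\<^sub>3\<close> with \<open>a\<^sub>2\<^sub>3\<close>.
\<close>

lemma ext_jordanian_cocycle:
  "fps_coeffwise leg12 ext_jordanian * fps_coeffwise comul_id ext_jordanian
    = fps_coeffwise leg23 ext_jordanian * fps_coeffwise id_comul (ext_jordanian ::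
        'k::field_char_0 UU fps)"
proof -
  let ?e = "fexp (scalUUU :: 'k \<Rightarrow> 'k UUU)"
  let ?A = "A13 :: 'k U fps" and ?s = "sigma :: 'k U fps"
  define a12 a13 a23 where a: "a12 = ?e (fps_X * (at\<^sub>1 e32 * at\<^sub>2 ?A))"
    "a13 = ?e (fps_X * (at\<^sub>1 e32 * at\<^sub>3 ?A))" "a23 = ?e (fps_X * (at\<^sub>2 e32 * at\<^sub>3 ?A))"
  define b12 b13 b23 where b: "b12 = ?e (at\<^sub>1 D1 * at\<^sub>2 ?s)"
    "b13 = ?e (at\<^sub>1 D1 * at\<^sub>3 ?s)" "b23 = ?e (at\<^sub>2 D1 * at\<^sub>3 ?s)"
  note [simp] = at_nth_0 fst3.hom_zero snd3.hom_zero trd3.hom_zero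
  have J12: "fps_coeffwise leg12 ext_jordanian = a12 * b12"
    and J23: "fps_coeffwise leg23 ext_jordanian = a23 * b23"
    by (simp_all only: ext_jordanian_def extension_def jordanian_def fps_tensor_eq
        leg12.hom_fps_simps leg23.hom_fps_simps hom_in a b)
  have "fps_coeffwise comul_id (ext_jordanian :: 'k UU fps)
      = ?e (fps_X * (at\<^sub>1 e32 * at\<^sub>3 ?A) + fps_X * (at\<^sub>2 e32 * at\<^sub>3 ?A)) * ?e (at\<^sub>1 D1 * at\<^sub>3 ?s + at\<^sub>2
          D1 * at\<^sub>3 ?s)"
    by (simp only: ext_jordanian_def extension_def jordanian_def fps_tensor_eq
        comul_id.hom_fps_simps hom_in leg_comul_generators distrib_left distrib_right)
  also have "?e (fps_X * (at\<^sub>1 e32 * at\<^sub>3 ?A) + fps_X * (at\<^sub>2 e32 * at\<^sub>3 ?A)) = a13 * a23"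
    unfolding a by (rule expUUU.fexp_add) (simp_all, simp_all only: at_simps)
  also have "?e (at\<^sub>1 D1 * at\<^sub>3 ?s + at\<^sub>2 D1 * at\<^sub>3 ?s) = b13 * b23"
    unfolding b by (rule expUUU.fexp_add) (simp_all, simp_all only: at_simps)
  finally have comul_id: "fps_coeffwise comul_id (ext_jordanian :: 'k UU fps)
      = (a13 * a23) * (b13 * b23)" .
  let ?J = "fps_coeffwise leg23 (ext_jordanian :: 'k UU fps)"
  have ext: "?J * fps_coeffwise id_comul extension = (a12 * a13) * ?J"
  proof -
    have "?J * fps_coeffwise leg23 (comul_fps ?A) = (at\<^sub>2 ?A + at\<^sub>3 ?A) * ?J"
      using arg_cong[OF ext_jordanian_A13, of "fps_coeffwise leg23"]
      by (simp only: leg23.hom_fps_mult leg23.hom_fps_add hom_in)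
    then have "?J * (fps_X * (at\<^sub>1 e32 * fps_coeffwise leg23 (comul_fps ?A)))
        = (fps_X * (at\<^sub>1 e32 * (at\<^sub>2 ?A + at\<^sub>3 ?A))) * ?J"
      by (intro intertwine_commuting leg_at_commute fps_mult_fps_X_commute[symmetric])
    then have "?J * ?e (fps_X * (at\<^sub>1 e32 * fps_coeffwise leg23 (comul_fps ?A)))
        = ?e (fps_X * (at\<^sub>1 e32 * at\<^sub>2 ?A) + fps_X * (at\<^sub>1 e32 * at\<^sub>3 ?A)) * ?J"
      by (intro expUUU.fexp_intertwine) (simp_all add: distrib_left)
    also have "?e (fps_X * (at\<^sub>1 e32 * at\<^sub>2 ?A) + fps_X * (at\<^sub>1 e32 * at\<^sub>3 ?A)) = a12 * a13"
      unfolding a by (rule expUUU.fexp_add) (simp_all, simp_all only: at_simps)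
    finally show ?thesis
      by (simp only: extension_def fps_tensor_eq id_comul.hom_fps_simps hom_in)
  qed
  have jor: "?J * fps_coeffwise id_comul jordanian = (b12 * b13) * ?J"
  proof -
    have "?J * fps_coeffwise leg23 (comul_fps ?s) = (at\<^sub>2 ?s + at\<^sub>3 ?s) * ?J"
      using arg_cong[OF ext_jordanian_sigma, of "fps_coeffwise leg23"]
      by (simp only: leg23.hom_fps_mult leg23.hom_fps_add hom_in)
    then have "?J * (at\<^sub>1 D1 * fps_coeffwise leg23 (comul_fps ?s))
        = (at\<^sub>1 D1 * (at\<^sub>2 ?s + at\<^sub>3 ?s)) * ?J"
      by (intro intertwine_commuting leg_at_commute)
    then have "?J * ?e (at\<^sub>1 D1 * fps_coeffwise leg23 (comul_fps ?s))
        = ?e (at\<^sub>1 D1 * at\<^sub>2 ?s + at\<^sub>1 D1 * at\<^sub>3 ?s) * ?J"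
      by (intro expUUU.fexp_intertwine)
        (simp_all add: distrib_left leg23.hom_fps_nth comul.hom_fps_nth comul.hom_zero leg23.hom_zero)
    also have "?e (at\<^sub>1 D1 * at\<^sub>2 ?s + at\<^sub>1 D1 * at\<^sub>3 ?s) = b12 * b13"
      unfolding b by (rule expUUU.fexp_add) (simp_all, simp_all only: at_simps)
    finally show ?thesis
      by (simp only: jordanian_def fps_tensor_eq id_comul.hom_fps_simps hom_in)
  qed
  have ba: "b12 * a13 = a13 * b12"
    unfolding a b by (rule fexp_commute) (simp_all, simp_all only: at_simps generator_relations(5))
  have ab: "a23 * b13 = b13 * a23"
    unfolding a b by (rule fexp_commute) (simp_all, simp_all only: at_simps A13_commute)
  have "?J * fps_coeffwise id_comul (ext_jordanian :: 'k UU fps)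
      = a12 * a13 * (b12 * b13 * (a23 * b23))"
    unfolding ext_jordanian_def[THEN arg_cong[where f = "fps_coeffwise id_comul"]] id_comul.hom_fps_mult
      intertwine_product[OF ext jor] unfolding J23 by (rule refl)
  also have "\<dots> = a12 * (a13 * b12) * (b13 * a23) * b23"
    by (simp only: mult.assoc)
  also have "\<dots> = (a12 * b12) * ((a13 * a23) * (b13 * b23))"
    by (simp only: mult.assoc flip: ba ab)
  finally show ?thesis
    by (simp only: J12 comul_id)
qed

definition Phi :: "'k::field_char_0 UU fps" where
  "Phi = fpower scalUU (twist_base (in\<^sub>2 e23) (in\<^sub>2 A13) (in\<^sub>1 D2)) (in\<^sub>1 D2)"

text \<open>
  Here \<open>M\<close> and \<open>M'\<close> are the images of \<open>\<Phi>\<close> under \<open>\<Delta>\<^sub>J \<otimes> id\<close> and \<open>id \<otimes> \<Delta>\<^sub>J\<close>, so this is the cocycle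
  equation of \<open>\<Phi>\<close> for \<open>\<Delta>\<^sub>J\<close>; it is \<open>twist_base_cocycle\<close> with \<open>D2\<close> in the first factor as \<open>x\<close> and \<open>D2\<close>
  in the second as \<open>d\<close>.
\<close>

lemma Phi_cocycle:
  fixes J12 J23
  defines "J12 \<equiv> fps_coeffwise leg12 (ext_jordanian :: 'k::field_char_0 UU fps)"
    and "J23 \<equiv> fps_coeffwise leg23 (ext_jordanian :: 'k UU fps)"
  shows "\<exists>M M'. J12 * fps_coeffwise comul_id Phi = M * J12 \<and> J23 * fps_coeffwise id_comul Phi = M' * J23
    \<and> fps_coeffwise leg12 Phi * M = fps_coeffwise leg23 Phi * M'"
proof -
  let ?A = "A13 :: 'k U fps"
  let ?M = "fpower scalUUU (twist_base (at\<^sub>3 e23) (at\<^sub>3 ?A) (at\<^sub>1 D2 + at\<^sub>2 D2)) (at\<^sub>1 D2 + at\<^sub>2 D2)"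
  let ?M' = "fpower scalUUU (twist_base (at\<^sub>2 e23 + at\<^sub>3 e23 - 2 * (fps_X * (at\<^sub>2 D2 * at\<^sub>3 ?A)))
    (at\<^sub>2 ?A + at\<^sub>3 ?A) (at\<^sub>1 D2)) (at\<^sub>1 D2)"
  have "J12 * (at\<^sub>1 D2 + at\<^sub>2 D2) = (at\<^sub>1 D2 + at\<^sub>2 D2) * J12"
    using arg_cong[OF ext_jordanian_D2[where 'k = 'k], of "fps_coeffwise leg12"]
    by (simp only: leg12.hom_fps_mult leg12.hom_fps_add hom_in leg_comul_generators J12_def)
  then have "J12 * ?M = ?M * J12"
    by (intro expUUU.fpower_intertwine twist_base_intertwine)
      (simp_all add: J12_def leg_at_commute)
  moreover have "fps_coeffwise comul_id Phi = ?M"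
    by (simp only: Phi_def comul_id.hom_fps_simps comul_id.hom_fps_twist_base hom_in leg_comul_generators)
  moreover have "J23 * fps_coeffwise leg23 (comul_fps ?A) = (at\<^sub>2 ?A + at\<^sub>3 ?A) * J23"
    using arg_cong[OF ext_jordanian_A13, of "fps_coeffwise leg23"]
    by (simp only: leg23.hom_fps_mult leg23.hom_fps_add hom_in J23_def)
  moreover have "J23 * fps_coeffwise leg23 (comul_fps e23)
      = (at\<^sub>2 e23 + at\<^sub>3 e23 - 2 * (fps_X * (at\<^sub>2 D2 * at\<^sub>3 ?A))) * J23"
    using arg_cong[OF ext_jordanian_e23[where 'k = 'k], of "fps_coeffwise leg23"]
    by (simp only: leg23.hom_fps_simps mult_2 hom_in J23_def)
  moreover have "fps_coeffwise id_comul Phi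
      = fpower scalUUU (twist_base (fps_coeffwise leg23 (comul_fps e23))
      (fps_coeffwise leg23 (comul_fps ?A)) (at\<^sub>1 D2)) (at\<^sub>1 D2)"
    by (simp only: Phi_def id_comul.hom_fps_simps id_comul.hom_fps_twist_base hom_in)
  ultimately have 1: "J12 * fps_coeffwise comul_id Phi = ?M * J12"
    and 2: "J23 * fps_coeffwise id_comul Phi = ?M' * J23"
    by (simp_all only:, intro expUUU.fpower_intertwine twist_base_intertwine)
      (simp_all add: J23_def leg_at_commute)
  let ?x = "tensor3 (D\<^sub>U 2 :: 'k U) 1 1" and ?d = "tensor3 1 (D\<^sub>U 2 :: 'k U) 1"
  have const: "at\<^sub>1 D2 = fps_const ?x" "at\<^sub>2 D2 = fps_const ?d"
    by (simp_all only: fst3.hom_fps_const snd3.hom_fps_const)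
  have "fpower scalUUU (twist_base (at\<^sub>2 e23) (at\<^sub>2 ?A) (fps_const ?x)) (fps_const ?x)
      * fpower scalUUU (twist_base (at\<^sub>3 e23) (at\<^sub>3 ?A) (fps_const ?x + fps_const ?d)) (fps_const
          ?x + fps_const ?d)
    = fpower scalUUU (twist_base (at\<^sub>3 e23) (at\<^sub>3 ?A) (fps_const ?d)) (fps_const ?d)
      * fpower scalUUU (twist_base (at\<^sub>2 e23 + at\<^sub>3 e23 - 2 * (fps_X * (fps_const ?d * at\<^sub>3 ?A)))
          (at\<^sub>2 ?A + at\<^sub>3 ?A) (fps_const ?x)) (fps_const ?x)"
  proof (rule expUUU.twist_base_cocycle, unfold const[symmetric])
    show "at\<^sub>2 ?A * at\<^sub>2 e23 = at\<^sub>2 e23 * at\<^sub>2 ?A + fps_X * (at\<^sub>2 ?A * at\<^sub>2 ?A)"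
      using arg_cong[OF A13_e23, of at\<^sub>2] by (simp only: snd3.hom_fps_simps)
    show "at\<^sub>3 ?A * at\<^sub>3 e23 = at\<^sub>3 e23 * at\<^sub>3 ?A + fps_X * (at\<^sub>3 ?A * at\<^sub>3 ?A)"
      using arg_cong[OF A13_e23, of at\<^sub>3] by (simp only: trd3.hom_fps_simps)
    show "at\<^sub>2 D2 * at\<^sub>2 e23 = at\<^sub>2 e23 * (at\<^sub>2 (D2 :: 'k U fps) + 1)"
      using arg_cong[OF generator_relations(8), of at\<^sub>2]
      by (simp only: snd3.hom_fps_mult snd3.hom_fps_add distrib_left mult_1_right)
    show "at\<^sub>2 D2 * at\<^sub>2 ?A = at\<^sub>2 ?A * (at\<^sub>2 D2 + 1)"
      using arg_cong[OF D2_A13, of at\<^sub>2]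
      by (simp only: snd3.hom_fps_mult snd3.hom_fps_add distrib_left mult_1_right)
  qed (simp_all only: at_commute)
  then have "fps_coeffwise leg12 Phi * ?M = fps_coeffwise leg23 Phi * ?M'"
    by (simp only: Phi_def leg12.hom_fps_simps leg23.hom_fps_simps leg12.hom_fps_twist_base
        leg23.hom_fps_twist_base hom_in flip: const)
  then show ?thesis using 1 2 by blast
qed


section \<open>The twist and its universal R-matrix\<close>

definition twist :: "'k::field_char_0 UU fps" where
  "twist = Phi * ext_jordanian"

lemma twist_cocycle:
  "fps_coeffwise leg12 twist * fps_coeffwise comul_id twist
    = fps_coeffwise leg23 twist * fps_coeffwise id_comul (twist :: 'k::field_char_0 UU fps)"
proof -
  let ?J = "ext_jordanian :: 'k UU fps" and ?P = "Phi :: 'k UU fps"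
  let ?J12 = "fps_coeffwise leg12 ?J" and ?J23 = "fps_coeffwise leg23 ?J"
  obtain M M' where M: "?J12 * fps_coeffwise comul_id ?P = M * ?J12"
    "?J23 * fps_coeffwise id_comul ?P = M' * ?J23"
    "fps_coeffwise leg12 ?P * M = fps_coeffwise leg23 ?P * M'"
    using Phi_cocycle by blast
  have "fps_coeffwise leg12 twist * fps_coeffwise comul_id twist
      = fps_coeffwise leg12 ?P * (?J12 * fps_coeffwise comul_id ?P) * fps_coeffwise comul_id ?J"
    by (simp only: twist_def leg12.hom_fps_mult comul_id.hom_fps_mult mult.assoc)
  also have "\<dots> = (fps_coeffwise leg12 ?P * M) * (?J12 * fps_coeffwise comul_id ?J)"
    by (simp only: M(1) mult.assoc)
  also have "\<dots> = fps_coeffwise leg23 ?P * (M' * ?J23) * fps_coeffwise id_comul ?J"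
    by (simp only: M(3) ext_jordanian_cocycle mult.assoc)
  also have "\<dots> = fps_coeffwise leg23 twist * fps_coeffwise id_comul twist"
    by (simp only: M(2)[symmetric] twist_def leg23.hom_fps_mult id_comul.hom_fps_mult mult.assoc)
  finally show ?thesis .
qed

lemma counit_generators: "counit (E\<^sub>U i j) = 0" "counit (D\<^sub>U p) = 0"
  by (simp_all add: E\<^sub>U_def D\<^sub>U_def U_of_matrix_def counit_\<iota>)

lemma counits_in:
  "fps_coeffwise counit_id (in\<^sub>1 (fps_const (E\<^sub>U i j :: 'k::field_char_0 U))) = 0"
  "fps_coeffwise counit_id (in\<^sub>1 (fps_const (D\<^sub>U p :: 'k U))) = 0"
  "fps_coeffwise id_counit (in\<^sub>2 (fps_const (E\<^sub>U i j :: 'k U))) = 0"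
  by (simp_all add: fst2.hom_fps_const snd2.hom_fps_const counit_id.hom_fps_const
      id_counit.hom_fps_const structure_maps_tensor counit_generators scalU.scal_zero)

lemma counit_id_twist: "fps_coeffwise counit_id (twist :: 'k::field_char_0 UU fps) = 1"
  by (simp add: twist_def Phi_def ext_jordanian_def extension_def jordanian_def fps_tensor_eq
      counit_id.hom_fps_simps counits_in fpower_def)

lemma id_counit_twist: "fps_coeffwise id_counit (twist :: 'k::field_char_0 UU fps) = 1"
proof -
  have A13: "fps_coeffwise id_counit (in\<^sub>2 A13) = (0 :: 'k U fps)"
    by (simp add: A13_def snd2.hom_fps_mult id_counit.hom_fps_mult counits_in)
  have sigma: "fps_coeffwise id_counit (in\<^sub>2 sigma) = (0 :: 'k U fps)"
    by (simp add: sigma_def omega_def snd2.hom_fps_simps id_counit.hom_fps_simps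
        structure_maps_tensor counit_generators scalU.scal_zero)
  show ?thesis
    by (simp add: twist_def Phi_def ext_jordanian_def extension_def jordanian_def fps_tensor_eq
        id_counit.hom_fps_simps id_counit.hom_fps_twist_base counits_in A13 sigma)
      (simp add: twist_base_def fpower_def)
qed

lemma twist_base_nth_1: "twist_base E A x $ 1 = - (E $ 0)"
  by (simp add: twist_base_def power2_eq_square mult.assoc)

lemma twist_nth_0: "twist $ 0 = 1"
  by (simp add: twist_def Phi_def fpower_def ext_jordanian_def extension_def jordanian_def)

lemma twist_nth_1:
  "twist $ 1 = E\<^sub>U 3 2 \<otimes>\<^sub>U E\<^sub>U 1 3 - D\<^sub>U 2 \<otimes>\<^sub>U E\<^sub>U 2 3 - D\<^sub>U 1 \<otimes>\<^sub>U (E\<^sub>U 1 2 :: 'k::field_char_0 U)"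
proof -
  have "Phi $ 1 = - (D\<^sub>U 2 \<otimes>\<^sub>U (E\<^sub>U 2 3 :: 'k U))"
    by (simp add: Phi_def fpower_def expUU.fexp_nth_1 expUU.fln_nth_1 fps_mult_nth_1 twist_base_nth_1
        fst2.hom_fps_nth snd2.hom_fps_nth tensor2_mult)
  moreover have "extension $ 1 = E\<^sub>U 3 2 \<otimes>\<^sub>U (E\<^sub>U 1 3 :: 'k U)"
    by (simp add: extension_def expUU.fexp_nth_1 A13_def)
  moreover have "jordanian $ 1 = - (D\<^sub>U 1 \<otimes>\<^sub>U (E\<^sub>U 1 2 :: 'k U))"
    by (simp add: jordanian_def expUU.fexp_nth_1 tensor2_zero fps_tensor_eq fps_mult_nth_1
        sigma_def expU.fln_nth_1 omega_def fst2.hom_fps_nth snd2.hom_fps_nth tensor2_mult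
        snd2.hom_zero tensor2_diff_right[of _ 0, simplified])
  moreover have "Phi $ 0 = (1 :: 'k UU)" "extension $ 0 = (1 :: 'k UU)" "jordanian $ 0 = (1 :: 'k UU)"
    by (simp_all add: Phi_def fpower_def extension_def jordanian_def)
  ultimately show ?thesis
    by (simp add: twist_def ext_jordanian_def fps_mult_nth_1)
qed

lemma is_inverse_mult: "is_inverse x x' \<Longrightarrow> is_inverse y y' \<Longrightarrow> is_inverse (x * y) (y' * x')"
  unfolding is_inverse_def by (metis mult.assoc mult_1_left)

lemma is_inverse_unique: "is_inverse x y \<Longrightarrow> is_inverse x z \<Longrightarrow> y = z"
  unfolding is_inverse_def by (metis mult.assoc mult_1_left mult_1_right)

lemma (in scalars_char_0) is_inverse_fexp: "f $ 0 = 0 \<Longrightarrow> is_inverse (fexp \<eta> f) (fexp \<eta> (- f))"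
  by (simp add: is_inverse_def fexp_minus)

lemma twist_inverse: "\<exists>G. is_inverse twist G"
  unfolding twist_def Phi_def fpower_def ext_jordanian_def extension_def jordanian_def
  by (rule exI, rule is_inverse_mult[OF expUU.is_inverse_fexp
        is_inverse_mult[OF expUU.is_inverse_fexp expUU.is_inverse_fexp]])
    (simp_all add: tensor2_zero)

lemma is_twist_twist: "is_twist (twist :: 'k::field_char_0 UU fps)"
  unfolding is_twist_def
  by (intro conjI twist_inverse twist_cocycle counit_id_twist id_counit_twist)

lemma flip2_one: "flip2 1 = 1"
  by (simp add: structure_maps_tensor flip: tensor2_one)

lemma flip2_diff: "flip2 (x - y) = flip2 x - flip2 y"
  using structure_maps_add(5)[of "x - y" y] by simp

lemma universal_R_nth:
  assumes "is_inverse F G" "F $ 0 = 1"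
  shows "universal_R F $ 0 = 1" "universal_R F $ 1 = flip2 (F $ 1) - F $ 1"
proof -
  have "(THE G. is_inverse F G) = G"
    using assms(1) is_inverse_unique by blast
  then have R: "universal_R F = fps_coeffwise flip2 F * G"
    by (simp add: universal_R_def)
  have FG: "F * G = 1" using assms(1) by (simp add: is_inverse_def)
  have G0: "G $ 0 = 1" using arg_cong[OF FG, of "\<lambda>f. f $ 0"] by (simp add: assms)
  have G1: "G $ 1 = - (F $ 1)"
    using arg_cong[OF FG, of "\<lambda>f. f $ 1"] by (simp add: assms G0 fps_mult_nth_1 eq_neg_iff_add_eq_0)
  show "universal_R F $ 0 = 1" "universal_R F $ 1 = flip2 (F $ 1) - F $ 1"
    by (simp_all add: R fps_mult_nth_1 G0 G1 fps_coeffwise_def assms flip2_one)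
qed

lemma fps_eq_first_order:
  fixes f :: "'a::ring_1 fps"
  shows "f = fps_const (f $ 0) + fps_X * fps_const (f $ 1) + fps_X\<^sup>2 * fps_shift 2 f"
proof (rule fps_ext)
  fix n :: nat
  show "f $ n = (fps_const (f $ 0) + fps_X * fps_const (f $ 1) + fps_X\<^sup>2 * fps_shift 2 f) $ n"
  proof (cases "n < 2")
    case True
    then consider "n = 0" | "n = 1" by linarith
    then show ?thesis by cases (simp_all add: fps_X_power_mult_nth)
  next
    case False
    then obtain m where "n = m + 2" by (metis le_add_diff_inverse2 not_less)
    then show ?thesis by (simp add: fps_X_power_mult_nth)
  qed
qed

theorem mainTheorem2:
  fixes \<sigma> :: "'k::field_char_0 U fps" and F :: "'k UU fps" and r :: "'k UU"
  assumes "\<sigma> = fln scalU (1 - fps_X * fps_const (E\<^sub>U 1 2))"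
    and "F =
      fpow (1 \<otimes>\<^sub>\<zeta> 1 - fps_X * (1 \<otimes>\<^sub>\<zeta> fps_const (E\<^sub>U 2 3))
            + fps_X\<^sup>2 * (fps_const (D\<^sub>U 2) \<otimes>\<^sub>\<zeta> (fps_const (E\<^sub>U 1 3) * fexp scalU (- \<sigma>))))
           (fps_const (D\<^sub>U 2) \<otimes>\<^sub>\<zeta> 1)
      * fexp scalUU (fps_X * (fps_const (E\<^sub>U 3 2) \<otimes>\<^sub>\<zeta> (fps_const (E\<^sub>U 1 3) * fexp scalU (- \<sigma>))))
      * fexp scalUU (fps_const (D\<^sub>U 1) \<otimes>\<^sub>\<zeta> \<sigma>)"
    and "r = D\<^sub>U 1 \<and>\<^sub>U E\<^sub>U 1 2 + D\<^sub>U 2 \<and>\<^sub>U E\<^sub>U 2 3 + E\<^sub>U 1 3 \<and>\<^sub>U E\<^sub>U 3 2"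
  shows "is_twist F \<and>
    (\<exists>S. universal_R F = 1 \<otimes>\<^sub>\<zeta> 1 + fps_X * fps_const r + fps_X\<^sup>2 * S)"
proof -
  have \<sigma>: "\<sigma> = sigma"
    by (simp only: assms(1) sigma_def omega_def)
  have F: "F = twist"
    unfolding assms(2) \<sigma> A13_def[symmetric] twist_def Phi_def ext_jordanian_def extension_def
      jordanian_def twist_base_def fpow_def fpower_def fps_tensor_one
    by (simp only: fps_tensor_eq fst2.hom_fps_one snd2.hom_fps_one mult_1_left mult_1_right mult.assoc)
  obtain G where "is_inverse (twist :: 'k UU fps) G"
    using twist_inverse by blast
  note R = universal_R_nth[OF this twist_nth_0]
  have "r = flip2 (twist $ 1) - twist $ 1"
    by (simp add: assms(3) wedge_def twist_nth_1 flip2_diff structure_maps_tensor)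
  then have "universal_R F = 1 \<otimes>\<^sub>\<zeta> 1 + fps_X * fps_const r + fps_X\<^sup>2 * fps_shift 2 (universal_R F)"
    using fps_eq_first_order[of "universal_R F"] by (simp only: F R fps_tensor_one fps_const_1_eq_1)
  then show ?thesis
    using is_twist_twist unfolding F by blast
qed

end
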